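(* Let $V$ be a rational vector space with lattice $V_{\mathbb Z}$. Let $\mathfrak p\subset V$ be a simple (full-dimensional) rational polytope and let $\mathfrak f$ be a face of $\mathfrak p$. Let $\mathfrak t_{\rm trans}(\mathfrak p,\mathfrak f)\subset V/\operatorname{lin}\mathfrak f$ be the transverse cone. Write $s+\mathfrak c_s$ for the tangent cone to $\mathfrak p$ at a vertex $s$, and for $\xi\in V^*$ let $$S(s+\mathfrak c_s)(\xi)=\sum_{x\in(s+\mathfrak c_s)\cap V_{\mathbb Z}}e^{\langle\xi,x\rangle}$$ (understood as a meromorphic function of $\xi$). Let $\mathcal V(\mathfrak f)$ be the set of vertices of $\mathfrak f$. (i) The sum $\sum_{s\in\mathcal V(\mathfrak f)}S(s+\mathfrak c_s)(\xi)$ restricts to a meromorphic function on $(\operatorname{lin}\mathfrak f)^\perp\subset V^*$, which is given by $$\sum_{s\in\mathcal V(\mathfrak f)}S(s+\mathfrak c_s)(\xi)=\sum_{y\in\mathfrak t_{\rm trans}(\mathfrak p,\mathfrak f)\cap(V/\operatorname{lin}\mathfrak f)_{\mathbb Z}}e^{\langle\xi,y\rangle}P(y),$$ where $P(y)$ is a quasi-polynomial function on the projected lattice $(V/\operatorname{lin}\mathfrak f)_{\mathbb Z}\subset V/\operatorname{lin}\mathfrak f$. Moreover, if $\xi\in(\operatorname{lin}\mathfrak f)^\perp$ is regular with respect to the cone $\mathfrak t_{\rm trans}(\mathfrak p,\mathfrak f)$, that is, if $\xi$ is not constant on any face of $\mathfrak p$ strictly containing $\mathfrak f$, then $\sum_{s\in\mathcal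 V(\mathfrak f)}S(s+\mathfrak c_s)(\xi)$ is holomorphic at $\xi$. (ii) For $y\in\mathfrak t_{\rm trans}(\mathfrak p,\mathfrak f)\cap(V/\operatorname{lin}\mathfrak f)_{\mathbb Z}$ close enough to the vertex $y_0$ of the transverse cone, $P(y)$ is the number of lattice points (points of $V_{\mathbb Z}$) of the slice $\mathfrak p\cap(\operatorname{lin}\mathfrak f+y)$.
   Context: $V$ is a finite-dimensional real vector space with a lattice $V_{\mathbb Z}$. $\operatorname{lin}\mathfrak f$ is the linear subspace of $V$ spanned by the differences $x-x'$, $x,x'\in\mathfrak f$. $(\operatorname{lin}\mathfrak f)^\perp\subset V^*$ is identified with $(V/\operatorname{lin}\mathfrak f)^*$, so $\langle\xi,y\rangle$ makes sense for $\xi\in(\operatorname{lin}\mathfrak f)^\perp$, $y\in V/\operatorname{lin}\mathfrak f$. $(V/\operatorname{lin}\mathfrak f)_{\mathbb Z}$ is the image of $V_{\mathbb Z}$ in $V/\operatorname{lin}\mathfrak f$. The transverse cone $\mathfrak t_{\rm trans}(\mathfrak p,\mathfrak f)$ is the image in $V/\operatorname{lin}\mathfrak f$ of the affine tangent cone to $\mathfrak p$ at $\mathfrak f$; it is a salient cone whose vertex $y_0$ is the image of any point of $\mathfrak f$. For $y\in V/\operatorname{lin}\mathfrak f$, $\operatorname{lin}\mathfrak f+y$ is the affine subspace of $V$ which is the preimage of $y$. The polytope is simple: each vertex belongs to exactly $\dim V$ facets. Meaning of the sums as meromorphic functions: let $\mathfrak q=s+\mathfrak c$ be a cone in a space $V$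 with lattice $V_{\mathbb Z}$, with $\mathfrak c$ generated by elements $g_j\in V_{\mathbb Z}$, and let $P$ be a quasi-polynomial function on $V_{\mathbb Z}$. The sum $\sum_{x\in V_{\mathbb Z}\cap\mathfrak q}P(x)e^{\langle\xi,x\rangle}$ defines a generalized function of $\xi\in iV^*$ which, outside the affine hyperplanes $\langle\xi,g_j\rangle\in 2i\pi\mathbb Z$, coincides with a meromorphic function of $\xi\in V^*_{\mathbb C}$ with poles on $\langle\xi,g_j\rangle\in2i\pi\mathbb Z$; the sum denotes this meromorphic function (for $P=1$ it is the usual generating function $S(\mathfrak q)$ of the cone). A function $f$ on a lattice $\Lambda$ of a real vector space $E$ is quasi-polynomial if there is a sublattice $\Lambda'\subset\Lambda$ (of finite index) such that for every $\lambda_0\in\Lambda$, $\lambda'\mapsto f(\lambda_0+\lambda')$ is the restriction to $\Lambda'$ of a polynomial function on $E$. *)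

theory Defs
  imports "HOL-Analysis.Analysis"
begin

section \<open>Lattices and quasi-polynomial functions\<close>

definition is_lattice :: "'a::euclidean_space set \<Rightarrow> bool" where
  "is_lattice \<Lambda> \<longleftrightarrow>
     (\<exists>B. independent B \<and> \<Lambda> = range (\<lambda>c :: 'a \<Rightarrow> int. \<Sum>b\<in>B. real_of_int (c b) *\<^sub>R b))"

definition is_full_lattice :: "'a::euclidean_space set \<Rightarrow> bool" where
  "is_full_lattice \<Lambda> \<longleftrightarrow> is_lattice \<Lambda> \<and> span \<Lambda> = UNIV"

definition rational_points :: "'a::euclidean_space set \<Rightarrow> 'a set" where
  "rational_points \<Lambda> = {x. \<exists>N::nat. N > 0 \<and> real N *\<^sub>R x \<in> \<Lambda>}"

text \<open>
  Only the values of \<open>P\<close> on \<open>\<Lambda>\<close> matter.  The polynomial may be taken on the whole ambient space,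
  since a polynomial function on the span of \<open>\<Lambda>\<close> extends to it.
\<close>

definition quasi_polynomial_on :: "'a::euclidean_space set \<Rightarrow> ('a \<Rightarrow> real) \<Rightarrow> bool" where
  "quasi_polynomial_on \<Lambda> P \<longleftrightarrow>
     (\<exists>\<Lambda>'. is_lattice \<Lambda>' \<and> \<Lambda>' \<subseteq> \<Lambda> \<and> finite ((\<lambda>x. (+) x ` \<Lambda>') ` \<Lambda>) \<and>
        (\<forall>x0\<in>\<Lambda>. \<exists>p. real_polynomial_function p \<and> (\<forall>x\<in>\<Lambda>'. P (x0 + x) = p x)))"

section \<open>Polytopes and tangent cones\<close>

definition rational_polytope :: "'a::euclidean_space set \<Rightarrow> 'a set \<Rightarrow> bool" where
  "rational_polytope \<Lambda> p \<longleftrightarrow>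
     (\<exists>X. finite X \<and> X \<subseteq> rational_points \<Lambda> \<and> p = convex hull X)"

definition vertices :: "'a::real_vector set \<Rightarrow> 'a set" where
  "vertices p = {s. s extreme_point_of p}"

definition simple_polytope :: "'a::euclidean_space set \<Rightarrow> bool" where
  "simple_polytope p \<longleftrightarrow> polytope p \<and> aff_dim p = int DIM('a) \<and>
     (\<forall>s\<in>vertices p. card {F. F facet_of p \<and> s \<in> F} = DIM('a))"

definition lin :: "'a::real_vector set \<Rightarrow> 'a set" where
  "lin f = span {x - x' | x x'. x \<in> f \<and> x' \<in> f}"

text \<open>The affine tangent cone to \<open>p\<close> at \<open>f\<close>; for \<open>f = {s}\<close> it is the cone \<open>s + c\<^sub>s\<close>.\<close>

definition tangent_cone :: "'a::real_vector set \<Rightarrow> 'a set \<Rightarrow> 'a set" where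
  "tangent_cone p f = {x + t *\<^sub>R (z - x) | x z t. x \<in> f \<and> z \<in> p \<and> 0 \<le> t}"

section \<open>Meromorphic functions on the complexified dual\<close>

text \<open>
  The complexified dual \<open>V\<^sup>*\<^sub>\<complex> = Hom\<^sub>\<real>(V, \<complex>)\<close> is the type of (bounded) real-linear maps
  from \<open>'a\<close> to \<open>complex\<close>; multiplication by \<open>\<i>\<close> acts on the values.  Holomorphic means Frechet
  differentiable with complex-linear derivative.
\<close>

definition holomorphic_dual ::
    "('a::euclidean_space \<Rightarrow>\<^sub>L complex) set \<Rightarrow> (('a \<Rightarrow>\<^sub>L complex) \<Rightarrow> complex) \<Rightarrow> bool" where
  "holomorphic_dual U F \<longleftrightarrow>
     (\<forall>\<xi>\<in>U. \<exists>D. (F has_derivative D) (at \<xi>) \<and>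
        (\<forall>h. D (blinfun_mult_right \<i> o\<^sub>L h) = \<i> * D h))"

text \<open>
  Meromorphic functions are represented by total functions whose values on a closed nowhere dense
  set are irrelevant: \<open>F\<close> is represented by the quotient \<open>a / b\<close> on \<open>U\<close> if it agrees with it on a
  dense open subset of \<open>U\<close>.
\<close>

definition local_quotient ::
    "(('a::euclidean_space \<Rightarrow>\<^sub>L complex) \<Rightarrow> complex) \<Rightarrow> ('a \<Rightarrow>\<^sub>L complex) set \<Rightarrow>
     (('a \<Rightarrow>\<^sub>L complex) \<Rightarrow> complex) \<Rightarrow> (('a \<Rightarrow>\<^sub>L complex) \<Rightarrow> complex) \<Rightarrow> bool" where
  "local_quotient F U a b \<longleftrightarrow>
     open U \<and> holomorphic_dual U a \<and> holomorphic_dual U b \<and>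
     U \<subseteq> closure (interior {\<xi> \<in> U. b \<xi> \<noteq> 0 \<and> F \<xi> = a \<xi> / b \<xi>})"

definition meromorphic_dual :: "(('a::euclidean_space \<Rightarrow>\<^sub>L complex) \<Rightarrow> complex) \<Rightarrow> bool" where
  "meromorphic_dual F \<longleftrightarrow> (\<forall>\<xi>. \<exists>U a b. \<xi> \<in> U \<and> local_quotient F U a b)"

text \<open>The meromorphic function represented by \<open>F\<close> is holomorphic at \<open>\<xi>\<close>.\<close>

definition holomorphic_dual_at ::
    "(('a::euclidean_space \<Rightarrow>\<^sub>L complex) \<Rightarrow> complex) \<Rightarrow> ('a \<Rightarrow>\<^sub>L complex) \<Rightarrow> bool" where
  "holomorphic_dual_at F \<xi> \<longleftrightarrow> (\<exists>U a. \<xi> \<in> U \<and> local_quotient F U a (\<lambda>_. 1))"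

text \<open>
  The meromorphic function represented by \<open>F\<close> restricts to \<open>G\<close> on the subspace \<open>W\<close>: near every
  point of \<open>W\<close> it is a quotient whose denominator does not vanish identically on any relatively
  open part of \<open>W\<close>, and \<open>G\<close> is the quotient of the restrictions.  The values of \<open>F\<close> itself on \<open>W\<close>
  are not used: \<open>W\<close> may be contained in the set where \<open>F\<close> has its irrelevant values.
\<close>

definition meromorphic_restricts ::
    "(('a::euclidean_space \<Rightarrow>\<^sub>L complex) \<Rightarrow> complex) \<Rightarrow> ('a \<Rightarrow>\<^sub>L complex) set \<Rightarrow>
     (('a \<Rightarrow>\<^sub>L complex) \<Rightarrow> complex) \<Rightarrow> bool" where
  "meromorphic_restricts F W G \<longleftrightarrow>
     (\<forall>\<xi>\<in>W. \<exists>U a b. \<xi> \<in> U \<and> local_quotient F U a b \<and>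
        U \<inter> W \<subseteq> closure {\<zeta> \<in> U \<inter> W. b \<zeta> \<noteq> 0} \<and>
        (\<forall>\<zeta>\<in>U \<inter> W. b \<zeta> \<noteq> 0 \<longrightarrow> G \<zeta> = a \<zeta> / b \<zeta>))"

text \<open>The complexification of \<open>X\<^sup>\<bottom>\<close>.\<close>

definition annihilator :: "'a::euclidean_space set \<Rightarrow> ('a \<Rightarrow>\<^sub>L complex) set" where
  "annihilator X = {\<xi>. \<forall>x\<in>X. blinfun_apply \<xi> x = 0}"

text \<open>The real dual \<open>V\<^sup>*\<close> inside its complexification.\<close>

definition real_dual :: "('a::euclidean_space \<Rightarrow>\<^sub>L complex) set" where
  "real_dual = {\<xi>. \<forall>x. blinfun_apply \<xi> x \<in> \<real>}"

section \<open>Exponential sums over cones as meromorphic functions\<close>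

fun C_k :: "nat \<Rightarrow> ('a::euclidean_space \<Rightarrow> complex) \<Rightarrow> bool" where
  "C_k 0 \<phi> \<longleftrightarrow> continuous_on UNIV \<phi>"
| "C_k (Suc k) \<phi> \<longleftrightarrow> (\<forall>x. \<phi> differentiable (at x)) \<and>
     (\<forall>v. C_k k (\<lambda>x. frechet_derivative \<phi> (at x) v))"

definition support :: "('a::euclidean_space \<Rightarrow> complex) \<Rightarrow> 'a set" where
  "support \<phi> = closure {x. \<phi> x \<noteq> 0}"

definition test_function :: "('a::euclidean_space \<Rightarrow> complex) \<Rightarrow> bool" where
  "test_function \<phi> \<longleftrightarrow> (\<forall>k. C_k k \<phi>) \<and> compact (support \<phi>)"

text \<open>
  The imaginary dual \<open>\<i>V\<^sup>*\<close> is parametrized by \<open>'a\<close> through the inner product: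
  \<open>\<theta>\<close> stands for the functional \<open>x \<mapsto> \<i> (\<theta> \<bullet> x)\<close>.
\<close>

lift_definition imag_functional :: "'a::euclidean_space \<Rightarrow> ('a \<Rightarrow>\<^sub>L complex)"
  is "\<lambda>\<theta> x. \<i> * complex_of_real (\<theta> \<bullet> x)"
  by (intro bounded_linear_const_mult bounded_linear_compose[OF bounded_linear_of_real]
      bounded_linear_inner_right)

definition pole_hyperplanes :: "'a::euclidean_space \<Rightarrow> ('a \<Rightarrow>\<^sub>L complex) set" where
  "pole_hyperplanes g = {\<xi>. \<exists>k::int. blinfun_apply \<xi> g = 2 * of_int k * of_real pi * \<i>}"

text \<open>
  \<open>exp_sum_represents \<Lambda> q P M\<close>: the meromorphic function denoted by
  \<open>\<Sum>\<^bsub>x \<in> \<Lambda> \<inter> q\<^esub> P x exp \<langle>\<xi>, x\<rangle>\<close> is \<open>M\<close>.  That is, \<open>q\<close> is a cone \<open>s + c\<close> with \<open>c\<close> generated by finitely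
  many \<open>g \<in> \<Lambda>\<close>; the sum converges as a generalized function of \<open>\<xi> \<in> \<i>V\<^sup>*\<close>, i.e. when paired termwise
  with test functions; \<open>M\<close> is meromorphic with poles on the hyperplanes \<open>\<langle>\<xi>, g\<rangle> \<in> 2\<pi>\<i>\<int>\<close>; and the
  generalized function coincides with \<open>M\<close> outside these hyperplanes.

  The lattice \<open>\<Lambda>\<close> need not span the type \<open>'a\<close>: in general the sum lives on the dual of
  \<open>E = span \<Lambda>\<close>, and \<open>M\<close> is its pullback under restriction of functionals to \<open>E\<close>.
\<close>

definition exp_sum_represents ::
    "'a::euclidean_space set \<Rightarrow> 'a set \<Rightarrow> ('a \<Rightarrow> real) \<Rightarrow> (('a \<Rightarrow>\<^sub>L complex) \<Rightarrow> complex) \<Rightarrow> bool" where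
  "exp_sum_represents \<Lambda> q P M \<longleftrightarrow>
     (\<exists>s C. finite C \<and> C \<subseteq> \<Lambda> - {0} \<and> q = (+) s ` (convex_cone hull C) \<and>
        (let H = (\<Union>g\<in>C. pole_hyperplanes g);
             summand = (\<lambda>\<phi> x. of_real (P x) *
                       (\<integral>\<theta>. \<phi> \<theta> * exp (blinfun_apply (imag_functional \<theta>) x) \<partial>lborel))
         in meromorphic_dual M \<and> holomorphic_dual (- H) M \<and>
            (\<forall>\<phi>. test_function \<phi> \<longrightarrow> summand \<phi> summable_on (\<Lambda> \<inter> q)) \<and>
            (\<forall>\<phi>. test_function \<phi> \<and> (\<forall>\<theta>\<in>support \<phi>. imag_functional \<theta> \<notin> H) \<longrightarrow>
               (summand \<phi> has_sum (\<integral>\<theta>. \<phi> \<theta> * M (imag_functional \<theta>) \<partial>lborel)) (\<Lambda> \<inter> q))))"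

text \<open>
  The generating function \<open>S q\<close> of a cone.  It is determined by \<open>exp_sum_represents\<close> off the pole
  hyperplanes, hence as a meromorphic function.
\<close>

definition cone_gf :: "'a::euclidean_space set \<Rightarrow> 'a set \<Rightarrow> ('a \<Rightarrow>\<^sub>L complex) \<Rightarrow> complex" where
  "cone_gf \<Lambda> q = (SOME M. exp_sum_represents \<Lambda> q (\<lambda>_. 1) M)"

definition vertex_cone_sum ::
    "'a::euclidean_space set \<Rightarrow> 'a set \<Rightarrow> 'a set \<Rightarrow> ('a \<Rightarrow>\<^sub>L complex) \<Rightarrow> complex" where
  "vertex_cone_sum \<Lambda> p f \<xi> = (\<Sum>s\<in>vertices f. cone_gf \<Lambda> (tangent_cone p {s}) \<xi>)"

section \<open>Realization of the quotient space\<close>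

text \<open>
  \<open>V / W\<close> is realized, up to isomorphism, as the range of an arbitrary linear map \<open>\<pi>\<close> with kernel
  \<open>W\<close>.  Surjectivity is not required, so that the zero quotient \<open>W = V\<close> is included although every
  Euclidean space type has positive dimension.  The functionals vanishing on \<open>W\<close> are exactly the
  \<open>\<eta> o\<^sub>L \<pi>\<close>, and \<open>\<langle>\<eta> o\<^sub>L \<pi>, x\<rangle> = \<langle>\<eta>, \<pi> x\<rangle>\<close>.
\<close>

definition realizes_quotient ::
    "('a::euclidean_space \<Rightarrow>\<^sub>L 'b::euclidean_space) \<Rightarrow> 'a set \<Rightarrow> bool" where
  "realizes_quotient \<pi> W \<longleftrightarrow> {x. blinfun_apply \<pi> x = 0} = W"

end

theory Submission
  imports Defs "HOL-Library.Multiset" "HOL-Computational_Algebra.Formal_Power_Series"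
    "HOL-Complex_Analysis.Complex_Analysis"
begin

text \<open>
  Let \<open>a\<^sub>i \<bullet> x \<le> b\<^sub>i\<close> be the facet inequalities of \<open>p\<close> and \<open>T\<close> the set of facets containing \<open>f\<close>.  The vertex
  cones are simplicial, one generator for each facet through the vertex; the generators for facets
  outside \<open>T\<close> span \<open>lin f\<close> and cause the poles on its annihilator.

  \<^bold>\<open>Flipping.\<close>  The indicator of a line is killed by differencing along the line, so replacing a half line
  by minus the complementary half line does not change a generating function.  For a functional \<open>\<beta>\<close>
  not constant on any edge of \<open>f\<close>, flip all vertex cones along the edges of \<open>f\<close> into the half space
  \<open>\<beta> > 0\<close>.  An argument in the style of Lawrence and Varchenko (\<open>\<Psi>_eq_flipped_cones\<close>) shows that on
  the tangent cone to \<open>p\<close> at \<open>f\<close> the signed sum of the flipped cones is the function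
  \<open>\<Psi> x = \<Sum>\<^sub>K (-1)\<^bsup>|K|\<^esup>\<close>, where \<open>K\<close> runs over the sets of facets violated by \<open>x\<close> with \<open>f \<inter> F\<^sub>K \<noteq> {}\<close>.
  It does not depend on \<open>\<beta>\<close>.  Choosing \<open>\<beta>\<close> for each point separately, one finds that on a fibre of the
  projection along \<open>lin f\<close> the support of \<open>\<Psi>\<close> lies in the convex hull of the points that replace the
  vertices of \<open>f\<close> in this slice (\<open>\<Psi>_support\<close>).  On \<open>p\<close> the function \<open>\<Psi>\<close> is \<open>1\<close>.

  \<^bold>\<open>Consequences.\<close>  Let \<open>P y\<close> be the sum of \<open>\<Psi>\<close> over the lattice points of the fibre of \<open>y\<close>.
  Near the apex the convex hull above lies in \<open>p\<close>, so \<open>P\<close> counts lattice points (\<open>P_counts_slice\<close>).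
  Since \<open>\<Psi>\<close> has bounded support on bounded families of slices, differencing it along the transverse
  edges alone leaves finitely many points (\<open>fsupp_transverse\<close>).  Hence the sum of the vertex cones
  is a quotient \<open>G\<close> whose denominator involves transverse edges only (\<open>sum_vertex_cones\<close>).  It restricts
  to the annihilator of \<open>lin f\<close> and has no pole at a regular functional; summing over the fibres
  identifies the restriction with the generating function of \<open>P\<close>
  (\<open>transverse_cone_represented\<close>).  Finally, moving a slice by a period translates the flipped cones by
  lattice vectors, and the total mass of a finitely supported function is a Taylor coefficient of
  its differences (\<open>sum_from_mixed_diff\<close>); this makes \<open>P\<close> polynomial on cosets (\<open>polynomial_on_coset\<close>).

  \<^bold>\<open>The sums as generalized functions.\<close>  Off the poles a test function is divisible by the denominator.
  Summation by parts then reduces a pairing with Fourier transforms to a finite sum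
  (\<open>exp_sum_by_parts\<close>).  Conversely a meromorphic function is determined by the pairings
  (\<open>exp_sum_represents_unique\<close>); this is how a generating function specified only by its pairings
  is identified with an explicit quotient.
\<close>

section \<open>Finite differences and exponential sums\<close>

definition backward_diff :: "'a::euclidean_space \<Rightarrow> ('a \<Rightarrow> real) \<Rightarrow> 'a \<Rightarrow> real" where
  "backward_diff g h = (\<lambda>x. h x - h (x - g))"

text \<open>
  On coefficients, \<open>mixed_diff D\<close> is multiplication of the formal sum \<open>\<Sum>x. h x e\<^sup>x\<close> by the product of
  all \<open>1 - e\<^sup>g\<close> with \<open>g\<close> in \<open>D\<close>.  The factors commute, so a multiset of steps suffices.
\<close>

definition mixed_diff :: "'a::euclidean_space multiset \<Rightarrow> ('a \<Rightarrow> real) \<Rightarrow> 'a \<Rightarrow> real" where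
  "mixed_diff D h = fold_mset backward_diff h D"

interpretation backward_diff: comp_fun_commute backward_diff
  by standard (auto simp: backward_diff_def fun_eq_iff algebra_simps)

lemma mixed_diff_empty [simp]: "mixed_diff {#} h = h"
  by (simp add: mixed_diff_def)

lemma mixed_diff_add_mset: "mixed_diff (add_mset g D) h = backward_diff g (mixed_diff D h)"
  by (simp add: mixed_diff_def)

lemma mixed_diff_union: "mixed_diff (D + E) h = mixed_diff E (mixed_diff D h)"
  by (simp add: mixed_diff_def)

lemma mixed_diff_sum: "mixed_diff D (\<lambda>x. \<Sum>i\<in>A. h i x) = (\<lambda>x. \<Sum>i\<in>A. mixed_diff D (h i) x)"
  by (induction D) (auto simp: mixed_diff_add_mset backward_diff_def sum_subtractf)

lemma mixed_diff_translate: "mixed_diff D (\<lambda>x. h (x - v)) = (\<lambda>x. mixed_diff D h (x - v))"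
  by (induction D) (auto simp: mixed_diff_add_mset backward_diff_def algebra_simps)

text \<open>
  Iterated differencing enlarges a support at most by these translations.
\<close>

definition subsums :: "'a::euclidean_space multiset \<Rightarrow> 'a set" where
  "subsums D = sum_mset ` {B. B \<subseteq># D}"

lemma finite_subsums: "finite (subsums D)"
proof -
  have "finite {B. B \<subseteq># D}"
  proof (induction D)
    case (add g D)
    have "B \<in> {B. B \<subseteq># D} \<union> add_mset g ` {B. B \<subseteq># D}" if "B \<subseteq># add_mset g D" for B
    proof (cases "g \<in># B")
      case True
      then obtain B' where B': "B = add_mset g B'" by (metis insert_DiffM)
      then show ?thesis using that by auto
    next
      case False
      have "count B x \<le> count D x" for x
        using mset_subset_eq_count[OF that, of x] False by (cases "x = g") (auto simp: not_in_iff)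
      then show ?thesis by (simp add: subseteq_mset_def)
    qed
    then have "{B. B \<subseteq># add_mset g D} \<subseteq> {B. B \<subseteq># D} \<union> add_mset g ` {B. B \<subseteq># D}"
      by blast
    then show ?case
      using add finite_subset by blast
  qed simp
  then show ?thesis by (simp add: subsums_def)
qed

lemma mixed_diff_nonzeroE:
  assumes "mixed_diff D h x \<noteq> 0"
  obtains v where "v \<in> subsums D" "h (x - v) \<noteq> 0"
proof -
  have "\<exists>B. B \<subseteq># D \<and> h (x - sum_mset B) \<noteq> 0"
    using assms
  proof (induction D arbitrary: x)
    case empty
    then show ?case by simp
  next
    case (add g D)
    then have "mixed_diff D h x \<noteq> 0 \<or> mixed_diff D h (x - g) \<noteq> 0"
      by (auto simp: mixed_diff_add_mset backward_diff_def)
    then show ?case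
    proof
      assume "mixed_diff D h x \<noteq> 0"
      with add.IH obtain B where "B \<subseteq># D" "h (x - sum_mset B) \<noteq> 0" by blast
      then show ?thesis
        by (metis add_mset_remove_trivial diff_subset_eq_self subset_mset.order_trans)
    next
      assume "mixed_diff D h (x - g) \<noteq> 0"
      with add.IH obtain B where "B \<subseteq># D" "h (x - g - sum_mset B) \<noteq> 0" by blast
      then show ?thesis
        by (intro exI[of _ "add_mset g B"]) (auto simp: algebra_simps)
    qed
  qed
  then show thesis
    using that by (auto simp: subsums_def)
qed

lemma subsums_closed:
  assumes "0 \<in> A" "\<And>x y. x \<in> A \<Longrightarrow> y \<in> A \<Longrightarrow> x + y \<in> A" "set_mset D \<subseteq> A" "v \<in> subsums D"
  shows "v \<in> A"
proof -
  have "set_mset B \<subseteq> A \<Longrightarrow> sum_mset B \<in> A" for B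
    by (induction B) (use assms in auto)
  then show ?thesis
    using assms by (auto simp: subsums_def dest!: set_mset_mono)
qed

lemma mixed_diff_supported:
  assumes "\<And>x y. x \<in> A \<Longrightarrow> y \<in> A \<Longrightarrow> x + y \<in> A" "0 \<in> A" "set_mset D \<subseteq> A"
    and "\<And>x. x \<notin> A \<Longrightarrow> h x = 0" and "x \<notin> A"
  shows "mixed_diff D h x = 0"
proof (rule ccontr)
  assume "mixed_diff D h x \<noteq> 0"
  then obtain v where v: "v \<in> subsums D" "h (x - v) \<noteq> 0" by (rule mixed_diff_nonzeroE)
  have "v \<in> A" using subsums_closed[OF assms(2,1,3) v(1)] .
  moreover have "x - v \<in> A" using v assms(4) by blast
  ultimately have "x - v + v \<in> A" using assms(1) by blast
  then show False using assms(5) by simp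
qed

text \<open>
  For indicators of half lines the one-variable differences are indicators of unit intervals.  In this
  way the lemma computes the numerator of the generating function of a simplicial cone.
\<close>

lemma mixed_diff_product:
  fixes t :: "'i \<Rightarrow> 'a::euclidean_space \<Rightarrow> real"
  assumes "finite A"
    and "\<And>i x. i \<in> A \<Longrightarrow> k (x - g i) = k x"
    and "\<And>i l x. i \<in> A \<Longrightarrow> l \<in> A \<Longrightarrow> t i (x - g l) = t i x - (if i = l then 1 else 0)"
  shows "mixed_diff (image_mset g (mset_set A)) (\<lambda>x. k x * (\<Prod>i\<in>A. \<sigma> i (t i x)))
       = (\<lambda>x. k x * (\<Prod>i\<in>A. \<sigma> i (t i x) - \<sigma> i (t i x - 1)))"
proof -
  have "B \<subseteq> A \<Longrightarrow> mixed_diff (image_mset g (mset_set B)) (\<lambda>x. k x * (\<Prod>i\<in>A. \<sigma> i (t i x)))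
       = (\<lambda>x. k x * (\<Prod>i\<in>B. \<sigma> i (t i x) - \<sigma> i (t i x - 1)) * (\<Prod>i\<in>A-B. \<sigma> i (t i x)))" 
    if "finite B" for B
    using that
  proof (induction B rule: finite_induct)
    case empty
    then show ?case by simp
  next
    case (insert l B)
    have l: "l \<in> A" and BA: "B \<subseteq> A" using insert by auto
    have t: "t i (x - g l) = t i x" if "i \<in> A" "i \<noteq> l" for i x
      using assms(3)[OF that(1) l] that(2) by simp
    have tl: "t l (x - g l) = t l x - 1" for x
      using assms(3)[OF l l] by simp
    have AB: "A - B = insert l (A - insert l B)" "l \<notin> A - insert l B"
      using l insert by auto
    have fAB: "finite (A - insert l B)" using assms(1) by simp
    have 1: "(\<Prod>i\<in>A-B. \<sigma> i (t i x)) = \<sigma> l (t l x) * (\<Prod>i\<in>A-insert l B. \<sigma> i (t i x))" for x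
      unfolding AB(1) by (rule prod.insert[OF fAB AB(2)])
    have 2: "(\<Prod>i\<in>A-insert l B. \<sigma> i (t i (x - g l))) = (\<Prod>i\<in>A-insert l B. \<sigma> i (t i x))" for x
      by (intro prod.cong) (auto simp: t)
    have 3: "(\<Prod>i\<in>B. \<sigma> i (t i (x - g l)) - \<sigma> i (t i (x - g l) - 1)) = (\<Prod>i\<in>B. \<sigma> i (t i x) - \<sigma> i (t i x - 1))" for x
    proof (intro prod.cong refl)
      fix i assume "i \<in> B"
      then have "i \<in> A" "i \<noteq> l" using BA insert.hyps by auto
      then show "\<sigma> i (t i (x - g l)) - \<sigma> i (t i (x - g l) - 1) = \<sigma> i (t i x) - \<sigma> i (t i x - 1)"
        by (simp add: t)
    qed
    show ?case
      using insert.hyps insert.IH[OF BA] assms(2)[OF l]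
      by (auto simp: mixed_diff_add_mset backward_diff_def 1 2 3 tl fun_eq_iff algebra_simps)
  qed
  from this[of A] show ?thesis using assms(1) by simp
qed

definition fsupp :: "('a \<Rightarrow> real) \<Rightarrow> bool" where
  "fsupp h \<longleftrightarrow> finite {x. h x \<noteq> 0}"

definition den :: "'a::euclidean_space multiset \<Rightarrow> ('a \<Rightarrow>\<^sub>L complex) \<Rightarrow> complex" where
  "den D \<xi> = (\<Prod>g\<in>#D. 1 - exp (blinfun_apply \<xi> g))"

text \<open>
  Summing over the support avoids carrying a finite superset of it around; for an infinite support
  the value is \<open>0\<close>.
\<close>

definition expsum :: "('a::euclidean_space \<Rightarrow> real) \<Rightarrow> ('a \<Rightarrow>\<^sub>L complex) \<Rightarrow> complex" where
  "expsum h \<xi> = (\<Sum>x | h x \<noteq> 0. of_real (h x) * exp (blinfun_apply \<xi> x))"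

lemma sum_supp_eq:
  fixes F :: "'a \<Rightarrow> 'b::comm_monoid_add"
  assumes "finite S" "\<And>x. x \<notin> S \<Longrightarrow> h x = 0" "\<And>x. h x = 0 \<Longrightarrow> F x = 0"
  shows "(\<Sum>x | h x \<noteq> 0. F x) = (\<Sum>x\<in>S. F x)"
  by (rule sum.mono_neutral_left) (use assms in auto)

lemma expsum_eq:
  assumes "finite S" "\<And>x. x \<notin> S \<Longrightarrow> h x = 0"
  shows "expsum h \<xi> = (\<Sum>x\<in>S. of_real (h x) * exp (blinfun_apply \<xi> x))"
  unfolding expsum_def by (rule sum_supp_eq) (use assms in auto)

lemma fsupp_translate: "fsupp h \<Longrightarrow> fsupp (\<lambda>x. h (x - v))" for v :: "'a::euclidean_space"
proof -
  assume "fsupp h"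
  moreover have "{x. h (x - v) \<noteq> 0} \<subseteq> (+) v ` {x. h x \<noteq> 0}"
    by (auto simp: image_iff) (metis add.commute diff_add_cancel)
  ultimately show ?thesis
    unfolding fsupp_def by (meson finite_imageI finite_subset)
qed

lemma fsupp_diff: "fsupp h \<Longrightarrow> fsupp k \<Longrightarrow> fsupp (\<lambda>x. h x - k x)"
  unfolding fsupp_def by (rule finite_subset[of _ "{x. h x \<noteq> 0} \<union> {x. k x \<noteq> 0}"]) auto

lemma fsupp_backward_diff: "fsupp h \<Longrightarrow> fsupp (backward_diff g h)"
  unfolding backward_diff_def by (intro fsupp_diff fsupp_translate)

lemma fsupp_mixed_diff: "fsupp h \<Longrightarrow> fsupp (mixed_diff D h)"
  by (induction D) (auto simp: mixed_diff_add_mset fsupp_backward_diff)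

lemma expsum_sum:
  assumes "finite A" "\<And>i. i \<in> A \<Longrightarrow> fsupp (h i)"
  shows "expsum (\<lambda>x. \<Sum>i\<in>A. h i x) \<xi> = (\<Sum>i\<in>A. expsum (h i) \<xi>)"
proof -
  let ?S = "\<Union>i\<in>A. {x. h i x \<noteq> 0}"
  have S: "finite ?S" using assms by (auto simp: fsupp_def)
  have "expsum (\<lambda>x. \<Sum>i\<in>A. h i x) \<xi> = (\<Sum>x\<in>?S. of_real (\<Sum>i\<in>A. h i x) * exp (blinfun_apply \<xi> x))"
    by (rule expsum_eq[OF S]) (auto intro!: sum.neutral)
  also have "\<dots> = (\<Sum>x\<in>?S. \<Sum>i\<in>A. of_real (h i x) * exp (blinfun_apply \<xi> x))"
    by (simp add: sum_distrib_right)
  also have "\<dots> = (\<Sum>i\<in>A. \<Sum>x\<in>?S. of_real (h i x) * exp (blinfun_apply \<xi> x))"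
    by (rule sum.swap)
  also have "\<dots> = (\<Sum>i\<in>A. expsum (h i) \<xi>)"
    by (intro sum.cong refl expsum_eq[symmetric, OF S]) auto
  finally show ?thesis .
qed

lemma sum_translate_supp:
  fixes F :: "'a::euclidean_space \<Rightarrow> 'b::comm_monoid_add"
  shows "(\<Sum>x | h (x - v) \<noteq> 0. F x) = (\<Sum>x | h x \<noteq> 0. F (x + v))"
  by (rule sum.reindex_bij_witness[of _ "\<lambda>x. x + v" "\<lambda>x. x - v"]) auto

lemma expsum_backward_diff:
  assumes "fsupp h"
  shows "expsum (backward_diff g h) \<xi> = (1 - exp (blinfun_apply \<xi> g)) * expsum h \<xi>"
proof -
  let ?S = "{x. h x \<noteq> 0} \<union> {x. h (x - g) \<noteq> 0}"
  have fin: "finite {x. h x \<noteq> 0}" "finite {x. h (x - g) \<noteq> 0}" 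
    using assms fsupp_translate[OF assms, of g] by (auto simp: fsupp_def)
  have "expsum (backward_diff g h) \<xi> = (\<Sum>x\<in>?S. of_real (h x - h (x - g)) * exp (blinfun_apply \<xi> x))"
    by (subst expsum_eq[of ?S]) (use fin in \<open>auto simp: backward_diff_def\<close>)
  also have "\<dots> = (\<Sum>x\<in>?S. of_real (h x) * exp (blinfun_apply \<xi> x)) - (\<Sum>x\<in>?S. of_real (h (x - g)) * exp (blinfun_apply \<xi> x))"
    by (simp add: algebra_simps sum_subtractf)
  also have "(\<Sum>x\<in>?S. of_real (h x) * exp (blinfun_apply \<xi> x)) = expsum h \<xi>"
    by (rule expsum_eq[symmetric]) (use fin in auto)
  also have "(\<Sum>x\<in>?S. of_real (h (x - g)) * exp (blinfun_apply \<xi> x)) = expsum (\<lambda>x. h (x - g)) \<xi>"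
    by (rule expsum_eq[symmetric]) (use fin in auto)
  also have "\<dots> = (\<Sum>x | h x \<noteq> 0. of_real (h x) * exp (blinfun_apply \<xi> (x + g)))"
    unfolding expsum_def by (subst sum_translate_supp) simp
  also have "\<dots> = exp (blinfun_apply \<xi> g) * expsum h \<xi>"
    by (simp add: expsum_def sum_distrib_left blinfun.add_right exp_add mult_ac)
  finally show ?thesis by (simp add: algebra_simps)
qed

lemma expsum_mixed_diff: "fsupp h \<Longrightarrow> expsum (mixed_diff D h) \<xi> = den D \<xi> * expsum h \<xi>"
  by (induction D) (auto simp: den_def mixed_diff_add_mset expsum_backward_diff fsupp_mixed_diff)

lemma den_union: "den (D + E) \<xi> = den D \<xi> * den E \<xi>"
  by (simp add: den_def)

lemma den_eq_0_iff: "den D \<xi> = 0 \<longleftrightarrow> (\<exists>g\<in>#D. exp (blinfun_apply \<xi> g) = 1)"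
  by (induction D) (auto simp: den_def)

text \<open>
  The total mass of a finitely supported function is a Taylor coefficient of the exponential sum of
  its differences: each factor \<open>1 - exp (\<beta> g)\<close> contributes one order of vanishing.
\<close>

lemma sum_from_mixed_diff:
  fixes \<beta> :: "'a::euclidean_space"
  assumes "fsupp h"
  shows "(\<Sum>x | mixed_diff D h x \<noteq> 0. mixed_diff D h x * (\<beta> \<bullet> x) ^ size D) / fact (size D)
       = (\<Prod>g\<in>#D. - (\<beta> \<bullet> g)) * (\<Sum>x | h x \<noteq> 0. h x)"
proof -
  define E :: "('a \<Rightarrow> real) \<Rightarrow> real fps" where
    "E h = (\<Sum>x | h x \<noteq> 0. fps_const (h x) * fps_exp (\<beta> \<bullet> x))" for h
  have Eq: "E h = (\<Sum>x\<in>S. fps_const (h x) * fps_exp (\<beta> \<bullet> x))" if "finite S" "\<And>x. x \<notin> S \<Longrightarrow> h x = 0" for h S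
    unfolding E_def by (rule sum_supp_eq) (use that in auto)
  have E1: "E (backward_diff g h) = (1 - fps_exp (\<beta> \<bullet> g)) * E h" if "fsupp h" for g h
  proof -
    let ?S = "{x. h x \<noteq> 0} \<union> {x. h (x - g) \<noteq> 0}"
    have fin: "finite {x. h x \<noteq> 0}" "finite {x. h (x - g) \<noteq> 0}" 
      using that fsupp_translate[OF that, of g] by (auto simp: fsupp_def)
    have "E (backward_diff g h) = (\<Sum>x\<in>?S. fps_const (h x - h (x - g)) * fps_exp (\<beta> \<bullet> x))"
      by (subst Eq[of ?S]) (use fin in \<open>auto simp: backward_diff_def\<close>)
    also have "\<dots> = (\<Sum>x\<in>?S. fps_const (h x) * fps_exp (\<beta> \<bullet> x)) - (\<Sum>x\<in>?S. fps_const (h (x - g)) * fps_exp (\<beta> \<bullet> x))"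
      by (simp add: algebra_simps sum_subtractf flip: fps_const_sub)
    also have "(\<Sum>x\<in>?S. fps_const (h x) * fps_exp (\<beta> \<bullet> x)) = E h"
      by (rule Eq[symmetric]) (use fin in auto)
    also have "(\<Sum>x\<in>?S. fps_const (h (x - g)) * fps_exp (\<beta> \<bullet> x)) = E (\<lambda>x. h (x - g))"
      by (rule Eq[symmetric]) (use fin in auto)
    also have "\<dots> = (\<Sum>x | h x \<noteq> 0. fps_const (h x) * fps_exp (\<beta> \<bullet> (x + g)))"
      unfolding E_def by (subst sum_translate_supp) simp
    also have "\<dots> = fps_exp (\<beta> \<bullet> g) * E h"
      by (simp add: E_def sum_distrib_left inner_add_right fps_exp_add_mult mult_ac)
    finally show ?thesis by (simp add: algebra_simps)
  qed
  have E2: "E (mixed_diff D h) = (\<Prod>g\<in>#D. 1 - fps_exp (\<beta> \<bullet> g)) * E h" for D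
    by (induction D) (auto simp: mixed_diff_add_mset E1 fsupp_mixed_diff assms)
  have one: "\<exists>U. 1 - fps_exp c = fps_X * U \<and> fps_nth U 0 = - c" for c :: real
  proof -
    have "1 - fps_exp c = fps_X * fps_shift 1 (1 - fps_exp c)"
      by (rule fps_ext) (auto simp: fps_X_mult_nth)
    moreover have "fps_nth (fps_shift 1 (1 - fps_exp c)) 0 = - c" by simp
    ultimately show ?thesis by blast
  qed
  have prod: "\<exists>U. (\<Prod>g\<in>#D. 1 - fps_exp (\<beta> \<bullet> g)) = fps_X ^ size D * U \<and> fps_nth U 0 = (\<Prod>g\<in>#D. - (\<beta> \<bullet> g))" for D
  proof (induction D)
    case empty
    show ?case by (intro exI[of _ 1]) simp
  next
    case (add g D)
    then obtain U where U: "(\<Prod>g\<in>#D. 1 - fps_exp (\<beta> \<bullet> g)) = fps_X ^ size D * U" 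
        "fps_nth U 0 = (\<Prod>g\<in>#D. - (\<beta> \<bullet> g))" by blast
    obtain W where W: "1 - fps_exp (\<beta> \<bullet> g) = fps_X * W" "fps_nth W 0 = - (\<beta> \<bullet> g)" using one by blast
    show ?case
      by (intro exI[of _ "W * U"]) (simp add: U W mult_ac)
  qed
  then obtain U where U: "(\<Prod>g\<in>#D. 1 - fps_exp (\<beta> \<bullet> g)) = fps_X ^ size D * U" 
        "fps_nth U 0 = (\<Prod>g\<in>#D. - (\<beta> \<bullet> g))" by blast
  have "fps_nth (E (mixed_diff D h)) (size D) = (\<Sum>x | mixed_diff D h x \<noteq> 0. mixed_diff D h x * (\<beta> \<bullet> x) ^ size D) / fact (size D)"
    by (simp add: E_def fps_sum_nth sum_divide_distrib)
  moreover have "fps_nth (E (mixed_diff D h)) (size D) = fps_nth (U * E h) 0"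
    unfolding E2 U by (simp add: mult.assoc fps_X_power_mult_nth)
  moreover have "fps_nth (E h) 0 = (\<Sum>x | h x \<noteq> 0. h x)"
    by (simp add: E_def fps_sum_nth)
  ultimately show ?thesis by (simp add: U)
qed

section \<open>Quotients of exponential sums as meromorphic functions\<close>

lemma holomorphic_dual_mono: "holomorphic_dual U F \<Longrightarrow> V \<subseteq> U \<Longrightarrow> holomorphic_dual V F"
  by (auto simp: holomorphic_dual_def)

lemma holomorphic_dual_const: "holomorphic_dual U (\<lambda>_. c)"
  unfolding holomorphic_dual_def by (auto intro!: exI[of _ "\<lambda>_. 0"])

lemma holomorphic_dual_exp_eval: "holomorphic_dual U (\<lambda>\<xi>. exp (blinfun_apply \<xi> x))"
  unfolding holomorphic_dual_def
proof (intro ballI exI conjI allI)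
  fix \<xi> :: "'a \<Rightarrow>\<^sub>L complex"
  have "((\<lambda>\<xi>. blinfun_apply \<xi> x) has_derivative (\<lambda>h. blinfun_apply h x)) (at \<xi>)"
    by (intro bounded_linear.has_derivative[OF blinfun.bounded_linear_left] has_derivative_ident)
  moreover have "(exp has_derivative (\<lambda>h. exp (blinfun_apply \<xi> x) * h)) (at (blinfun_apply \<xi> x))"
    using DERIV_exp unfolding has_field_derivative_def by blast
  ultimately show "((\<lambda>\<xi>. exp (blinfun_apply \<xi> x)) has_derivative (\<lambda>h. exp (blinfun_apply \<xi> x) * blinfun_apply h x)) (at \<xi>)"
    by (rule has_derivative_compose)
qed simp

lemma holomorphic_dual_diff:
  assumes "holomorphic_dual U F" "holomorphic_dual U G"
  shows "holomorphic_dual U (\<lambda>\<xi>. F \<xi> - G \<xi>)"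
  unfolding holomorphic_dual_def
proof
  fix \<xi> assume "\<xi> \<in> U"
  with assms obtain D E where "(F has_derivative D) (at \<xi>)" "\<forall>h. D (blinfun_mult_right \<i> o\<^sub>L h) = \<i> * D h"
     "(G has_derivative E) (at \<xi>)" "\<forall>h. E (blinfun_mult_right \<i> o\<^sub>L h) = \<i> * E h"
    unfolding holomorphic_dual_def by metis
  then show "\<exists>D. ((\<lambda>\<xi>. F \<xi> - G \<xi>) has_derivative D) (at \<xi>) \<and> (\<forall>h. D (blinfun_mult_right \<i> o\<^sub>L h) = \<i> * D h)"
    by (intro exI[of _ "\<lambda>h. D h - E h"]) (auto intro!: derivative_eq_intros simp: algebra_simps)
qed

lemma holomorphic_dual_mult:
  assumes "holomorphic_dual U F" "holomorphic_dual U G"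
  shows "holomorphic_dual U (\<lambda>\<xi>. F \<xi> * G \<xi>)"
  unfolding holomorphic_dual_def
proof
  fix \<xi> assume "\<xi> \<in> U"
  with assms obtain D E where "(F has_derivative D) (at \<xi>)" "\<forall>h. D (blinfun_mult_right \<i> o\<^sub>L h) = \<i> * D h"
     "(G has_derivative E) (at \<xi>)" "\<forall>h. E (blinfun_mult_right \<i> o\<^sub>L h) = \<i> * E h"
    unfolding holomorphic_dual_def by metis
  then show "\<exists>D. ((\<lambda>\<xi>. F \<xi> * G \<xi>) has_derivative D) (at \<xi>) \<and> (\<forall>h. D (blinfun_mult_right \<i> o\<^sub>L h) = \<i> * D h)"
    by (intro exI[of _ "\<lambda>h. F \<xi> * E h + D h * G \<xi>"] conjI has_derivative_mult) (auto simp: algebra_simps)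
qed

lemma holomorphic_dual_inverse:
  assumes "holomorphic_dual U F" "\<And>\<xi>. \<xi> \<in> U \<Longrightarrow> F \<xi> \<noteq> 0"
  shows "holomorphic_dual U (\<lambda>\<xi>. inverse (F \<xi>))"
  unfolding holomorphic_dual_def
proof
  fix \<xi> assume \<xi>: "\<xi> \<in> U"
  with assms obtain D where "(F has_derivative D) (at \<xi>)" "\<forall>h. D (blinfun_mult_right \<i> o\<^sub>L h) = \<i> * D h"
    unfolding holomorphic_dual_def by metis
  then show "\<exists>D. ((\<lambda>\<xi>. inverse (F \<xi>)) has_derivative D) (at \<xi>) \<and> (\<forall>h. D (blinfun_mult_right \<i> o\<^sub>L h) = \<i> * D h)"
    using assms(2)[OF \<xi>]
    by (intro exI[of _ "\<lambda>h. - (inverse (F \<xi>) * D h * inverse (F \<xi>))"] conjI Deriv.has_derivative_inverse) auto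
qed

lemma holomorphic_dual_divide:
  assumes "holomorphic_dual U F" "holomorphic_dual U G" "\<And>\<xi>. \<xi> \<in> U \<Longrightarrow> G \<xi> \<noteq> 0"
  shows "holomorphic_dual U (\<lambda>\<xi>. F \<xi> / G \<xi>)"
  unfolding divide_inverse by (intro holomorphic_dual_mult holomorphic_dual_inverse assms)

lemma holomorphic_dual_sum:
  "(\<And>i. i \<in> A \<Longrightarrow> holomorphic_dual U (F i)) \<Longrightarrow> holomorphic_dual U (\<lambda>\<xi>. \<Sum>i\<in>A. F i \<xi>)"
proof (induction A rule: infinite_finite_induct)
  case (insert i A)
  have "holomorphic_dual U (\<lambda>\<xi>. F i \<xi> - (\<lambda>\<xi>. 0 - (\<Sum>i\<in>A. F i \<xi>)) \<xi>)"
    using insert by (intro holomorphic_dual_diff holomorphic_dual_const) auto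
  then show ?case using insert.hyps by simp
qed (auto intro: holomorphic_dual_const)

lemma holomorphic_dual_expsum: "holomorphic_dual U (expsum h)"
  unfolding expsum_def
  by (intro holomorphic_dual_sum holomorphic_dual_mult holomorphic_dual_const holomorphic_dual_exp_eval)

lemma holomorphic_dual_den: "holomorphic_dual U (den D)"
  unfolding den_def
  by (induction D) (auto intro!: holomorphic_dual_mult holomorphic_dual_const holomorphic_dual_diff holomorphic_dual_exp_eval)

lemma pole_hyperplanes_eq: "pole_hyperplanes g = {\<xi>. exp (blinfun_apply \<xi> g) = 1}"
proof -
  have "(\<exists>k::int. blinfun_apply \<xi> g = 2 * of_int k * of_real pi * \<i>) \<longleftrightarrow> exp (blinfun_apply \<xi> g) = 1" for \<xi>
    unfolding exp_eq_1 by (auto simp: complex_eq_iff)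
  then show ?thesis by (simp add: pole_hyperplanes_def)
qed

lemma closed_poles: "closed {\<xi>::'a::euclidean_space \<Rightarrow>\<^sub>L complex. exp (blinfun_apply \<xi> g) = 1}"
  by (intro closed_Collect_eq continuous_intros)

lemma open_off_poles:
  "finite C \<Longrightarrow> open {\<xi>::'a::euclidean_space \<Rightarrow>\<^sub>L complex. \<forall>g\<in>C. exp (blinfun_apply \<xi> g) \<noteq> 1}"
proof -
  assume "finite C"
  moreover have "{\<xi>::'a \<Rightarrow>\<^sub>L complex. \<forall>g\<in>C. exp (blinfun_apply \<xi> g) \<noteq> 1} = (\<Inter>g\<in>C. - {\<xi>. exp (blinfun_apply \<xi> g) = 1})"
    by auto
  ultimately show ?thesis
    using closed_poles by (simp only:) (intro open_INT ballI open_Compl)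
qed

text \<open>
  A line whose direction \<open>\<kappa>\<close> has non-zero real part at \<open>g\<close> meets the pole hyperplanes of \<open>g\<close> at most
  once, because \<open>exp z = 1\<close> forces the real part of \<open>z\<close> to vanish.
\<close>

lemma dense_off_poles:
  fixes W :: "('a::euclidean_space \<Rightarrow>\<^sub>L complex) set"
  assumes C: "finite C" and W: "\<And>\<xi> t. \<xi> \<in> W \<Longrightarrow> \<xi> + t *\<^sub>R \<kappa> \<in> W"
    and \<kappa>: "\<And>g. g \<in> C \<Longrightarrow> Re (blinfun_apply \<kappa> g) \<noteq> 0"
  shows "W \<subseteq> closure {\<xi>\<in>W. \<forall>g\<in>C. exp (blinfun_apply \<xi> g) \<noteq> 1}"
proof
  fix \<xi> assume \<xi>: "\<xi> \<in> W"
  let ?bad = "(\<lambda>g. - Re (blinfun_apply \<xi> g) / Re (blinfun_apply \<kappa> g)) ` C"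
  show "\<xi> \<in> closure {\<xi>\<in>W. \<forall>g\<in>C. exp (blinfun_apply \<xi> g) \<noteq> 1}"
    unfolding closure_approachable
  proof (intro allI impI)
    fix e :: real assume e: "e > 0"
    have "infinite ({0<..<e / (norm \<kappa> + 1)} - ?bad)"
      using C e by (intro Diff_infinite_finite) (auto intro!: add_nonneg_pos divide_pos_pos)
    then obtain t where t: "t \<in> {0<..<e / (norm \<kappa> + 1)}" "t \<notin> ?bad"
      using infinite_imp_nonempty by blast
    have "exp (blinfun_apply (\<xi> + t *\<^sub>R \<kappa>) g) \<noteq> 1" if "g \<in> C" for g
    proof
      assume "exp (blinfun_apply (\<xi> + t *\<^sub>R \<kappa>) g) = 1"
      then have "Re (blinfun_apply (\<xi> + t *\<^sub>R \<kappa>) g) = 0" by (simp add: exp_eq_1)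
      then have "t = - Re (blinfun_apply \<xi> g) / Re (blinfun_apply \<kappa> g)"
        using \<kappa>[OF that] by (simp add: blinfun.add_left blinfun.scaleR_left field_simps)
      then show False using t(2) that by blast
    qed
    moreover have "dist (\<xi> + t *\<^sub>R \<kappa>) \<xi> < e"
    proof -
      have "t * norm \<kappa> \<le> t * (norm \<kappa> + 1)" using t by (simp add: algebra_simps)
      also have "\<dots> < e" using t by (simp add: pos_less_divide_eq add_nonneg_pos)
      finally show ?thesis using t by (simp add: dist_norm)
    qed
    ultimately show "\<exists>y\<in>{\<xi>\<in>W. \<forall>g\<in>C. exp (blinfun_apply \<xi> g) \<noteq> 1}. dist y \<xi> < e"
      using W[OF \<xi>] by blast
  qed
qed

lift_definition real_functional :: "'a::euclidean_space \<Rightarrow> ('a \<Rightarrow>\<^sub>L complex)"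
  is "\<lambda>\<beta> x. complex_of_real (\<beta> \<bullet> x)"
  by (intro bounded_linear_compose[OF bounded_linear_of_real] bounded_linear_inner_right)

lemma generic_vector:
  fixes C :: "'a::euclidean_space set"
  assumes "finite C" "0 \<notin> C" "e > 0"
  obtains \<beta> where "\<beta> \<in> ball \<beta>0 e" "\<And>g. g \<in> C \<Longrightarrow> \<beta> \<bullet> g \<noteq> 0"
proof -
  have "negligible (\<Union>g\<in>C. {x. g \<bullet> x = 0})"
    using assms by (intro negligible_Union) (auto intro!: negligible_hyperplane)
  moreover have "\<not> negligible (ball \<beta>0 e)"
    using assms by (intro open_not_negligible) auto
  ultimately have "\<not> ball \<beta>0 e \<subseteq> (\<Union>g\<in>C. {x. g \<bullet> x = 0})"
    using negligible_subset by blast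
  then show thesis using that by (force simp: inner_commute)
qed

lemma dense_off_poles_UNIV:
  assumes "finite C" "0 \<notin> C"
  shows "closure {\<xi>::'a::euclidean_space \<Rightarrow>\<^sub>L complex. \<forall>g\<in>C. exp (blinfun_apply \<xi> g) \<noteq> 1} = UNIV"
proof -
  obtain \<beta> where "\<And>g. g \<in> C \<Longrightarrow> \<beta> \<bullet> g \<noteq> 0" using generic_vector[OF assms zero_less_one] by metis
  then have "Re (blinfun_apply (real_functional \<beta>) g) \<noteq> 0" if "g \<in> C" for g
    using that by (simp add: real_functional.rep_eq)
  from dense_off_poles[OF assms(1) _ this, of UNIV] show ?thesis by auto
qed

text \<open>
  Finitely many families of pole hyperplanes have an open dense complement, so an identity of
  meromorphic functions only has to be checked there.
\<close>

lemma local_quotient_off_poles: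
  assumes "finite C" "0 \<notin> C" "open U" "holomorphic_dual U a" "holomorphic_dual U b"
    and "\<And>\<xi>. \<xi> \<in> U \<Longrightarrow> \<forall>g\<in>C. exp (blinfun_apply \<xi> g) \<noteq> 1 \<Longrightarrow> b \<xi> \<noteq> 0 \<and> F \<xi> = a \<xi> / b \<xi>"
  shows "local_quotient F U a b"
proof -
  let ?S = "{\<xi>. \<forall>g\<in>C. exp (blinfun_apply \<xi> g) \<noteq> 1}"
  have "U \<inter> ?S \<subseteq> interior {\<xi> \<in> U. b \<xi> \<noteq> 0 \<and> F \<xi> = a \<xi> / b \<xi>}"
    using open_off_poles[OF assms(1)] assms by (intro interior_maximal open_Int) auto
  moreover have "U \<subseteq> closure (U \<inter> ?S)"
    using open_Int_closure_subset[OF assms(3), of ?S] dense_off_poles_UNIV[OF assms(1,2)] by simp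
  ultimately show ?thesis
    using assms closure_mono unfolding local_quotient_def by blast
qed

section \<open>Smooth functions\<close>

lemma C_k_SucI:
  assumes "\<And>x. (\<phi> has_derivative \<phi>' x) (at x)" "\<And>v. C_k k (\<lambda>x. \<phi>' x v)"
  shows "C_k (Suc k) \<phi>"
proof -
  have "frechet_derivative \<phi> (at x) = \<phi>' x" for x
    using frechet_derivative_at[OF assms(1)] by simp
  then show ?thesis using assms by (auto simp: differentiable_def)
qed

lemma C_k_Suc_imp: "C_k (Suc k) \<phi> \<Longrightarrow> C_k k \<phi>"
proof (induction k arbitrary: \<phi>)
  case 0
  then show ?case
    by (auto simp: continuous_on_eq_continuous_at differentiable_imp_continuous_within)
next
  case (Suc k)
  then show ?case by (metis C_k.simps(2))
qed

lemma C_k_differentiable: "C_k (Suc k) \<phi> \<Longrightarrow> (\<phi> has_derivative frechet_derivative \<phi> (at x)) (at x)"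
  using frechet_derivative_works by auto

lemma C_k_const: "C_k k (\<lambda>_. c)"
proof (induction k arbitrary: c)
  case (Suc k)
  show ?case by (rule C_k_SucI[where \<phi>' = "\<lambda>_ _. 0"]) (auto intro: Suc)
qed simp

lemma C_k_add: "C_k k f \<Longrightarrow> C_k k g \<Longrightarrow> C_k k (\<lambda>x. f x + g x)"
proof (induction k arbitrary: f g)
  case (Suc k)
  show ?case
    by (rule C_k_SucI[OF has_derivative_add[OF C_k_differentiable[OF Suc.prems(1)] C_k_differentiable[OF Suc.prems(2)]]])
       (use Suc in auto)
qed (auto intro: continuous_intros)

lemma C_k_mult: "C_k k f \<Longrightarrow> C_k k g \<Longrightarrow> C_k k (\<lambda>x. f x * g x)"
proof (induction k arbitrary: f g)
  case (Suc k)
  show ?case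
    by (rule C_k_SucI[OF has_derivative_mult[OF C_k_differentiable[OF Suc.prems(1)] C_k_differentiable[OF Suc.prems(2)]]])
       (intro C_k_add Suc.IH C_k_Suc_imp[OF Suc.prems(1)] C_k_Suc_imp[OF Suc.prems(2)],
        use Suc.prems in auto)
qed (auto intro: continuous_intros)

lemma C_k_affine: "C_k k (\<lambda>x. of_real (v \<bullet> x + c))"
proof (induction k)
  case (Suc k)
  have "((\<lambda>x. complex_of_real (v \<bullet> x + c)) has_derivative (\<lambda>h. of_real (v \<bullet> h))) (at x)" for x
    by (auto intro!: derivative_eq_intros)
  then show ?case by (rule C_k_SucI) (rule C_k_const)
qed (auto intro!: continuous_intros)

lemma C_k_exp: "C_k k (\<lambda>\<theta>. exp (\<i> * of_real (\<theta> \<bullet> x)))"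
proof (induction k)
  case (Suc k)
  have "((\<lambda>\<theta>. exp (\<i> * complex_of_real (\<theta> \<bullet> x))) has_derivative (\<lambda>h. \<i> * of_real (h \<bullet> x) * exp (\<i> * of_real (\<theta> \<bullet> x)))) (at \<theta>)" for \<theta>
  proof -
    have 1: "((\<lambda>\<theta>. \<i> * complex_of_real (\<theta> \<bullet> x)) has_derivative (\<lambda>h. \<i> * of_real (h \<bullet> x))) (at \<theta>)"
      by (auto intro!: derivative_eq_intros)
    have "(exp has_derivative (\<lambda>h. exp (\<i> * complex_of_real (\<theta> \<bullet> x)) * h)) (at (\<i> * complex_of_real (\<theta> \<bullet> x)))"
      using DERIV_exp unfolding has_field_derivative_def by blast
    from has_derivative_compose[OF 1 this] show ?thesis by (simp add: mult_ac)
  qed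
  then show ?case by (rule C_k_SucI) (intro C_k_mult C_k_const Suc)
qed (auto intro!: continuous_intros)

lemma outside_support: "x \<notin> support \<phi> \<Longrightarrow> \<phi> x = 0"
  using closure_subset[of "{x. \<phi> x \<noteq> 0}"] by (auto simp: support_def)

lemma zero_near_outside_support:
  assumes "x \<notin> support \<phi>"
  shows "\<forall>\<^sub>F y in nhds x. \<phi> y = 0"
proof -
  have "\<forall>\<^sub>F y in nhds x. y \<in> - support \<phi>"
    using assms by (intro eventually_nhds_in_open) (auto simp: support_def)
  then show ?thesis
    by eventually_elim (use outside_support in auto)
qed

lemma has_derivative_zero_outside_support:
  assumes "x \<notin> support \<phi>"
  shows "(\<phi> has_derivative (\<lambda>_. 0)) (at x)"
proof (rule has_derivative_transform_eventually[OF has_derivative_const[of 0]])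
  show "\<forall>\<^sub>F y in at x. 0 = \<phi> y"
    using zero_near_outside_support[OF assms] unfolding eventually_at_filter
    by eventually_elim simp
qed (use outside_support[OF assms] in auto)

lemma support_subset: "(\<And>x. x \<notin> support \<phi> \<Longrightarrow> \<psi> x = 0) \<Longrightarrow> support \<psi> \<subseteq> support \<phi>"
  unfolding support_def by (intro closure_minimal) auto

lemma support_deriv: "support (\<lambda>x. frechet_derivative \<phi> (at x) v) \<subseteq> support \<phi>"
proof (rule support_subset)
  fix x assume "x \<notin> support \<phi>"
  from frechet_derivative_at[OF has_derivative_zero_outside_support[OF this]]
  show "frechet_derivative \<phi> (at x) v = 0" by metis
qed

text \<open>
  With \<open>d = 1 - exp\<close>, the derivative of \<open>\<phi> / d ^ m\<close> is a combination of functions of the same form,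
  since the derivative of \<open>d\<close> is a multiple of \<open>1 - d\<close>.  The induction therefore runs over all \<open>m\<close> at
  once.  Near a zero of \<open>d\<close> the numerator vanishes.
\<close>

lemma C_k_divide_power:
  assumes "\<And>k. C_k k \<phi>" "\<And>\<theta>. \<theta> \<in> support \<phi> \<Longrightarrow> exp (\<i> * of_real (\<theta> \<bullet> g)) \<noteq> 1"
  shows "C_k k (\<lambda>\<theta>. \<phi> \<theta> / (1 - exp (\<i> * of_real (\<theta> \<bullet> g))) ^ m)"
  using assms
proof (induction k arbitrary: \<phi> m)
  case (0 \<phi> m)
  have cont: "continuous_on UNIV \<phi>" using 0(1)[of 0] by simp
  have "isCont (\<lambda>\<theta>. \<phi> \<theta> / (1 - exp (\<i> * of_real (\<theta> \<bullet> g))) ^ m) x" for x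
  proof (cases "x \<in> support \<phi>")
    case True
    then show ?thesis
      using 0(2)[OF True] cont by (auto simp: continuous_on_eq_continuous_at intro!: continuous_intros)
  next
    case False
    have "\<forall>\<^sub>F y in nhds x. \<phi> y / (1 - exp (\<i> * of_real (y \<bullet> g))) ^ m = 0"
      using zero_near_outside_support[OF False] by eventually_elim simp
    then have "isCont (\<lambda>\<theta>. \<phi> \<theta> / (1 - exp (\<i> * of_real (\<theta> \<bullet> g))) ^ m) x \<longleftrightarrow> isCont (\<lambda>_. 0 :: complex) x"
      by (rule isCont_cong)
    then show ?thesis by simp
  qed
  then show ?case by (simp add: continuous_on_eq_continuous_at)
next
  case (Suc k \<phi> m)
  let ?d = "\<lambda>\<theta>. 1 - exp (\<i> * complex_of_real (\<theta> \<bullet> g))"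
  let ?\<phi>' = "\<lambda>\<theta> v. frechet_derivative \<phi> (at \<theta>) v"
  let ?D = "\<lambda>\<theta> v. ?\<phi>' \<theta> v / ?d \<theta> ^ m + (- (of_nat m * \<i> * of_real (v \<bullet> g))) * (\<phi> \<theta> / ?d \<theta> ^ m)
     + (of_nat m * \<i> * of_real (v \<bullet> g)) * (\<phi> \<theta> / ?d \<theta> ^ Suc m)"
  have "((\<lambda>\<theta>. \<phi> \<theta> / ?d \<theta> ^ m) has_derivative ?D \<theta>) (at \<theta>)" for \<theta>
  proof (cases "\<theta> \<in> support \<phi>")
    case True
    then have d: "?d \<theta> \<noteq> 0" using Suc.prems(2) by auto
    have 1: "((\<lambda>\<theta>. \<i> * complex_of_real (\<theta> \<bullet> g)) has_derivative (\<lambda>h. \<i> * of_real (h \<bullet> g))) (at \<theta>)"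
      by (auto intro!: derivative_eq_intros)
    have "((\<lambda>z. inverse ((1 - exp z) ^ m)) has_field_derivative
        (of_nat m * exp (\<i> * complex_of_real (\<theta> \<bullet> g)) / ?d \<theta> ^ Suc m)) (at (\<i> * complex_of_real (\<theta> \<bullet> g)))"
    proof -
      have *: "((\<lambda>w. inverse (w ^ m)) has_field_derivative (- of_nat m / w ^ Suc m)) (at w)" if "w \<noteq> 0" for w :: complex
      proof (cases m)
        case (Suc m')
        have "w ^ m \<noteq> 0" using that by simp
        moreover have "((\<lambda>w. w ^ m) has_field_derivative (of_nat m * w ^ (m - Suc 0))) (at w)"
          by (rule DERIV_cong[OF DERIV_power[OF DERIV_ident]]) simp
        ultimately have "((\<lambda>w. inverse (w ^ m)) has_field_derivative
            - ((of_nat m * w ^ (m - Suc 0)) * inverse ((w ^ m) ^ Suc (Suc 0)))) (at w)"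
          by (intro DERIV_inverse_fun)
        then
        show ?thesis unfolding Suc using that
          by (simp add: field_simps power2_eq_square del: of_nat_Suc)
      qed simp
      have "((\<lambda>z. 1 - exp z) has_field_derivative - exp z) (at z)" for z :: complex
        by (auto intro!: derivative_eq_intros)
      from DERIV_chain2[OF *[OF d] this] show ?thesis by simp
    qed
    then have "((\<lambda>z. inverse ((1 - exp z) ^ m)) has_derivative
        (*) (of_nat m * exp (\<i> * complex_of_real (\<theta> \<bullet> g)) / ?d \<theta> ^ Suc m)) (at (\<i> * complex_of_real (\<theta> \<bullet> g)))"
      unfolding has_field_derivative_def .
    from has_derivative_mult[OF C_k_differentiable[OF Suc.prems(1)] has_derivative_compose[OF 1 this]]
    have "((\<lambda>\<theta>. \<phi> \<theta> * inverse (?d \<theta> ^ m)) has_derivative 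
       (\<lambda>h. \<phi> \<theta> * (of_nat m * exp (\<i> * complex_of_real (\<theta> \<bullet> g)) / ?d \<theta> ^ Suc m * (\<i> * of_real (h \<bullet> g))) +
         ?\<phi>' \<theta> h * inverse (?d \<theta> ^ m))) (at \<theta>)" .
    moreover
    have "\<phi> \<theta> * (of_nat m * exp (\<i> * complex_of_real (\<theta> \<bullet> g)) / ?d \<theta> ^ Suc m * (\<i> * of_real (h \<bullet> g))) +
         ?\<phi>' \<theta> h * inverse (?d \<theta> ^ m) = ?D \<theta> h" for h
      using d by (simp add: field_simps)
    then have "(\<lambda>h. \<phi> \<theta> * (of_nat m * exp (\<i> * complex_of_real (\<theta> \<bullet> g)) / ?d \<theta> ^ Suc m * (\<i> * of_real (h \<bullet> g))) +
         ?\<phi>' \<theta> h * inverse (?d \<theta> ^ m)) = ?D \<theta>" by (rule ext)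
    ultimately have "((\<lambda>\<theta>. \<phi> \<theta> * inverse (?d \<theta> ^ m)) has_derivative ?D \<theta>) (at \<theta>)" by (simp only:)
    moreover have "(\<lambda>\<theta>. \<phi> \<theta> / ?d \<theta> ^ m) = (\<lambda>\<theta>. \<phi> \<theta> * inverse (?d \<theta> ^ m))" by (simp add: divide_inverse)
    ultimately show ?thesis by (simp only:)
  next
    case False
    have "((\<lambda>\<theta>. \<phi> \<theta> / ?d \<theta> ^ m) has_derivative (\<lambda>_. 0)) (at \<theta>)"
      by (rule has_derivative_zero_outside_support)
         (use False support_subset[of \<phi> "\<lambda>\<theta>. \<phi> \<theta> / ?d \<theta> ^ m"] outside_support in auto)
    moreover have "?D \<theta> = (\<lambda>_. 0)"
      using frechet_derivative_at[OF has_derivative_zero_outside_support[OF False]] outside_support[OF False]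
      by (auto simp: fun_eq_iff)
    ultimately show ?thesis by simp
  qed
  moreover have "C_k k (\<lambda>\<theta>. ?D \<theta> v)" for v
  proof -
    have "C_k k (\<lambda>\<theta>. ?\<phi>' \<theta> v / ?d \<theta> ^ m)"
      using Suc.prems(2) support_deriv[of \<phi> v] Suc.prems(1)[of "Suc _"] 
      by (intro Suc.IH) auto
    moreover have "C_k k (\<lambda>\<theta>. \<phi> \<theta> / ?d \<theta> ^ m)" for m
      by (rule Suc.IH[OF Suc.prems])
    ultimately show ?thesis
      by (intro C_k_add C_k_mult C_k_const)
  qed
  ultimately show ?case by (rule C_k_SucI)
qed

section \<open>Fourier transforms of test functions\<close>

definition fourier :: "('a::euclidean_space \<Rightarrow> complex) \<Rightarrow> 'a \<Rightarrow> complex" where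
  "fourier \<phi> x = (\<integral>\<theta>. \<phi> \<theta> * exp (blinfun_apply (imag_functional \<theta>) x) \<partial>lborel)"

lemma test_function_C_k: "test_function \<phi> \<Longrightarrow> C_k k \<phi>"
  by (simp add: test_function_def)

lemma test_function_cont: "test_function \<phi> \<Longrightarrow> continuous_on UNIV \<phi>"
  using test_function_C_k[of \<phi> 0] by simp

lemma test_function_subset:
  assumes "test_function \<phi>" "\<And>k. C_k k \<psi>" "support \<psi> \<subseteq> support \<phi>"
  shows "test_function \<psi>"
  using assms compact_Int_closed[of "support \<phi>" "support \<psi>"]
  by (auto simp: test_function_def support_def Int_absorb1)

lemma test_function_deriv:
  "test_function \<phi> \<Longrightarrow> test_function (\<lambda>x. frechet_derivative \<phi> (at x) v)"
proof (rule test_function_subset[of \<phi>])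
  assume "test_function \<phi>"
  then show "C_k k (\<lambda>x. frechet_derivative \<phi> (at x) v)" for k
    using test_function_C_k[of \<phi> "Suc k"] by simp
qed (simp_all add: support_deriv)

lemma test_function_mult:
  assumes "test_function \<phi>" "\<And>k. C_k k \<psi>"
  shows "test_function (\<lambda>x. \<phi> x * \<psi> x)"
proof (rule test_function_subset[OF assms(1)])
  show "C_k k (\<lambda>x. \<phi> x * \<psi> x)" for k
    by (intro C_k_mult test_function_C_k assms)
  show "support (\<lambda>x. \<phi> x * \<psi> x) \<subseteq> support \<phi>"
    by (rule support_subset) (simp add: outside_support)
qed

lemma continuous_compact_support_integrable:
  fixes F :: "'a::euclidean_space \<Rightarrow> complex"
  assumes "compact S" "continuous_on S F" "\<And>x. x \<notin> S \<Longrightarrow> F x = 0"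
  shows "integrable lborel F"
proof -
  have "(\<lambda>x. indicator S x *\<^sub>R F x) = F"
    using assms(3) by (auto simp: fun_eq_iff indicator_def)
  then show ?thesis using borel_integrable_compact[OF assms(1,2)] by simp
qed

lemma test_function_integrable: "test_function \<phi> \<Longrightarrow> integrable lborel \<phi>"
  using continuous_compact_support_integrable[of "support \<phi>" \<phi>] outside_support[of _ \<phi>]
    continuous_on_subset[OF test_function_cont] 
  by (auto simp: test_function_def)

lemma test_function_bounded:
  assumes "test_function \<phi>" obtains B where "B \<ge> 0" "\<And>x. norm (\<phi> x) \<le> B"
proof -
  have "bounded (\<phi> ` support \<phi>)"
    using assms continuous_on_subset[OF test_function_cont[OF assms]]
    by (intro compact_imp_bounded compact_continuous_image) (auto simp: test_function_def)
  then obtain B where B: "\<And>x. x \<in> support \<phi> \<Longrightarrow> norm (\<phi> x) \<le> B"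
    unfolding bounded_iff by auto
  have "norm (\<phi> x) \<le> max B 0" for x
    using B[of x] outside_support[of x \<phi>] by (cases "x \<in> support \<phi>") auto
  then show thesis using that[of "max B 0"] by auto
qed

lemma integral_translate:
  fixes F :: "'a::euclidean_space \<Rightarrow> complex"
  assumes "F \<in> borel_measurable borel"
  shows "(\<integral>\<theta>. F (c + \<theta>) \<partial>lborel) = (\<integral>\<theta>. F \<theta> \<partial>lborel)"
proof -
  have "(\<integral>\<theta>. F \<theta> \<partial>lborel) = (\<integral>\<theta>. F \<theta> \<partial>(distr lborel borel ((+) c)))"
    by (simp only: lborel_distr_plus)
  also have "\<dots> = (\<integral>\<theta>. F (c + \<theta>) \<partial>lborel)"
    using assms by (intro integral_distr) auto
  finally show ?thesis by simp
qed

text \<open>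
  Integrals are translation invariant, so all difference quotients of \<open>\<phi>\<close> have integral \<open>0\<close>, and they
  converge boundedly to the derivative.
\<close>

lemma integral_deriv_zero:
  fixes \<phi> :: "'a::euclidean_space \<Rightarrow> complex"
  assumes "test_function \<phi>"
  shows "(\<integral>\<theta>. frechet_derivative \<phi> (at \<theta>) v \<partial>lborel) = 0"
proof (cases "v = 0")
  case True
  have "frechet_derivative \<phi> (at \<theta>) 0 = 0" for \<theta>
    by (rule linear_0[OF bounded_linear.linear[OF has_derivative_bounded_linear[OF C_k_differentiable[OF test_function_C_k[OF assms]]]]])
  then show ?thesis using True by simp
next
  case False
  let ?D = "\<lambda>\<theta>. frechet_derivative \<phi> (at \<theta>)"
  have der: "(\<phi> has_derivative ?D \<theta>) (at \<theta>)" for \<theta>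
    using C_k_differentiable[OF test_function_C_k[OF assms]] .
  have linD: "linear (?D \<theta>)" for \<theta>
    by (rule bounded_linear.linear[OF has_derivative_bounded_linear[OF der]])
  have mphi: "\<phi> \<in> borel_measurable borel"
    using test_function_cont[OF assms] by (rule borel_measurable_continuous_onI)
  obtain B where B: "B \<ge> 0" "\<And>\<theta>. norm (?D \<theta> v) \<le> B"
    using test_function_bounded[OF test_function_deriv[OF assms]] by metis
  define h where "h n = inverse (real (Suc n)) *\<^sub>R v" for n
  define F where "F n \<theta> = of_real (real (Suc n)) * (\<phi> (h n + \<theta>) - \<phi> \<theta>)" for n \<theta>
  have int0: "(\<integral>\<theta>. F n \<theta> \<partial>lborel) = 0" for n
  proof -
    have i1: "integrable lborel \<phi>" by (rule test_function_integrable[OF assms])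
    have "integrable (distr lborel borel ((+) (h n))) \<phi>"
      by (subst lborel_distr_plus) (rule i1)
    then have "integrable lborel (\<lambda>\<theta>. \<phi> (h n + \<theta>))"
      using integrable_distr[of "(+) (h n)" lborel borel \<phi>] by simp
    then show ?thesis
      unfolding F_def using i1 integral_translate[OF mphi, of "h n"] by simp
  qed
  have lim: "(\<lambda>n. F n \<theta>) \<longlonglongrightarrow> ?D \<theta> v" for \<theta>
  proof -
    have "filterlim h (at 0) sequentially"
      unfolding filterlim_at
    proof
      show "\<forall>\<^sub>F n in sequentially. h n \<in> UNIV \<and> h n \<noteq> 0"
        using False by (simp add: h_def del: of_nat_Suc)
      show "h \<longlonglongrightarrow> 0"
        unfolding h_def using tendsto_scaleR[OF LIMSEQ_inverse_real_of_nat tendsto_const[of v]] by simp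
    qed
    moreover have "((\<lambda>h. norm (\<phi> (\<theta> + h) - \<phi> \<theta> - ?D \<theta> h) / norm h) \<longlongrightarrow> 0) (at 0)"
      using der[of \<theta>] unfolding has_derivative_at by blast
    ultimately have "(\<lambda>n. norm (\<phi> (\<theta> + h n) - \<phi> \<theta> - ?D \<theta> (h n)) / norm (h n)) \<longlonglongrightarrow> 0"
      by (rule filterlim_compose[rotated])
    then have "(\<lambda>n. norm v * (norm (\<phi> (\<theta> + h n) - \<phi> \<theta> - ?D \<theta> (h n)) / norm (h n))) \<longlonglongrightarrow> norm v * 0"
      by (intro tendsto_intros)
    moreover have "norm v * (norm (\<phi> (\<theta> + h n) - \<phi> \<theta> - ?D \<theta> (h n)) / norm (h n)) = norm (F n \<theta> - ?D \<theta> v)" for n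
    proof -
      have D: "?D \<theta> (h n) = of_real (inverse (real (Suc n))) * ?D \<theta> v"
        unfolding h_def linear_cmul[OF linD] by (simp add: scaleR_conv_of_real)
      have "F n \<theta> - ?D \<theta> v = of_real (real (Suc n)) * (\<phi> (\<theta> + h n) - \<phi> \<theta> - ?D \<theta> (h n))"
        unfolding F_def D by (simp add: algebra_simps del: of_nat_Suc flip: of_real_mult)
      then have nF: "norm (F n \<theta> - ?D \<theta> v) = real (Suc n) * norm (\<phi> (\<theta> + h n) - \<phi> \<theta> - ?D \<theta> (h n))"
        by (simp only: norm_mult norm_of_real abs_of_nat)
      have nh: "norm (h n) = norm v / real (Suc n)"
        by (simp add: h_def divide_inverse mult.commute del: of_nat_Suc)
      have "norm v * (A / (norm v / r)) = r * A" for A r :: real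
        using False by simp
      then show ?thesis by (simp only: nF nh)
    qed
    ultimately have "(\<lambda>n. norm (F n \<theta> - ?D \<theta> v)) \<longlonglongrightarrow> 0" by (simp only: mult_zero_right)
    then show ?thesis by (rule LIM_zero_cancel[OF tendsto_norm_zero_cancel])
  qed
  obtain R where R: "support \<phi> \<subseteq> cball 0 R"
  proof -
    have "bounded (support \<phi>)"
      using assms by (auto simp: test_function_def intro: compact_imp_bounded)
    then obtain R where "\<forall>x\<in>support \<phi>. norm x \<le> R" unfolding bounded_iff by blast
    then have "support \<phi> \<subseteq> cball 0 R" by auto
    then show thesis by (rule that)
  qed
  let ?w = "\<lambda>\<theta>. indicator (cball 0 (R + norm v)) \<theta> *\<^sub>R B"
  have bound: "norm (F n \<theta>) \<le> ?w \<theta>" for n \<theta>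
  proof (cases "\<theta> \<in> cball 0 (R + norm v)")
    case True
    have "norm ((\<lambda>t. \<phi> (\<theta> + t *\<^sub>R v)) (inverse (real (Suc n))) - (\<lambda>t. \<phi> (\<theta> + t *\<^sub>R v)) 0) \<le> B * norm (inverse (real (Suc n)) - 0)"
    proof (rule differentiable_bound[where S = UNIV and f' = "\<lambda>t h. ?D (\<theta> + t *\<^sub>R v) (h *\<^sub>R v)"])
      fix t :: real
      have "((\<lambda>t. \<theta> + t *\<^sub>R v) has_derivative (\<lambda>h. h *\<^sub>R v)) (at t)"
        by (auto intro!: derivative_eq_intros)
      from has_derivative_compose[OF this der]
      show "((\<lambda>t. \<phi> (\<theta> + t *\<^sub>R v)) has_derivative (\<lambda>h. ?D (\<theta> + t *\<^sub>R v) (h *\<^sub>R v))) (at t)" .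
      show "onorm (\<lambda>h. ?D (\<theta> + t *\<^sub>R v) (h *\<^sub>R v)) \<le> B"
        using B by (intro onorm_bound) (auto simp: linear_cmul[OF linD] mult.commute[of B] intro!: mult_left_mono)
    qed auto
    then have "norm (\<phi> (h n + \<theta>) - \<phi> \<theta>) \<le> B * inverse (real (Suc n))"
      by (simp add: h_def add.commute del: of_nat_Suc)
    then have "norm (F n \<theta>) \<le> real (Suc n) * (B * inverse (real (Suc n)))"
      unfolding F_def norm_mult norm_of_real abs_of_nat by (intro mult_left_mono) auto
    then show ?thesis using True by (simp add: field_simps del: of_nat_Suc)
  next
    case False
    have "norm (h n) \<le> 1 * norm v"
      unfolding h_def norm_scaleR by (intro mult_right_mono) (auto simp: field_simps)
    then have "norm \<theta> > R" "norm (h n + \<theta>) > R"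
      using False norm_triangle_ineq2[of \<theta> "- h n"] norm_ge_zero[of v] by (auto simp: add.commute simp del: norm_ge_zero)
    then have "\<theta> \<notin> support \<phi>" "h n + \<theta> \<notin> support \<phi>" using R by (auto simp: subset_iff)
    then show ?thesis using B by (simp add: F_def outside_support indicator_def)
  qed
  have "(\<lambda>n. \<integral>\<theta>. F n \<theta> \<partial>lborel) \<longlonglongrightarrow> (\<integral>\<theta>. ?D \<theta> v \<partial>lborel)"
  proof (rule integral_dominated_convergence)
    show "(\<lambda>\<theta>. ?D \<theta> v) \<in> borel_measurable lborel"
      using test_function_integrable[OF test_function_deriv[OF assms]] by (rule borel_measurable_integrable)
    show "F n \<in> borel_measurable lborel" for n
      unfolding F_def using mphi by measurable
    show "integrable lborel ?w"
      by (intro borel_integrable_compact) auto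
  qed (use lim bound in auto)
  then show ?thesis using int0 by (simp add: LIMSEQ_const_iff)
qed

lemma imag_functional_apply: "blinfun_apply (imag_functional \<theta>) x = \<i> * of_real (\<theta> \<bullet> x)"
  by (simp add: imag_functional.rep_eq)

lemma test_function_exp:
  "test_function \<phi> \<Longrightarrow> test_function (\<lambda>\<theta>. \<phi> \<theta> * exp (\<i> * of_real (\<theta> \<bullet> x)))"
  by (intro test_function_mult C_k_exp)

lemma fourier_deriv:
  assumes "test_function \<phi>"
  shows "fourier (\<lambda>\<theta>. frechet_derivative \<phi> (at \<theta>) v) x = - (\<i> * of_real (v \<bullet> x)) * fourier \<phi> x"
proof -
  let ?e = "\<lambda>\<theta>. exp (\<i> * complex_of_real (\<theta> \<bullet> x))"
  let ?D = "\<lambda>\<theta>. frechet_derivative \<phi> (at \<theta>)"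
  have "((\<lambda>\<theta>. \<phi> \<theta> * ?e \<theta>) has_derivative (\<lambda>h. \<phi> \<theta> * (\<i> * of_real (h \<bullet> x) * ?e \<theta>) + ?D \<theta> h * ?e \<theta>)) (at \<theta>)" for \<theta>
  proof (rule has_derivative_mult[OF C_k_differentiable[OF test_function_C_k[OF assms]]])
    have 1: "((\<lambda>\<theta>. \<i> * complex_of_real (\<theta> \<bullet> x)) has_derivative (\<lambda>h. \<i> * of_real (h \<bullet> x))) (at \<theta>)"
      by (auto intro!: derivative_eq_intros)
    have "(exp has_derivative (\<lambda>h. ?e \<theta> * h)) (at (\<i> * complex_of_real (\<theta> \<bullet> x)))"
      using DERIV_exp unfolding has_field_derivative_def by blast
    from has_derivative_compose[OF 1 this] 
    show "(?e has_derivative (\<lambda>h. \<i> * of_real (h \<bullet> x) * ?e \<theta>)) (at \<theta>)" by (simp add: mult_ac)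
  qed
  then have eq: "frechet_derivative (\<lambda>\<theta>. \<phi> \<theta> * ?e \<theta>) (at \<theta>) v = \<i> * of_real (v \<bullet> x) * (\<phi> \<theta> * ?e \<theta>) + ?D \<theta> v * ?e \<theta>" for \<theta>
    using frechet_derivative_at by (metis (no_types, lifting) mult.assoc mult.left_commute)
  have "0 = (\<integral>\<theta>. \<i> * of_real (v \<bullet> x) * (\<phi> \<theta> * ?e \<theta>) + ?D \<theta> v * ?e \<theta> \<partial>lborel)"
    using integral_deriv_zero[OF test_function_exp[OF assms, of x], of v] unfolding eq by simp
  also have "\<dots> = \<i> * of_real (v \<bullet> x) * fourier \<phi> x + fourier (\<lambda>\<theta>. ?D \<theta> v) x"
    unfolding fourier_def imag_functional_apply
    using test_function_integrable[OF test_function_exp[OF assms]]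
      test_function_integrable[OF test_function_exp[OF test_function_deriv[OF assms]]]
    by (subst Bochner_Integration.integral_add) auto
  finally show ?thesis by (simp add: eq_neg_iff_add_eq_0 add.commute)
qed

lemma fourier_decay_direction:
  assumes "test_function \<phi>"
  shows "\<exists>A. \<forall>x. \<bar>b \<bullet> x\<bar> ^ K * norm (fourier \<phi> x) \<le> A"
  using assms
proof (induction K arbitrary: \<phi>)
  case 0
  have "norm (fourier \<phi> x) \<le> (\<integral>\<theta>. norm (\<phi> \<theta>) \<partial>lborel)" for x
  proof -
    have "norm (fourier \<phi> x) \<le> (\<integral>\<theta>. norm (\<phi> \<theta> * exp (\<i> * of_real (\<theta> \<bullet> x))) \<partial>lborel)"
      unfolding fourier_def imag_functional_apply by (rule integral_norm_bound)
    then show ?thesis by (simp add: norm_mult)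
  qed
  then show ?case by auto
next
  case (Suc K)
  from Suc.IH[OF test_function_deriv[OF Suc.prems]]
  obtain A where "\<And>x. \<bar>b \<bullet> x\<bar> ^ K * norm (fourier (\<lambda>\<theta>. frechet_derivative \<phi> (at \<theta>) b) x) \<le> A" by blast
  then show ?case
    by (intro exI[of _ A]) (simp add: fourier_deriv[OF Suc.prems] norm_mult mult_ac)
qed

text \<open>
  A directional derivative of \<open>\<phi>\<close> multiplies the Fourier transform by a linear form, and Fourier
  transforms are bounded; iterating in the basis directions gives decay of every order.
\<close>

lemma fourier_decay:
  fixes \<phi> :: "'a::euclidean_space \<Rightarrow> complex"
  assumes "test_function \<phi>"
  obtains A where "\<forall>x. norm (fourier \<phi> x) * (1 + norm x) ^ K \<le> A"
proof -
  obtain A where A: "\<And>b x. \<bar>b \<bullet> x\<bar> ^ K * norm (fourier \<phi> x) \<le> A b"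
    using fourier_decay_direction[OF assms, of _ K] by metis
  obtain A0 where A0: "\<And>x. norm (fourier \<phi> x) \<le> A0"
    using fourier_decay_direction[OF assms, of _ 0] by auto
  let ?n = "real DIM('a)"
  have "norm (fourier \<phi> x) * (1 + norm x) ^ K \<le> (?n + 1) ^ K * (A0 + (\<Sum>b\<in>Basis. \<bar>A b\<bar>))" for x
  proof -
    have fx: "norm (fourier \<phi> x) * (max 1 m) ^ K \<le> A0 + (\<Sum>b\<in>Basis. \<bar>A b\<bar>)" 
      if m: "\<forall>b\<in>Basis. \<bar>b \<bullet> x\<bar> \<le> m" "m = 0 \<or> (\<exists>b\<in>Basis. m = \<bar>b \<bullet> x\<bar>)" for m
    proof (cases "m \<le> 1")
      case True
      then have "norm (fourier \<phi> x) * (max 1 m) ^ K = norm (fourier \<phi> x)" by simp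
      also have "\<dots> \<le> A0 + (\<Sum>b\<in>Basis. \<bar>A b\<bar>)"
        by (intro add_increasing2 A0 sum_nonneg) auto
      finally show ?thesis .
    next
      case False
      then obtain b where b: "b \<in> Basis" "m = \<bar>b \<bullet> x\<bar>" using m by auto
      have "norm (fourier \<phi> x) * (max 1 m) ^ K = \<bar>b \<bullet> x\<bar> ^ K * norm (fourier \<phi> x)"
        using False b by simp
      also have "\<dots> \<le> \<bar>A b\<bar>" using A[of b x] by linarith
      also have "\<dots> \<le> (\<Sum>b\<in>Basis. \<bar>A b\<bar>)" using b by (intro member_le_sum) auto
      also have "\<dots> \<le> A0 + (\<Sum>b\<in>Basis. \<bar>A b\<bar>)" using A0[of x] norm_ge_zero[of "fourier \<phi> x"] by linarith
      finally show ?thesis .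
    qed
    define m where "m = Max ((\<lambda>b. \<bar>b \<bullet> x\<bar>) ` Basis)"
    have m: "\<forall>b\<in>Basis. \<bar>b \<bullet> x\<bar> \<le> m" unfolding m_def by auto
    have "m \<in> (\<lambda>b. \<bar>b \<bullet> x\<bar>) ` Basis" unfolding m_def by (rule Max_in) auto
    then have m2: "\<exists>b\<in>Basis. m = \<bar>b \<bullet> x\<bar>" by auto
    have "norm x \<le> (\<Sum>b\<in>Basis. \<bar>x \<bullet> b\<bar>)" by (rule norm_le_l1)
    also have "\<dots> \<le> (\<Sum>b\<in>(Basis :: 'a set). m)" using m by (intro sum_mono) (simp add: inner_commute)
    finally have "norm x \<le> ?n * m" by simp
    also have "\<dots> \<le> ?n * max 1 m" by (intro mult_left_mono) auto
    finally have "1 + norm x \<le> (?n + 1) * max 1 m" by (simp add: algebra_simps max_def split: if_splits)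
    then have "(1 + norm x) ^ K \<le> ((?n + 1) * max 1 m) ^ K" by (intro power_mono) auto
    then have "norm (fourier \<phi> x) * (1 + norm x) ^ K \<le> norm (fourier \<phi> x) * ((?n + 1) * max 1 m) ^ K"
      by (intro mult_left_mono) auto
    also have "\<dots> = (?n + 1) ^ K * (norm (fourier \<phi> x) * (max 1 m) ^ K)" by (simp add: power_mult_distrib)
    also have "\<dots> \<le> (?n + 1) ^ K * (A0 + (\<Sum>b\<in>Basis. \<bar>A b\<bar>))"
      using fx[OF m] m2 by (intro mult_left_mono) auto
    finally show ?thesis .
  qed
  then show thesis using that by blast
qed

section \<open>Sums over lattices\<close>

lemma independent_coeff_bound:
  fixes B :: "'a::euclidean_space set"
  assumes "independent B"
  obtains C where "C \<ge> 0" "\<And>c b. b \<in> B \<Longrightarrow> \<bar>c b\<bar> \<le> C * norm (\<Sum>b\<in>B. c b *\<^sub>R b)"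
proof -
  have fin: "finite B" using assms independent_imp_finite by blast
  have "\<exists>f. linear f \<and> (\<forall>b'\<in>B. f b' = (if b' = b then 1 else 0 :: real))" for b
    using linear_independent_extend[OF assms, of "\<lambda>b'. if b' = b then 1 else 0"] by auto
  then obtain f where f: "\<And>b. linear (f b)" "\<And>b b'. b' \<in> B \<Longrightarrow> f b b' = (if b' = b then 1 else 0 :: real)"
    by metis
  have "f b (\<Sum>b\<in>B. c b *\<^sub>R b) = c b" if "b \<in> B" for b c
  proof -
    have "f b (\<Sum>b\<in>B. c b *\<^sub>R b) = (\<Sum>b'\<in>B. c b' * f b b')"
      by (simp add: linear_sum[OF f(1)] linear_cmul[OF f(1)])
    also have "\<dots> = (\<Sum>b'\<in>B. if b' = b then c b' else 0)" by (intro sum.cong) (auto simp: f)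
    finally show ?thesis using that fin by simp
  qed
  note fb = this
  have "\<exists>C. \<forall>x. norm (f b x) \<le> C * norm x \<and> C \<ge> 0" for b
    using linear_bounded_pos[OF f(1), of b] by (metis less_imp_le)
  then obtain C where C: "\<And>b x. norm (f b x) \<le> C b * norm x" "\<And>b. C b \<ge> 0" by metis
  have "\<bar>c b\<bar> \<le> (\<Sum>b\<in>B. C b) * norm (\<Sum>b\<in>B. c b *\<^sub>R b)" if b: "b \<in> B" for c b
  proof -
    have "\<bar>c b\<bar> \<le> C b * norm (\<Sum>b\<in>B. c b *\<^sub>R b)" using C(1)[of b "\<Sum>b\<in>B. c b *\<^sub>R b"] fb[OF b] by simp
    also have "\<dots> \<le> (\<Sum>b\<in>B. C b) * norm (\<Sum>b\<in>B. c b *\<^sub>R b)"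
      using C(2) fin b by (intro mult_right_mono member_le_sum) auto
    finally show ?thesis .
  qed
  then show thesis using that[of "\<Sum>b\<in>B. C b"] C(2) by (simp add: sum_nonneg)
qed

lemma summable_on_int_inverse_square: "(\<lambda>m::int. 1 / (1 + \<bar>real_of_int m\<bar>)\<^sup>2) summable_on UNIV"
proof -
  have s: "(\<lambda>n::nat. 1 / (1 + real n)\<^sup>2) summable_on UNIV"
    using inverse_squares_sums by (subst summable_on_UNIV_nonneg_real_iff) (auto simp: sums_iff add.commute)
  have "(\<lambda>m::int. 1 / (1 + \<bar>real_of_int m\<bar>)\<^sup>2) summable_on (range int \<union> range (\<lambda>n. - int n))"
    by (intro summable_on_union) (auto simp: summable_on_reindex inj_on_def o_def s)
  moreover have "range int \<union> range (\<lambda>n. - int n) = UNIV"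
    by (metis (no_types, lifting) UNIV_eq_I UnI1 UnI2 int_cases2 rangeI)
  ultimately show ?thesis by simp
qed

text \<open>
  Each coordinate is bounded by a multiple of the norm, so the sum is dominated by a product of
  convergent series in one integer variable.
\<close>

lemma summable_on_lattice_coset:
  fixes B :: "'a::euclidean_space set"
  assumes "independent B"
  shows "(\<lambda>x. 1 / (1 + norm x) ^ (2 * card B)) summable_on 
    ((+) r ` range (\<lambda>c::'a \<Rightarrow> int. \<Sum>b\<in>B. real_of_int (c b) *\<^sub>R b))"
proof -
  have fin: "finite B" using assms independent_imp_finite by blast
  obtain C where C: "C \<ge> 0" "\<And>c b. b \<in> B \<Longrightarrow> \<bar>c b\<bar> \<le> C * norm (\<Sum>b\<in>B. c b *\<^sub>R b)"
    using independent_coeff_bound[OF assms] by metis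
  let ?v = "\<lambda>c::'a \<Rightarrow> int. r + (\<Sum>b\<in>B. real_of_int (c b) *\<^sub>R b)"
  have im: "(+) r ` range (\<lambda>c::'a \<Rightarrow> int. \<Sum>b\<in>B. real_of_int (c b) *\<^sub>R b) = ?v ` (PiE B (\<lambda>_. UNIV))"
  proof -
    have "?v c \<in> ?v ` (PiE B (\<lambda>_. UNIV))" for c
      by (rule image_eqI[of _ _ "restrict c B"]) auto
    then show ?thesis by auto
  qed
  have inj: "inj_on ?v (PiE B (\<lambda>_. UNIV))"
  proof (rule inj_onI)
    fix c d assume c: "c \<in> PiE B (\<lambda>_. UNIV)" and d: "d \<in> PiE B (\<lambda>_. UNIV)" and eq: "?v c = ?v d"
    then have "(\<Sum>b\<in>B. (real_of_int (c b) - real_of_int (d b)) *\<^sub>R b) = 0"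
      by (simp add: scaleR_diff_left sum_subtractf)
    then have "c b = d b" if "b \<in> B" for b
      using C(2)[OF that, of "\<lambda>b. real_of_int (c b) - real_of_int (d b)"] by simp
    then show "c = d" using PiE_ext[OF c d] by blast
  qed
  define M where "M = 1 + C + C * norm r"
  have M: "M \<ge> 1" using C by (simp add: M_def)
  have "Infinite_Set_Sum.abs_summable_on (\<lambda>m::int. 1 / (1 + \<bar>real_of_int m\<bar>)\<^sup>2) UNIV"
    using summable_on_int_inverse_square by (auto simp flip: abs_summable_equivalent)
  then have "Infinite_Set_Sum.abs_summable_on (\<lambda>c::'a \<Rightarrow> int. \<Prod>b\<in>B. 1 / (1 + \<bar>real_of_int (c b)\<bar>)\<^sup>2) (PiE B (\<lambda>_. UNIV))"
    by (intro abs_summable_on_prod_PiE fin) auto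
  then have "(\<lambda>c::'a \<Rightarrow> int. \<Prod>b\<in>B. 1 / (1 + \<bar>real_of_int (c b)\<bar>)\<^sup>2) summable_on PiE B (\<lambda>_. UNIV)"
    unfolding abs_summable_equivalent[symmetric] by (rule abs_summable_summable)
  then have "(\<lambda>c. M ^ (2 * card B) * (\<Prod>b\<in>B. 1 / (1 + \<bar>real_of_int (c b)\<bar>)\<^sup>2)) summable_on PiE B (\<lambda>_. UNIV)"
    by (rule summable_on_cmult_right)
  then have "(\<lambda>c. 1 / (1 + norm (?v c)) ^ (2 * card B)) summable_on PiE B (\<lambda>_. UNIV)"
  proof (rule summable_on_comparison_test)
    fix c :: "'a \<Rightarrow> int"
    have "1 / (1 + norm (?v c))\<^sup>2 \<le> M\<^sup>2 * (1 / (1 + \<bar>real_of_int (c b)\<bar>)\<^sup>2)" if "b \<in> B" for b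
    proof -
      have n: "norm (\<Sum>b\<in>B. real_of_int (c b) *\<^sub>R b) \<le> norm (?v c) + norm r"
        using norm_triangle_ineq4[of "?v c" r] by simp
      have "\<bar>real_of_int (c b)\<bar> \<le> C * norm (\<Sum>b\<in>B. real_of_int (c b) *\<^sub>R b)"
        by (rule C(2)[OF that])
      also have "\<dots> \<le> C * (norm (?v c) + norm r)" by (intro mult_left_mono n C)
      finally have "1 + \<bar>real_of_int (c b)\<bar> \<le> 1 + C * norm (?v c) + C * norm r" by (simp add: distrib_left)
      also have "\<dots> \<le> M * (1 + norm (?v c))"
      proof -
        have "0 \<le> (1 + C * norm r) * norm (?v c) + C" using C by simp
        then show ?thesis by (simp add: M_def algebra_simps)
      qed
      finally have "(1 + \<bar>real_of_int (c b)\<bar>)\<^sup>2 \<le> (M * (1 + norm (?v c)))\<^sup>2" by (intro power_mono) auto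
      then have le: "(1 + \<bar>real_of_int (c b)\<bar>)\<^sup>2 \<le> M\<^sup>2 * (1 + norm (?v c))\<^sup>2"
        by (simp only: power_mult_distrib)
      have "1 / y \<le> m * (1 / x)" if "x \<le> m * y" "x > 0" "y > 0" for x y m :: real
        using that by (simp add: field_simps)
      from this[OF le] show ?thesis
        by (meson abs_ge_zero add_pos_nonneg norm_ge_zero zero_less_one zero_less_power)
    qed
    then have "(\<Prod>b\<in>B. 1 / (1 + norm (?v c))\<^sup>2) \<le> (\<Prod>b\<in>B. M\<^sup>2 * (1 / (1 + \<bar>real_of_int (c b)\<bar>)\<^sup>2))"
      by (intro prod_mono) auto
    then show "1 / (1 + norm (?v c)) ^ (2 * card B) \<le> M ^ (2 * card B) * (\<Prod>b\<in>B. 1 / (1 + \<bar>real_of_int (c b)\<bar>)\<^sup>2)"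
      unfolding prod.distrib by (simp add: power_mult power_divide)
  qed auto
  then show ?thesis
    unfolding im using inj by (subst summable_on_reindex) (auto simp: o_def)
qed

lemma summable_on_finite_UN:
  fixes F :: "'a \<Rightarrow> real"
  shows "finite I \<Longrightarrow> (\<And>i. i \<in> I \<Longrightarrow> F summable_on A i) \<Longrightarrow> F summable_on (\<Union>i\<in>I. A i)"
  by (induction I rule: finite_induct) (auto intro: summable_on_union)

lemma real_polynomial_function_growth:
  assumes "real_polynomial_function (p :: 'a::euclidean_space \<Rightarrow> real)"
  shows "\<exists>C k. C \<ge> 0 \<and> (\<forall>x. \<bar>p x\<bar> \<le> C * (1 + norm x) ^ k)"
  using assms
proof (induction rule: real_polynomial_function.induct)
  case (linear f)
  then obtain K where K: "K > 0" "\<And>x. norm (f x) \<le> norm x * K"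
    using bounded_linear.pos_bounded by blast
  have "\<bar>f x\<bar> \<le> K * (1 + norm x) ^ 1" for x
  proof -
    have "\<bar>f x\<bar> \<le> norm x * K" using K(2)[of x] by simp
    then show ?thesis using K(1) by (simp add: algebra_simps)
  qed
  then show ?case using \<open>K > 0\<close> by (metis less_imp_le)
next
  case (const c)
  have "\<bar>c\<bar> \<le> \<bar>c\<bar> * (1 + norm (x::'a)) ^ 0" for x by simp
  then show ?case by (metis abs_ge_zero)
next
  case (add f g)
  then obtain C k D l where C: "C \<ge> 0" "\<And>x. \<bar>f x\<bar> \<le> C * (1 + norm x) ^ k" 
    and D: "D \<ge> 0" "\<And>x. \<bar>g x\<bar> \<le> D * (1 + norm x) ^ l" by blast
  have "\<bar>f x + g x\<bar> \<le> (C + D) * (1 + norm x) ^ (k + l)" for x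
  proof -
    have "\<bar>f x + g x\<bar> \<le> \<bar>f x\<bar> + \<bar>g x\<bar>" by simp
    also have "\<dots> \<le> C * (1 + norm x) ^ k + D * (1 + norm x) ^ l" by (intro add_mono C D)
    also have "\<dots> \<le> C * (1 + norm x) ^ (k + l) + D * (1 + norm x) ^ (k + l)"
      using C D by (intro add_mono mult_left_mono power_increasing) auto
    finally show ?thesis by (simp add: distrib_right)
  qed
  then show ?case using C D by (metis add_nonneg_nonneg)
next
  case (mult f g)
  then obtain C k D l where C: "C \<ge> 0" "\<And>x. \<bar>f x\<bar> \<le> C * (1 + norm x) ^ k" 
    and D: "D \<ge> 0" "\<And>x. \<bar>g x\<bar> \<le> D * (1 + norm x) ^ l" by blast
  have "\<bar>f x * g x\<bar> \<le> (C * D) * (1 + norm x) ^ (k + l)" for x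
  proof -
    have "\<bar>f x\<bar> * \<bar>g x\<bar> \<le> (C * (1 + norm x) ^ k) * (D * (1 + norm x) ^ l)"
      using C D by (intro mult_mono) auto
    then show ?thesis by (simp add: abs_mult power_add mult_ac)
  qed
  then show ?case using C D by (metis mult_nonneg_nonneg)
qed

section \<open>Exponential sums over cones as generalized functions\<close>

text \<open>
  A quasi-polynomial is given by finitely many polynomials, one for each coset of a lattice.  This
  yields polynomial growth as well as summability over \<open>\<Lambda>\<close>.
\<close>

lemma quasi_polynomial_on_coset:
  assumes "quasi_polynomial_on \<Lambda> P" 
  obtains B R where "independent (B :: 'a::euclidean_space set)" "finite R" "R \<subseteq> \<Lambda>"
    "\<Lambda> \<subseteq> (\<Union>r\<in>R. (+) r ` range (\<lambda>c::'a \<Rightarrow> int. \<Sum>b\<in>B. real_of_int (c b) *\<^sub>R b))"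
    "\<forall>r\<in>R. \<exists>p. real_polynomial_function p \<and> (\<forall>x\<in>range (\<lambda>c::'a \<Rightarrow> int. \<Sum>b\<in>B. real_of_int (c b) *\<^sub>R b). P (r + x) = p x)"
proof -
  obtain \<Lambda>' where L: "is_lattice \<Lambda>'" "finite ((\<lambda>x. (+) x ` \<Lambda>') ` \<Lambda>)"
     "\<forall>x0\<in>\<Lambda>. \<exists>p. real_polynomial_function p \<and> (\<forall>x\<in>\<Lambda>'. P (x0 + x) = p x)"
    using assms unfolding quasi_polynomial_on_def by blast
  then obtain B :: "'a set" where B: "independent B" "\<Lambda>' = range (\<lambda>c::'a \<Rightarrow> int. \<Sum>b\<in>B. real_of_int (c b) *\<^sub>R b)"
    unfolding is_lattice_def by blast
  obtain R where R: "R \<subseteq> \<Lambda>" "finite R" "(\<lambda>x. (+) x ` \<Lambda>') ` \<Lambda> = (\<lambda>x. (+) x ` \<Lambda>') ` R"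
    using finite_subset_image[OF L(2) subset_refl] by blast
  have 0: "0 \<in> \<Lambda>'" unfolding B(2) by (rule image_eqI[of _ _ "\<lambda>_. 0"]) auto
  have "\<Lambda> \<subseteq> (\<Union>r\<in>R. (+) r ` \<Lambda>')"
  proof
    fix x assume "x \<in> \<Lambda>"
    then have "(+) x ` \<Lambda>' \<in> (\<lambda>x. (+) x ` \<Lambda>') ` R" unfolding R(3)[symmetric] by (rule imageI)
    then obtain r where r: "r \<in> R" "(+) x ` \<Lambda>' = (+) r ` \<Lambda>'" by (elim imageE)
    have "x \<in> (+) x ` \<Lambda>'" using 0 by (rule image_eqI[rotated]) simp
    then show "x \<in> (\<Union>r\<in>R. (+) r ` \<Lambda>')" using r by blast
  qed
  moreover have "\<forall>r\<in>R. \<exists>p. real_polynomial_function p \<and> (\<forall>x\<in>\<Lambda>'. P (r + x) = p x)"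
    using L(3) R(1) by blast
  ultimately show thesis
    unfolding B(2) by (intro that[OF B(1) R(2,1)])
qed

lemma quasi_polynomial_on_growth:
  assumes "quasi_polynomial_on \<Lambda> P" 
  obtains C k where "C \<ge> 0" "\<forall>x :: 'a::euclidean_space\<in>\<Lambda>. \<bar>P x\<bar> \<le> C * (1 + norm x) ^ k"
proof -
  obtain B :: "'a set" and R where B: "independent B" and R: "finite R" "R \<subseteq> \<Lambda>"
    and cov: "\<Lambda> \<subseteq> (\<Union>r\<in>R. (+) r ` range (\<lambda>c::'a \<Rightarrow> int. \<Sum>b\<in>B. real_of_int (c b) *\<^sub>R b))"
    and pol: "\<forall>r\<in>R. \<exists>p. real_polynomial_function p \<and> (\<forall>x\<in>range (\<lambda>c::'a \<Rightarrow> int. \<Sum>b\<in>B. real_of_int (c b) *\<^sub>R b). P (r + x) = p x)"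
    by (rule quasi_polynomial_on_coset[OF assms])
  let ?L = "range (\<lambda>c::'a \<Rightarrow> int. \<Sum>b\<in>B. real_of_int (c b) *\<^sub>R b)"
  have "\<exists>C k. C \<ge> 0 \<and> (\<forall>x\<in>?L. \<bar>P (r + x)\<bar> \<le> C * (1 + norm (r + x)) ^ k)" if r: "r \<in> R" for r
  proof -
    obtain p where p: "real_polynomial_function p" "\<forall>x\<in>?L. P (r + x) = p x" using pol r by blast
    obtain C k where C: "C \<ge> 0" "\<And>x. \<bar>p x\<bar> \<le> C * (1 + norm x) ^ k"
      using real_polynomial_function_growth[OF p(1)] by blast
    have "\<bar>P (r + x)\<bar> \<le> C * (1 + norm r) ^ k * (1 + norm (r + x)) ^ k" if "x \<in> ?L" for x
    proof -
      have "norm x \<le> norm (r + x) + norm r" using norm_triangle_ineq4[of "r + x" r] by simp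
      moreover have "(1 + norm r) * (1 + norm (r + x)) = 1 + norm r + norm (r + x) + norm r * norm (r + x)"
        by (simp add: algebra_simps)
      ultimately have "1 + norm x \<le> (1 + norm r) * (1 + norm (r + x))" 
        using mult_nonneg_nonneg[OF norm_ge_zero[of r] norm_ge_zero[of "r + x"]] by linarith
      then have "(1 + norm x) ^ k \<le> ((1 + norm r) * (1 + norm (r + x))) ^ k" by (intro power_mono) auto
      then have "C * (1 + norm x) ^ k \<le> C * ((1 + norm r) * (1 + norm (r + x))) ^ k"
        using C by (intro mult_left_mono)
      moreover have "P (r + x) = p x" using p(2) that by (rule bspec)
      ultimately show ?thesis using C(2)[of x] by (simp add: power_mult_distrib mult_ac)
    qed
    then show ?thesis using C(1) by (intro exI[of _ "C * (1 + norm r) ^ k"] exI[of _ k]) auto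
  qed
  then have "\<forall>r\<in>R. \<exists>C k. C \<ge> 0 \<and> (\<forall>x\<in>?L. \<bar>P (r + x)\<bar> \<le> C * (1 + norm (r + x)) ^ k)" by (rule ballI)
  from bchoice[OF this] obtain C where
    "\<forall>r\<in>R. \<exists>k. C r \<ge> 0 \<and> (\<forall>x\<in>?L. \<bar>P (r + x)\<bar> \<le> C r * (1 + norm (r + x)) ^ k)" ..
  from bchoice[OF this] obtain k where
    Ck: "\<forall>r\<in>R. C r \<ge> 0 \<and> (\<forall>x\<in>?L. \<bar>P (r + x)\<bar> \<le> C r * (1 + norm (r + x)) ^ k r)" ..
  have C: "C r \<ge> 0" "x \<in> ?L \<Longrightarrow> \<bar>P (r + x)\<bar> \<le> C r * (1 + norm (r + x)) ^ k r" if "r \<in> R" for r x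
    using bspec[OF Ck that] by (auto simp only:)
  have "\<bar>P x\<bar> \<le> (\<Sum>r\<in>R. C r) * (1 + norm x) ^ (\<Sum>r\<in>R. k r)" if "x \<in> \<Lambda>" for x
  proof -
    obtain r v where r: "r \<in> R" "v \<in> ?L" "x = r + v" using cov \<open>x \<in> \<Lambda>\<close> by blast
    have "\<bar>P x\<bar> \<le> C r * (1 + norm x) ^ k r" using C(2)[OF r(1,2)] r(3) by simp
    also have "\<dots> \<le> (\<Sum>r\<in>R. C r) * (1 + norm x) ^ (\<Sum>r\<in>R. k r)"
      using C r R by (intro mult_mono power_increasing member_le_sum sum_nonneg) auto
    finally show ?thesis .
  qed
  then show thesis using that[of "\<Sum>r\<in>R. C r"] C(1) by (auto simp: sum_nonneg)
qed

lemma quasi_polynomial_on_summable: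
  assumes "quasi_polynomial_on \<Lambda> P" 
  obtains K where "(\<lambda>x :: 'a::euclidean_space. 1 / (1 + norm x) ^ K) summable_on \<Lambda>"
proof -
  obtain B :: "'a set" and R where B: "independent B" and R: "finite R" "R \<subseteq> \<Lambda>"
    and cov: "\<Lambda> \<subseteq> (\<Union>r\<in>R. (+) r ` range (\<lambda>c::'a \<Rightarrow> int. \<Sum>b\<in>B. real_of_int (c b) *\<^sub>R b))"
    and pol: "\<forall>r\<in>R. \<exists>p. real_polynomial_function p \<and> (\<forall>x\<in>range (\<lambda>c::'a \<Rightarrow> int. \<Sum>b\<in>B. real_of_int (c b) *\<^sub>R b). P (r + x) = p x)"
    by (rule quasi_polynomial_on_coset[OF assms])
  have "(\<lambda>x. 1 / (1 + norm x) ^ (2 * card B)) summable_on (\<Union>r\<in>R. (+) r ` range (\<lambda>c::'a \<Rightarrow> int. \<Sum>b\<in>B. real_of_int (c b) *\<^sub>R b))"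
    by (intro summable_on_finite_UN R(1) summable_on_lattice_coset B)
  then show thesis using that summable_on_subset_banach[OF _ cov] by blast
qed

text \<open>Rapid decay of Fourier transforms beats the polynomial growth of the coefficients.\<close>

lemma summable_fourier_pairing:
  fixes \<phi> :: "'a::euclidean_space \<Rightarrow> complex"
  assumes "quasi_polynomial_on \<Lambda> P" "test_function \<phi>"
  shows "(\<lambda>x. of_real (P x) * fourier \<phi> x) summable_on \<Lambda>"
proof -
  obtain C k where C: "C \<ge> 0" "\<forall>x\<in>\<Lambda>. \<bar>P x\<bar> \<le> C * (1 + norm x) ^ k"
    by (rule quasi_polynomial_on_growth[OF assms(1)])
  obtain K where K: "(\<lambda>x :: 'a. 1 / (1 + norm x) ^ K) summable_on \<Lambda>"
    by (rule quasi_polynomial_on_summable[OF assms(1)])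
  obtain A where A: "\<forall>x. norm (fourier \<phi> x) * (1 + norm x) ^ (k + K) \<le> A"
    by (rule fourier_decay[OF assms(2)])
  have "(\<lambda>x. C * A * (1 / (1 + norm x) ^ K)) summable_on \<Lambda>"
    using K by (rule summable_on_cmult_right)
  then have "(\<lambda>x. norm (of_real (P x) * fourier \<phi> x)) summable_on \<Lambda>"
  proof (rule summable_on_comparison_test)
    fix x assume x: "x \<in> \<Lambda>"
    have pos: "0 < (1 + norm x) ^ K" by (intro zero_less_power add_pos_nonneg) auto
    have "norm (of_real (P x) * fourier \<phi> x) * (1 + norm x) ^ K = \<bar>P x\<bar> * (norm (fourier \<phi> x) * (1 + norm x) ^ K)"
      by (simp add: norm_mult)
    also have "\<dots> \<le> (C * (1 + norm x) ^ k) * (norm (fourier \<phi> x) * (1 + norm x) ^ K)"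
      using C(2) x by (intro mult_right_mono) auto
    also have "\<dots> = C * (norm (fourier \<phi> x) * (1 + norm x) ^ (k + K))" by (simp add: power_add mult_ac)
    also have "\<dots> \<le> C * A" using A C(1) by (intro mult_left_mono) auto
    finally show "norm (of_real (P x) * fourier \<phi> x) \<le> C * A * (1 / (1 + norm x) ^ K)"
      using pos by (simp add: field_simps)
  qed auto
  then show ?thesis by (rule abs_summable_summable)
qed

lemma has_sum_diff_complex:
  fixes F G :: "'a \<Rightarrow> complex"
  assumes "(F has_sum a) A" "(G has_sum b) A"
  shows "((\<lambda>x. F x - G x) has_sum (a - b)) A"
  using has_sum_add[OF assms(1) has_sum_cmult_right[OF assms(2), of "- 1"]] by simp

lemma fourier_shift: "fourier \<phi> (x + g) = fourier (\<lambda>\<theta>. \<phi> \<theta> * exp (\<i> * of_real (\<theta> \<bullet> g))) x"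
  unfolding fourier_def imag_functional_apply
  by (simp add: inner_add_right distrib_left exp_add mult_ac)

lemma fourier_diff:
  assumes "test_function \<phi>" "test_function \<psi>"
  shows "fourier (\<lambda>\<theta>. \<phi> \<theta> - \<psi> \<theta>) x = fourier \<phi> x - fourier \<psi> x"
  unfolding fourier_def imag_functional_apply
  using test_function_integrable[OF test_function_exp[OF assms(1)]] test_function_integrable[OF test_function_exp[OF assms(2)]]
  by (simp add: left_diff_distrib)

text \<open>
  Off the poles a test function \<open>\<phi>\<close> is \<open>1 - exp\<close> times another test function,
  and the factor \<open>1 - exp\<close> turns the coefficients \<open>h\<close> into their backward differences.  When
  repeated differencing leaves finitely many coefficients the sum is elementary.
\<close>

lemma exp_sum_by_parts:
  fixes h :: "'a::euclidean_space \<Rightarrow> real"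
  assumes "test_function \<phi>" "\<And>g \<theta>. g \<in># D \<Longrightarrow> \<theta> \<in> support \<phi> \<Longrightarrow> exp (\<i> * of_real (\<theta> \<bullet> g)) \<noteq> 1"
    and "\<And>\<psi>. test_function \<psi> \<Longrightarrow> (\<lambda>x. of_real (h x) * fourier \<psi> x) summable_on UNIV"
    and "fsupp (mixed_diff D h)"
  shows "((\<lambda>x. of_real (h x) * fourier \<phi> x) has_sum
    (\<integral>\<theta>. \<phi> \<theta> * (expsum (mixed_diff D h) (imag_functional \<theta>) / den D (imag_functional \<theta>)) \<partial>lborel)) UNIV"
  using assms
proof (induction D arbitrary: \<phi> h)
  case (empty \<phi> h)
  let ?S = "{x. h x \<noteq> 0}"
  have S: "finite ?S" using empty by (simp add: fsupp_def)
  have "(\<integral>\<theta>. \<phi> \<theta> * (expsum h (imag_functional \<theta>) / den {#} (imag_functional \<theta>)) \<partial>lborel)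
     = (\<integral>\<theta>. (\<Sum>x\<in>?S. of_real (h x) * (\<phi> \<theta> * exp (\<i> * of_real (\<theta> \<bullet> x)))) \<partial>lborel)"
    by (simp add: expsum_def den_def imag_functional_apply sum_distrib_left mult_ac)
  also have "\<dots> = (\<Sum>x\<in>?S. of_real (h x) * fourier \<phi> x)"
    unfolding fourier_def imag_functional_apply
    using test_function_integrable[OF test_function_exp[OF empty(1)]]
    by (subst Bochner_Integration.integral_sum) auto
  finally show ?case
    by (intro has_sum_finite_neutralI[OF S]) auto
next
  case (add g D \<phi> h)
  let ?d = "\<lambda>\<theta>. 1 - exp (\<i> * complex_of_real (\<theta> \<bullet> g))"
  define \<psi> where "\<psi> = (\<lambda>\<theta>. \<phi> \<theta> / ?d \<theta> ^ 1)"
  have "C_k k \<psi>" for k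
    unfolding \<psi>_def using add.prems(2)[of g] 
    by (intro C_k_divide_power test_function_C_k[OF add.prems(1)]) auto
  moreover have supp: "support \<psi> \<subseteq> support \<phi>"
    by (rule support_subset) (simp add: \<psi>_def outside_support)
  ultimately have \<psi>: "test_function \<psi>" using test_function_subset[OF add.prems(1)] by blast
  have \<psi>e: "test_function (\<lambda>\<theta>. \<psi> \<theta> * exp (\<i> * of_real (\<theta> \<bullet> g)))" by (rule test_function_exp[OF \<psi>])
  have eq: "\<phi> \<theta> = \<psi> \<theta> - \<psi> \<theta> * exp (\<i> * of_real (\<theta> \<bullet> g))" for \<theta>
  proof (cases "\<theta> \<in> support \<phi>")
    case True
    then have "?d \<theta> \<noteq> 0" using add.prems(2)[of g \<theta>] by auto
    then have "\<phi> \<theta> = \<psi> \<theta> * ?d \<theta>" by (simp add: \<psi>_def)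
    then show ?thesis by (simp add: algebra_simps)
  qed (simp add: \<psi>_def outside_support)
  then have "\<phi> = (\<lambda>\<theta>. \<psi> \<theta> - \<psi> \<theta> * exp (\<i> * of_real (\<theta> \<bullet> g)))" by blast
  then have f\<phi>: "fourier \<phi> x = fourier \<psi> x - fourier \<psi> (x + g)" for x
    using fourier_diff[OF \<psi> \<psi>e, of x] fourier_shift[of \<psi> x g] by metis
  have shift: "((\<lambda>x. of_real (h (x - g)) * fourier \<omega> x) has_sum infsum (\<lambda>x. of_real (h x) * fourier \<omega> (x + g)) UNIV) UNIV"
    if "test_function \<omega>" for \<omega>
  proof -
    have "(\<lambda>x. of_real (h x) * fourier \<omega> (x + g)) summable_on UNIV"
      unfolding fourier_shift by (rule add.prems(3)[OF test_function_exp[OF that]])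
    from has_sum_infsum[OF this]
    show ?thesis
      by (subst has_sum_reindex_bij_witness[of UNIV "\<lambda>x. x + g" "\<lambda>x. x - g" UNIV "\<lambda>x. of_real (h x) * fourier \<omega> (x + g)"]) auto
  qed
  have summ: "(\<lambda>x. of_real (backward_diff g h x) * fourier \<omega> x) summable_on UNIV" if "test_function \<omega>" for \<omega>
    using has_sum_imp_summable[OF has_sum_diff_complex[OF has_sum_infsum[OF add.prems(3)[OF that]] shift[OF that]]]
    by (simp add: backward_diff_def left_diff_distrib)
  have md: "mixed_diff (add_mset g D) h = mixed_diff D (backward_diff g h)"
    using mixed_diff_union[of "{#g#}" D h] by (simp add: mixed_diff_add_mset)
  have IH: "((\<lambda>x. of_real (backward_diff g h x) * fourier \<psi> x) has_sum
    (\<integral>\<theta>. \<psi> \<theta> * (expsum (mixed_diff D (backward_diff g h)) (imag_functional \<theta>) / den D (imag_functional \<theta>)) \<partial>lborel)) UNIV"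
    using add.prems supp by (intro add.IH \<psi> summ) (auto simp: md)
  have int: "\<psi> \<theta> * (N / den D (imag_functional \<theta>)) = \<phi> \<theta> * (N / den (add_mset g D) (imag_functional \<theta>))" for \<theta> N
  proof (cases "\<theta> \<in> support \<phi>")
    case True
    then have "?d \<theta> \<noteq> 0" using add.prems(2)[of g \<theta>] by auto
    then show ?thesis by (simp add: \<psi>_def den_def imag_functional_apply)
  qed (simp add: \<psi>_def outside_support)
  have 1: "((\<lambda>x. of_real (h x) * fourier \<psi> x) has_sum infsum (\<lambda>x. of_real (h x) * fourier \<psi> x) UNIV) UNIV"
    by (rule has_sum_infsum[OF add.prems(3)[OF \<psi>]])
  have 2: "((\<lambda>x. of_real (h x) * fourier \<psi> (x + g)) has_sum infsum (\<lambda>x. of_real (h x) * fourier \<psi> (x + g)) UNIV) UNIV"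
    unfolding fourier_shift by (rule has_sum_infsum[OF add.prems(3)[OF \<psi>e]])
  have 3: "((\<lambda>x. of_real (backward_diff g h x) * fourier \<psi> x) has_sum
      infsum (\<lambda>x. of_real (h x) * fourier \<psi> x) UNIV - infsum (\<lambda>x. of_real (h x) * fourier \<psi> (x + g)) UNIV) UNIV"
    using has_sum_diff_complex[OF 1 shift[OF \<psi>]] by (simp add: backward_diff_def left_diff_distrib)
  have "((\<lambda>x. of_real (h x) * fourier \<phi> x) has_sum
      infsum (\<lambda>x. of_real (h x) * fourier \<psi> x) UNIV - infsum (\<lambda>x. of_real (h x) * fourier \<psi> (x + g)) UNIV) UNIV"
    using has_sum_diff_complex[OF 1 2] by (simp add: f\<phi> right_diff_distrib)
  then show ?case
    using has_sum_unique[OF 3 IH] by (simp only: int md)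
qed

text \<open>
  The criterion used for the vertex cones and for the transverse cone: if differencing the
  coefficients along some generators leaves a finitely supported function, then the sum is the
  corresponding quotient of exponential polynomials.
\<close>

lemma exp_sum_representsI:
  fixes \<Lambda> :: "'a::euclidean_space set"
  assumes "quasi_polynomial_on \<Lambda> P" "finite C" "C \<subseteq> \<Lambda> - {0}" "q = (+) s ` (convex_cone hull C)"
    and "set_mset D \<subseteq> C" "fsupp (mixed_diff D (\<lambda>x. if x \<in> \<Lambda> \<inter> q then P x else 0))"
  shows "exp_sum_represents \<Lambda> q P (\<lambda>\<xi>. expsum (mixed_diff D (\<lambda>x. if x \<in> \<Lambda> \<inter> q then P x else 0)) \<xi> / den D \<xi>)"
proof -
  define h where "h = (\<lambda>x. if x \<in> \<Lambda> \<inter> q then P x else 0)"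
  define M where "M = (\<lambda>\<xi>. expsum (mixed_diff D h) \<xi> / den D \<xi>)"
  define H where "H = (\<Union>g\<in>C. pole_hyperplanes g)"
  have offH: "\<xi> \<notin> H \<longleftrightarrow> (\<forall>g\<in>C. exp (blinfun_apply \<xi> g) \<noteq> 1)" for \<xi>
    by (auto simp: H_def pole_hyperplanes_eq)
  have den: "den D \<xi> \<noteq> 0" if "\<xi> \<notin> H" for \<xi>
    using that assms(5) by (auto simp: offH den_eq_0_iff)
  have "local_quotient M UNIV (expsum (mixed_diff D h)) (den D)"
    using assms(2,3) den
    by (intro local_quotient_off_poles[of C]) (auto simp: offH M_def holomorphic_dual_expsum holomorphic_dual_den)
  then have mero: "meromorphic_dual M"
    unfolding meromorphic_dual_def by blast
  have holo: "holomorphic_dual (- H) M"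
    unfolding M_def using den
    by (intro holomorphic_dual_divide holomorphic_dual_expsum holomorphic_dual_den) auto
  have summable0: "(\<lambda>x. of_real (P x) * fourier \<phi> x) summable_on (\<Lambda> \<inter> q)" if "test_function \<phi>" for \<phi>
    by (rule summable_on_subset_banach[OF summable_fourier_pairing[OF assms(1) that]]) auto
  have ext: "((\<lambda>x. of_real (h x) * fourier \<phi> x) has_sum S) UNIV \<longleftrightarrow> ((\<lambda>x. of_real (P x) * fourier \<phi> x) has_sum S) (\<Lambda> \<inter> q)" for \<phi> S
    by (rule has_sum_cong_neutral) (auto simp: h_def)
  have summable: "(\<lambda>x. of_real (h x) * fourier \<phi> x) summable_on UNIV" if "test_function \<phi>" for \<phi>
    using summable0[OF that] ext unfolding summable_on_def by blast
  have sums: "((\<lambda>x. of_real (P x) * fourier \<phi> x) has_sum (\<integral>\<theta>. \<phi> \<theta> * M (imag_functional \<theta>) \<partial>lborel)) (\<Lambda> \<inter> q)"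
    if "test_function \<phi>" "\<forall>\<theta>\<in>support \<phi>. imag_functional \<theta> \<notin> H" for \<phi>
    unfolding ext[symmetric] M_def
    using that assms(5,6)
    by (intro exp_sum_by_parts summable) (auto simp: offH imag_functional_apply h_def)
  have "exp_sum_represents \<Lambda> q P M"
    unfolding exp_sum_represents_def Let_def fourier_def[symmetric]
    apply (intro exI[of _ s] exI[of _ C] conjI assms(2,3,4) mero)
    unfolding H_def[symmetric]
      apply (rule holo)
     apply (intro allI impI summable0, assumption)
    apply (intro allI impI, elim conjE, rule sums, assumption+)
    done
  then show ?thesis unfolding M_def h_def .
qed

section \<open>Uniqueness of the meromorphic function\<close>

text \<open>
  The derivative of \<open>flat_exp m\<close> is a combination of \<open>flat_exp (m + 1)\<close> and \<open>flat_exp (m + 2)\<close>, so the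
  whole family is smooth, also at \<open>0\<close>.  Composed with \<open>r\<^sup>2 - norm (\<theta> - c)\<^sup>2\<close> it gives bump functions.
\<close>

definition flat_exp :: "nat \<Rightarrow> real \<Rightarrow> real" where
  "flat_exp m t = (if t > 0 then exp (- 1 / t) / t ^ m else 0)"

lemma flat_exp_bound: "\<bar>flat_exp m t\<bar> \<le> real (Suc m) ^ Suc m * \<bar>t\<bar>"
proof (cases "t > 0")
  case True
  \<comment> \<open>\<open>exp (1 / t)\<close> exceeds every power of \<open>1 / t\<close>, by \<open>(1 + x / n) ^ n \<le> exp x\<close>.\<close>
  have "(1 / t / real (Suc m)) ^ Suc m \<le> (1 + 1 / t / real (Suc m)) ^ Suc m"
    using True by (intro power_mono) auto
  also have "\<dots> \<le> exp (1 / t)"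
    using True by (intro exp_ge_one_plus_x_over_n_power_n) (auto intro: order_trans[of _ 0])
  finally have "1 / (t ^ Suc m * real (Suc m) ^ Suc m) \<le> exp (1 / t)"
    unfolding divide_divide_eq_left power_divide power_mult_distrib by (simp only: power_one)
  then have "1 \<le> exp (1 / t) * (t ^ Suc m * real (Suc m) ^ Suc m)"
    using True by (subst (asm) pos_divide_le_eq) auto
  then have "exp (- (1 / t)) * 1 \<le> exp (- (1 / t)) * (exp (1 / t) * (t ^ Suc m * real (Suc m) ^ Suc m))"
    by (intro mult_left_mono) auto
  also have "\<dots> = t ^ Suc m * real (Suc m) ^ Suc m"
    unfolding mult.assoc[symmetric] exp_minus by simp
  finally have "exp (- (1 / t)) \<le> t ^ m * (t * real (Suc m) ^ Suc m)" by (simp add: mult_ac)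
  then have "exp (- (1 / t)) / t ^ m \<le> t * real (Suc m) ^ Suc m"
    using True by (simp add: pos_divide_le_eq mult_ac)
  then show ?thesis using True by (simp add: flat_exp_def mult_ac)
qed (simp add: flat_exp_def mult_nonneg_nonpos del: power_Suc of_nat_Suc)

lemma flat_exp_derivative:
  "(flat_exp m has_real_derivative flat_exp (m + 2) t - real m * flat_exp (m + 1) t) (at t)"
proof -
  consider "t > 0" | "t < 0" | "t = 0" by linarith
  then show ?thesis
  proof cases
    case 1
    have "((\<lambda>t. exp (- 1 / t) * inverse (t ^ m)) has_real_derivative
       exp (- 1 / t) * (1 / t\<^sup>2) * inverse (t ^ m) + exp (- 1 / t) * (- (real m * t ^ (m - 1)) * inverse ((t ^ m)\<^sup>2))) (at t)"
      using 1 by (auto intro!: derivative_eq_intros simp: power2_eq_square field_simps)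
    moreover have "exp (- 1 / t) * (1 / t\<^sup>2) * inverse (t ^ m) + exp (- 1 / t) * (- (real m * t ^ (m - 1)) * inverse ((t ^ m)\<^sup>2)) 
        = flat_exp (m + 2) t - real m * flat_exp (m + 1) t"
      using 1 by (cases m) (auto simp: flat_exp_def field_simps power2_eq_square)
    ultimately have "((\<lambda>t. exp (- 1 / t) * inverse (t ^ m)) has_real_derivative flat_exp (m + 2) t - real m * flat_exp (m + 1) t) (at t)"
      by simp
    moreover have "\<forall>\<^sub>F s in nhds t. exp (- 1 / s) * inverse (s ^ m) = flat_exp m s"
      using eventually_nhds_in_open[of "{0<..}" t] 1 by (auto simp: flat_exp_def divide_inverse elim!: eventually_mono)
    ultimately show ?thesis by (subst (asm) DERIV_cong_ev[OF refl _ refl]) auto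
  next
    case 2
    have "\<forall>\<^sub>F s in nhds t. 0 = flat_exp m s"
      using eventually_nhds_in_open[of "{..<0}" t] 2 by (auto simp: flat_exp_def elim!: eventually_mono)
    moreover have "((\<lambda>_. 0) has_real_derivative flat_exp (m + 2) t - real m * flat_exp (m + 1) t) (at t)"
      using 2 by (simp add: flat_exp_def)
    ultimately show ?thesis by (subst (asm) DERIV_cong_ev[OF refl _ refl]) auto
  next
    case 3
    have "((\<lambda>h. real (Suc (Suc m)) ^ Suc (Suc m) * \<bar>h\<bar>) \<longlongrightarrow> real (Suc (Suc m)) ^ Suc (Suc m) * \<bar>0\<bar>) (at (0::real))"
      by (intro tendsto_intros)
    then have "((\<lambda>h. flat_exp m h / h) \<longlongrightarrow> 0) (at 0)"
    proof (rule Lim_null_comparison[rotated, OF tendsto_eq_rhs])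
      show "\<forall>\<^sub>F h in at 0. norm (flat_exp m h / h) \<le> real (Suc (Suc m)) ^ Suc (Suc m) * \<bar>h\<bar>"
      proof (rule always_eventually, rule allI)
        fix h :: real
        have "flat_exp m h / h = flat_exp (Suc m) h" by (simp add: flat_exp_def)
        then show "norm (flat_exp m h / h) \<le> real (Suc (Suc m)) ^ Suc (Suc m) * \<bar>h\<bar>"
          using flat_exp_bound[of "Suc m" h] by simp
      qed
    qed simp
    then show ?thesis unfolding 3 DERIV_def by (simp add: flat_exp_def)
  qed
qed

lemma C_k_flat_exp:
  "C_k k (\<lambda>\<theta>::'a::euclidean_space. complex_of_real (flat_exp m (r - (\<theta> - c) \<bullet> (\<theta> - c))))"
proof (induction k arbitrary: m)
  case (0 m)
  have "isCont (flat_exp m) t" for t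
    using flat_exp_derivative by (rule DERIV_isCont)
  then have "continuous_on UNIV (flat_exp m)" by (simp add: continuous_on_eq_continuous_at)
  then show ?case
    by (auto intro!: continuous_intros continuous_on_compose2[of UNIV "flat_exp m"])
next
  case (Suc k m)
  let ?\<rho> = "\<lambda>\<theta>. r - (\<theta> - c) \<bullet> (\<theta> - c)"
  let ?D = "\<lambda>\<theta> h. (complex_of_real (flat_exp (m + 2) (?\<rho> \<theta>)) + (- of_nat m) * of_real (flat_exp (m + 1) (?\<rho> \<theta>))) * of_real ((- 2 *\<^sub>R h) \<bullet> \<theta> + 2 * (h \<bullet> c))"
  have "((\<lambda>\<theta>. complex_of_real (flat_exp m (?\<rho> \<theta>))) has_derivative ?D \<theta>) (at \<theta>)" for \<theta>
  proof -
    have 1: "(?\<rho> has_derivative (\<lambda>h. (- 2 *\<^sub>R h) \<bullet> \<theta> + 2 * (h \<bullet> c))) (at \<theta>)"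
      by (auto intro!: derivative_eq_intros simp: inner_diff_left inner_diff_right inner_commute algebra_simps)
    have "(flat_exp m has_derivative (*) (flat_exp (m + 2) (?\<rho> \<theta>) - real m * flat_exp (m + 1) (?\<rho> \<theta>))) (at (?\<rho> \<theta>))"
      using flat_exp_derivative unfolding has_field_derivative_def .
    from bounded_linear.has_derivative[OF bounded_linear_of_real has_derivative_compose[OF 1 this]]
    have "((\<lambda>\<theta>. complex_of_real (flat_exp m (?\<rho> \<theta>))) has_derivative 
      (\<lambda>h. complex_of_real ((flat_exp (m + 2) (?\<rho> \<theta>) - real m * flat_exp (m + 1) (?\<rho> \<theta>)) * ((- 2 *\<^sub>R h) \<bullet> \<theta> + 2 * (h \<bullet> c))))) (at \<theta>)" .
    then show ?thesis by simp
  qed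
  moreover have "C_k k (\<lambda>\<theta>. ?D \<theta> h)" for h
    by (intro C_k_mult C_k_add C_k_const Suc C_k_affine)
  ultimately show ?case by (rule C_k_SucI)
qed

lemma bump_function:
  fixes c :: "'a::euclidean_space"
  assumes "r > 0"
  obtains \<beta> :: "'a \<Rightarrow> real" where "test_function (\<lambda>\<theta>. of_real (\<beta> \<theta>))" "support (\<lambda>\<theta>. of_real (\<beta> \<theta>)) \<subseteq> cball c r"
    "\<forall>\<theta>. \<beta> \<theta> \<ge> 0" "(\<integral>\<theta>. \<beta> \<theta> \<partial>lborel) > 0"
proof -
  define \<beta> where "\<beta> = (\<lambda>\<theta>. flat_exp 0 (r\<^sup>2 - (\<theta> - c) \<bullet> (\<theta> - c)))"
  have supp: "support (\<lambda>\<theta>. complex_of_real (\<beta> \<theta>)) \<subseteq> cball c r"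
    unfolding support_def
  proof (rule closure_minimal)
    show "{\<theta>. complex_of_real (\<beta> \<theta>) \<noteq> 0} \<subseteq> cball c r"
    proof
      fix \<theta> assume "\<theta> \<in> {\<theta>. complex_of_real (\<beta> \<theta>) \<noteq> 0}"
      then have "(norm (\<theta> - c))\<^sup>2 < r\<^sup>2" by (auto simp: \<beta>_def flat_exp_def power2_norm_eq_inner split: if_splits)
      then have "norm (\<theta> - c) < r" using assms by (simp add: power2_less_imp_less)
      then show "\<theta> \<in> cball c r" by (simp add: dist_norm norm_minus_commute)
    qed
  qed simp
  then have "compact (support (\<lambda>\<theta>. complex_of_real (\<beta> \<theta>)))"
    by (metis compact_cball closed_closure compact_Int_closed inf.absorb_iff2 support_def)
  then have test: "test_function (\<lambda>\<theta>. complex_of_real (\<beta> \<theta>))"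
    unfolding test_function_def by (simp add: \<beta>_def C_k_flat_exp)
  have nonneg: "\<beta> \<theta> \<ge> 0" for \<theta> by (simp add: \<beta>_def flat_exp_def)
  have int: "integrable lborel \<beta>"
    using integrable_Re[OF test_function_integrable[OF test]] by simp
  define e where "e = exp (- 1 / (3 / 4 * r\<^sup>2))"
  have "0 < e * measure lborel (ball c (r/2))" using assms by (simp add: e_def content_ball_pos)
  also have "\<dots> = (\<integral>\<theta>. e * indicator (ball c (r/2)) \<theta> \<partial>lborel)" by simp
  also have "\<dots> \<le> (\<integral>\<theta>. \<beta> \<theta> \<partial>lborel)"
  proof (rule integral_mono[OF _ int])
    show "integrable lborel (\<lambda>\<theta>. e * indicator (ball c (r/2)) \<theta> :: real)"
      by (intro integrable_mult_right integrable_real_indicator) (use emeasure_bounded_finite[OF bounded_ball, of c "r/2"] in auto)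
    show "e * indicator (ball c (r/2)) \<theta> \<le> \<beta> \<theta>" for \<theta>
    proof (cases "\<theta> \<in> ball c (r/2)")
      case True
      then have "(norm (\<theta> - c))\<^sup>2 \<le> (r/2)\<^sup>2" by (intro power_mono) (auto simp: dist_norm norm_minus_commute)
      then have t: "3 / 4 * r\<^sup>2 \<le> r\<^sup>2 - (\<theta> - c) \<bullet> (\<theta> - c)" by (simp add: power2_norm_eq_inner power_divide)
      have "0 < 3 / 4 * r\<^sup>2" using assms by simp
      then have pos: "0 < r\<^sup>2 - (\<theta> - c) \<bullet> (\<theta> - c)" using t by (rule less_le_trans)
      have "1 / (r\<^sup>2 - (\<theta> - c) \<bullet> (\<theta> - c)) \<le> 1 / (3 / 4 * r\<^sup>2)"
        using t \<open>0 < 3 / 4 * r\<^sup>2\<close> by (intro divide_left_mono mult_pos_pos pos) auto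
      then have "e \<le> exp (- 1 / (r\<^sup>2 - (\<theta> - c) \<bullet> (\<theta> - c)))"
        unfolding e_def by (simp only: exp_le_cancel_iff minus_divide_left[symmetric] neg_le_iff_le)
      note this pos
      then show ?thesis using True by (simp add: \<beta>_def flat_exp_def)
    qed (simp add: nonneg)
  qed
  finally have "(\<integral>\<theta>. \<beta> \<theta> \<partial>lborel) > 0" .
  moreover have "\<forall>\<theta>. \<beta> \<theta> \<ge> 0" using nonneg by blast
  ultimately show thesis using that[OF test supp] by blast
qed

lemma bounded_linear_imag_functional: "bounded_linear imag_functional"
proof (rule bounded_linear_intro[where K = 1])
  show "norm (imag_functional \<theta>) \<le> norm \<theta> * 1" for \<theta> :: 'a
    by (rule norm_blinfun_bound) (auto simp: imag_functional_apply norm_mult Cauchy_Schwarz_ineq2)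
qed (auto intro!: blinfun_eqI simp: imag_functional_apply blinfun.add_left blinfun.scaleR_left inner_add_left algebra_simps scaleR_conv_of_real)

lemma holomorphic_dual_cont: "holomorphic_dual U M \<Longrightarrow> \<xi> \<in> U \<Longrightarrow> isCont M \<xi>"
  unfolding holomorphic_dual_def by (meson has_derivative_continuous)

text \<open>
  A bump function concentrated near a point where \<open>F\<close> and \<open>G\<close> differ would have different integrals
  against them.
\<close>

lemma exp_sum_unique_imag:
  fixes \<theta>0 :: "'a::euclidean_space"
  assumes "open U" "\<theta>0 \<in> U"
    and F: "continuous_on U F" and G: "continuous_on U G"
    and eq: "\<And>\<phi>. test_function \<phi> \<Longrightarrow> support \<phi> \<subseteq> U \<Longrightarrow> (\<integral>\<theta>. \<phi> \<theta> * F \<theta> \<partial>lborel) = (\<integral>\<theta>. \<phi> \<theta> * G \<theta> \<partial>lborel)"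
  shows "F \<theta>0 = (G \<theta>0 :: complex)"
proof (rule ccontr)
  assume "F \<theta>0 \<noteq> G \<theta>0"
  define w where "w = F \<theta>0 - G \<theta>0"
  have w: "norm w > 0" using \<open>F \<theta>0 \<noteq> G \<theta>0\<close> by (simp add: w_def)
  have "continuous_on U (\<lambda>\<theta>. F \<theta> - G \<theta>)" by (intro continuous_intros F G)
  then have "isCont (\<lambda>\<theta>. F \<theta> - G \<theta>) \<theta>0" using assms(1,2) by (simp add: continuous_on_eq_continuous_at)
  then obtain d where d: "d > 0" "\<And>\<theta>. dist \<theta> \<theta>0 < d \<Longrightarrow> dist (F \<theta> - G \<theta>) w < norm w / 2"
    unfolding continuous_at_eps_delta w_def using w half_gt_zero w_def by blast
  obtain e where e: "e > 0" "cball \<theta>0 e \<subseteq> U" using open_contains_cball assms by blast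
  define r where "r = min e (d / 2)"
  have r: "r > 0" "r < d" "cball \<theta>0 r \<subseteq> U" using d e by (auto simp: r_def)
  obtain \<beta> where \<beta>: "test_function (\<lambda>\<theta>. complex_of_real (\<beta> \<theta>))" "support (\<lambda>\<theta>. complex_of_real (\<beta> \<theta>)) \<subseteq> cball \<theta>0 r"
    "\<forall>\<theta>. \<beta> \<theta> \<ge> 0" "(\<integral>\<theta>. \<beta> \<theta> \<partial>lborel) > 0"
    by (rule bump_function[OF r(1)])
  let ?S = "support (\<lambda>\<theta>. complex_of_real (\<beta> \<theta>))"
  have bz: "\<beta> \<theta> = 0" if "\<theta> \<notin> ?S" for \<theta> using outside_support[OF that] by simp
  have suppU: "?S \<subseteq> U" using \<beta>(2) r(3) by blast
  have compS: "compact ?S" using \<beta>(1) by (simp add: test_function_def)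
  have prod_int: "integrable lborel (\<lambda>\<theta>. complex_of_real (\<beta> \<theta>) * K \<theta>)" if "continuous_on U K" for K
  proof -
    have "continuous_on ?S (\<lambda>\<theta>. complex_of_real (\<beta> \<theta>) * K \<theta>)"
      using continuous_on_subset[OF test_function_cont[OF \<beta>(1)]] continuous_on_subset[OF that suppU]
      by (intro continuous_intros) auto
    moreover have "complex_of_real (\<beta> \<theta>) * K \<theta> = 0" if "\<theta> \<notin> ?S" for \<theta> using bz[OF that] by simp
    ultimately show ?thesis by (rule continuous_compact_support_integrable[OF compS])
  qed
  have "0 = (\<integral>\<theta>. \<beta> \<theta> * F \<theta> \<partial>lborel) - (\<integral>\<theta>. \<beta> \<theta> * G \<theta> \<partial>lborel)"
    using eq[OF \<beta>(1) suppU] by simp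
  also have "\<dots> = (\<integral>\<theta>. \<beta> \<theta> * F \<theta> - \<beta> \<theta> * G \<theta> \<partial>lborel)"
    using prod_int[OF F] prod_int[OF G] by simp
  also have "\<dots> = (\<integral>\<theta>. \<beta> \<theta> * w + \<beta> \<theta> * (F \<theta> - G \<theta> - w) \<partial>lborel)"
    by (simp add: algebra_simps)
  also have "\<dots> = (\<integral>\<theta>. \<beta> \<theta> * w \<partial>lborel) + (\<integral>\<theta>. \<beta> \<theta> * (F \<theta> - G \<theta> - w) \<partial>lborel)"
    by (intro Bochner_Integration.integral_add prod_int continuous_intros F G)
  finally have z: "(\<integral>\<theta>. \<beta> \<theta> * w \<partial>lborel) = - (\<integral>\<theta>. \<beta> \<theta> * (F \<theta> - G \<theta> - w) \<partial>lborel)"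
    by (simp add: eq_neg_iff_add_eq_0)
  have intb: "integrable lborel \<beta>" using integrable_Re[OF test_function_integrable[OF \<beta>(1)]] by simp
  have "norm (\<integral>\<theta>. \<beta> \<theta> * w \<partial>lborel) \<le> (\<integral>\<theta>. norm (\<beta> \<theta> * (F \<theta> - G \<theta> - w)) \<partial>lborel)"
    unfolding z norm_minus_cancel by (rule integral_norm_bound)
  also have "\<dots> \<le> (\<integral>\<theta>. \<beta> \<theta> * (norm w / 2) \<partial>lborel)"
  proof (rule integral_mono)
    show "integrable lborel (\<lambda>\<theta>. norm (complex_of_real (\<beta> \<theta>) * (F \<theta> - G \<theta> - w)))"
      by (intro integrable_norm prod_int continuous_intros F G)
    show "integrable lborel (\<lambda>\<theta>. \<beta> \<theta> * (norm w / 2))" using intb by (rule integrable_mult_left)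
    show "norm (complex_of_real (\<beta> \<theta>) * (F \<theta> - G \<theta> - w)) \<le> \<beta> \<theta> * (norm w / 2)" for \<theta>
    proof (cases "\<theta> \<in> ?S")
      case True
      then have "dist \<theta> \<theta>0 < d" using \<beta>(2) r(2) by (force simp: dist_commute)
      then have "norm (F \<theta> - G \<theta> - w) \<le> norm w / 2" using d(2) by (force simp: dist_norm)
      then have "\<beta> \<theta> * norm (F \<theta> - G \<theta> - w) \<le> \<beta> \<theta> * (norm w / 2)" using \<beta>(3) by (intro mult_left_mono) auto
      moreover have "norm (complex_of_real (\<beta> \<theta>)) = \<beta> \<theta>" using \<beta>(3) by simp
      ultimately show ?thesis by (simp only: norm_mult)
    qed (simp add: bz)
  qed
  also have "\<dots> = (\<integral>\<theta>. \<beta> \<theta> \<partial>lborel) * (norm w / 2)" by simp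
  finally have "norm (\<integral>\<theta>. \<beta> \<theta> * w \<partial>lborel) \<le> (\<integral>\<theta>. \<beta> \<theta> \<partial>lborel) * (norm w / 2)" .
  moreover have "norm (\<integral>\<theta>. \<beta> \<theta> * w \<partial>lborel) = (\<integral>\<theta>. \<beta> \<theta> \<partial>lborel) * norm w"
    using \<beta>(4) by (simp add: norm_mult)
  ultimately show False using \<beta>(4) w by simp
qed

lemma functional_decomposition:
  fixes \<xi> :: "'a::euclidean_space \<Rightarrow>\<^sub>L complex"
  obtains a b where "\<xi> = real_functional a + imag_functional b"
proof -
  let ?a = "\<Sum>e\<in>Basis. Re (blinfun_apply \<xi> e) *\<^sub>R e" and ?b = "\<Sum>e\<in>Basis. Im (blinfun_apply \<xi> e) *\<^sub>R e"
  have "blinfun_apply \<xi> x = of_real (?a \<bullet> x) + \<i> * of_real (?b \<bullet> x)" for x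
  proof -
    have "blinfun_apply \<xi> x = blinfun_apply \<xi> (\<Sum>e\<in>Basis. (x \<bullet> e) *\<^sub>R e)" by (simp add: euclidean_representation)
    also have "\<dots> = (\<Sum>e\<in>Basis. of_real (x \<bullet> e) * blinfun_apply \<xi> e)"
      by (simp add: blinfun.sum_right blinfun.scaleR_right scaleR_conv_of_real)
    also have "\<dots> = (\<Sum>e\<in>Basis. of_real (x \<bullet> e) * (of_real (Re (blinfun_apply \<xi> e)) + \<i> * of_real (Im (blinfun_apply \<xi> e))))"
      using complex_eq by metis
    also have "\<dots> = of_real (?a \<bullet> x) + \<i> * of_real (?b \<bullet> x)"
      by (simp add: inner_sum_left inner_sum_right inner_commute[of _ x] sum_distrib_left distrib_left sum.distrib mult_ac)
    finally show ?thesis .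
  qed
  note eq = this
  have "\<xi> = real_functional ?a + imag_functional ?b"
    by (rule blinfun_eqI, unfold blinfun.add_left real_functional.rep_eq imag_functional.rep_eq) (rule eq)
  then show thesis by (rule that)
qed

text \<open>
  The pairings determine the function on the imaginary dual.  A complex functional \<open>\<xi>\<close> with real part
  \<open>a\<close> and imaginary part \<open>b\<close> lies on the complex line \<open>z \<mapsto> z a + \<i> b\<close>, which contains imaginary
  functionals for \<open>z \<in> \<i>\<real>\<close> and meets the poles in a countable set.  So the one-variable identity
  theorem suffices.
\<close>

lemma exp_sum_represents_unique:
  fixes \<Lambda> :: "'a::euclidean_space set"
  assumes "exp_sum_represents \<Lambda> q P M1" "exp_sum_represents \<Lambda> q P M2"
  obtains C where "finite C" "0 \<notin> C" "\<forall>\<xi>. (\<forall>g\<in>C. exp (blinfun_apply \<xi> g) \<noteq> 1) \<longrightarrow> M1 \<xi> = M2 \<xi>"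
proof -
  have rep: "\<exists>C. finite C \<and> 0 \<notin> C \<and> holomorphic_dual {\<xi>. \<forall>g\<in>C. exp (blinfun_apply \<xi> g) \<noteq> 1} M \<and>
      (\<forall>\<phi>. test_function \<phi> \<and> (\<forall>\<theta>\<in>support \<phi>. \<forall>g\<in>C. exp (blinfun_apply (imag_functional \<theta>) g) \<noteq> 1) \<longrightarrow>
         ((\<lambda>x. of_real (P x) * fourier \<phi> x) has_sum (\<integral>\<theta>. \<phi> \<theta> * M (imag_functional \<theta>) \<partial>lborel)) (\<Lambda> \<inter> q))"
    if "exp_sum_represents \<Lambda> q P M" for M
  proof -
    have off: "- (\<Union>g\<in>C. pole_hyperplanes g) = {\<xi>. \<forall>g\<in>C. exp (blinfun_apply \<xi> g) \<noteq> 1}"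
      "\<xi> \<notin> (\<Union>g\<in>C. pole_hyperplanes g) \<longleftrightarrow> (\<forall>g\<in>C. exp (blinfun_apply \<xi> g) \<noteq> 1)" 
      for C and \<xi> :: "'a \<Rightarrow>\<^sub>L complex"
      by (auto simp: pole_hyperplanes_eq)
    show ?thesis
      using that unfolding exp_sum_represents_def Let_def off fourier_def by blast
  qed
  obtain C1 where C1: "finite C1" "0 \<notin> C1" "holomorphic_dual {\<xi>. \<forall>g\<in>C1. exp (blinfun_apply \<xi> g) \<noteq> 1} M1"
    "\<And>\<phi>. test_function \<phi> \<Longrightarrow> \<forall>\<theta>\<in>support \<phi>. \<forall>g\<in>C1. exp (blinfun_apply (imag_functional \<theta>) g) \<noteq> 1 \<Longrightarrow>
         ((\<lambda>x. of_real (P x) * fourier \<phi> x) has_sum (\<integral>\<theta>. \<phi> \<theta> * M1 (imag_functional \<theta>) \<partial>lborel)) (\<Lambda> \<inter> q)"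
    using rep[OF assms(1)] by auto
  obtain C2 where C2: "finite C2" "0 \<notin> C2" "holomorphic_dual {\<xi>. \<forall>g\<in>C2. exp (blinfun_apply \<xi> g) \<noteq> 1} M2"
    "\<And>\<phi>. test_function \<phi> \<Longrightarrow> \<forall>\<theta>\<in>support \<phi>. \<forall>g\<in>C2. exp (blinfun_apply (imag_functional \<theta>) g) \<noteq> 1 \<Longrightarrow>
         ((\<lambda>x. of_real (P x) * fourier \<phi> x) has_sum (\<integral>\<theta>. \<phi> \<theta> * M2 (imag_functional \<theta>) \<partial>lborel)) (\<Lambda> \<inter> q)"
    using rep[OF assms(2)] by auto
  define C where "C = C1 \<union> C2"
  define O' where "O' = {\<xi> :: 'a \<Rightarrow>\<^sub>L complex. \<forall>g\<in>C. exp (blinfun_apply \<xi> g) \<noteq> 1}"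
  have C: "finite C" "0 \<notin> C" using C1 C2 by (auto simp: C_def)
  have hol: "holomorphic_dual O' M1" "holomorphic_dual O' M2"
    using holomorphic_dual_mono[OF C1(3), of O'] holomorphic_dual_mono[OF C2(3), of O'] by (auto simp: O'_def C_def)
  have openO: "open O'" unfolding O'_def by (rule open_off_poles[OF C(1)])
  have imag_cont: "continuous_on S imag_functional" for S :: "'a set"
    using bounded_linear_imag_functional by (rule linear_continuous_on)
  have imag: "M1 (imag_functional \<theta>) = M2 (imag_functional \<theta>)" if "imag_functional \<theta> \<in> O'" for \<theta>
  proof (rule exp_sum_unique_imag[where U = "imag_functional -` O'"])
    show "open (imag_functional -` O')" by (rule open_vimage[OF openO imag_cont])
    have c: "continuous_on O' M1" "continuous_on O' M2"
      using hol holomorphic_dual_cont openO by (auto simp: continuous_on_eq_continuous_at)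
    show "continuous_on (imag_functional -` O') (\<lambda>\<theta>. M1 (imag_functional \<theta>))"
         "continuous_on (imag_functional -` O') (\<lambda>\<theta>. M2 (imag_functional \<theta>))"
      using continuous_on_compose2[OF c(1) imag_cont] continuous_on_compose2[OF c(2) imag_cont] by auto
    fix \<phi> :: "'a \<Rightarrow> complex" assume \<phi>: "test_function \<phi>" "support \<phi> \<subseteq> imag_functional -` O'"
    show "(\<integral>\<theta>. \<phi> \<theta> * M1 (imag_functional \<theta>) \<partial>lborel) = (\<integral>\<theta>. \<phi> \<theta> * M2 (imag_functional \<theta>) \<partial>lborel)"
      using \<phi> by (intro has_sum_unique[OF C1(4)[OF \<phi>(1)] C2(4)[OF \<phi>(1)]]) (auto simp: O'_def C_def)
  qed (use that in auto)
  have "M1 \<xi> = M2 \<xi>" if \<xi>: "\<forall>g\<in>C. exp (blinfun_apply \<xi> g) \<noteq> 1" for \<xi>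
  proof -
    obtain a b where ab: "\<xi> = real_functional a + imag_functional b" by (rule functional_decomposition)
    define A where "A = real_functional a"
    define \<gamma> where "\<gamma> z = (blinfun_mult_right z o\<^sub>L A) + imag_functional b" for z
    have \<gamma>_apply: "blinfun_apply (\<gamma> z) g = z * of_real (a \<bullet> g) + \<i> * of_real (b \<bullet> g)" for z g
      by (simp add: \<gamma>_def A_def blinfun.add_left real_functional.rep_eq imag_functional.rep_eq)
    have \<gamma>1: "\<gamma> 1 = \<xi>" 
      by (rule blinfun_eqI) (simp add: \<gamma>_apply ab blinfun.add_left real_functional.rep_eq imag_functional.rep_eq)
    have \<gamma>i: "\<gamma> (\<i> * of_real t) = imag_functional (t *\<^sub>R a + b)" for t
      by (rule blinfun_eqI) (simp add: \<gamma>_apply imag_functional.rep_eq inner_add_left algebra_simps)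
    define S where "S = {z. \<gamma> z \<in> O'}"
    have Sc: "- S = (\<Union>g\<in>C. {z. exp (z * of_real (a \<bullet> g) + \<i> * of_real (b \<bullet> g)) = 1})"
      by (auto simp: S_def O'_def \<gamma>_apply)
    have "countable {z. exp (z * of_real (a \<bullet> g) + \<i> * of_real (b \<bullet> g)) = 1}" if g: "g \<in> C" for g
    proof (cases "a \<bullet> g = 0")
      case True
      then have "exp (\<i> * of_real (b \<bullet> g)) \<noteq> 1" using \<xi> g \<gamma>_apply[of 1 g] unfolding \<gamma>1 by auto
      then show ?thesis using True by simp
    next
      case False
      have "{z. exp (z * of_real (a \<bullet> g) + \<i> * of_real (b \<bullet> g)) = 1} \<subseteq> range (\<lambda>n::int. (of_int (2 * n) * of_real pi * \<i> - \<i> * of_real (b \<bullet> g)) / of_real (a \<bullet> g))"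
      proof
        fix z assume "z \<in> {z. exp (z * of_real (a \<bullet> g) + \<i> * of_real (b \<bullet> g)) = 1}"
        then obtain n :: int where "z * of_real (a \<bullet> g) + \<i> * of_real (b \<bullet> g) = of_int (2 * n) * of_real pi * \<i>"
          by (auto simp add: exp_eq_1 simp: complex_eq_iff[of "_ + _"])
        then have "z = (of_int (2 * n) * of_real pi * \<i> - \<i> * of_real (b \<bullet> g)) / of_real (a \<bullet> g)"
          using False by (simp add: field_simps)
        then show "z \<in> range (\<lambda>n::int. (of_int (2 * n) * of_real pi * \<i> - \<i> * of_real (b \<bullet> g)) / of_real (a \<bullet> g))" by blast
      qed
      then show ?thesis by (rule countable_subset) auto
    qed
    then have count: "countable (- S)" unfolding Sc using C(1) by (intro countable_UN) (auto intro: countable_finite)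
    have \<gamma>_der: "(\<gamma> has_derivative (\<lambda>w. blinfun_mult_right w o\<^sub>L A)) (at z)" for z
    proof -
      have "bounded_linear (\<lambda>w. blinfun_mult_right w o\<^sub>L A)"
        by (rule bounded_linear_compose[OF bounded_bilinear.bounded_linear_left[OF bounded_bilinear_blinfun_compose] bounded_linear_blinfun_mult_right])
      from has_derivative_add[OF bounded_linear_imp_has_derivative[OF this] has_derivative_const]
      show ?thesis unfolding \<gamma>_def[abs_def] by simp
    qed
    have "continuous_on UNIV \<gamma>"
      using has_derivative_continuous[OF \<gamma>_der] by (simp add: continuous_on_eq_continuous_at)
    then have openS: "open S" unfolding S_def using openO by (metis open_vimage vimage_def)
    have "connected (- (- S))" using count by (intro path_connected_imp_connected path_connected_complement_countable) auto
    then have connS: "connected S" by simp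
    have field: "(\<lambda>z. M (\<gamma> z)) holomorphic_on S" if M: "holomorphic_dual O' M" for M
      unfolding holomorphic_on_def
    proof
      fix z assume "z \<in> S"
      then obtain D where D: "(M has_derivative D) (at (\<gamma> z))" "\<forall>h. D (blinfun_mult_right \<i> o\<^sub>L h) = \<i> * D h"
        using M unfolding holomorphic_dual_def S_def by blast
      have lin: "linear D" using D(1) by (rule has_derivative_linear)
      have "D (blinfun_mult_right w o\<^sub>L A) = D A * w" for w
      proof -
        have "blinfun_mult_right w o\<^sub>L A = Re w *\<^sub>R A + Im w *\<^sub>R (blinfun_mult_right \<i> o\<^sub>L A)"
          by (rule blinfun_eqI) (simp add: blinfun.add_left blinfun.scaleR_left complex_eq_iff)
        then have "D (blinfun_mult_right w o\<^sub>L A) = Re w *\<^sub>R D A + Im w *\<^sub>R (\<i> * D A)"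
          by (simp add: linear_add[OF lin] linear_cmul[OF lin] D(2))
        then show ?thesis by (simp add: complex_eq_iff algebra_simps)
      qed
      then have "((\<lambda>z. M (\<gamma> z)) has_derivative (*) (D A)) (at z)"
        using has_derivative_compose[OF \<gamma>_der D(1)] by (simp add: fun_eq_iff)
      then have "((\<lambda>z. M (\<gamma> z)) has_field_derivative D A) (at z)" unfolding has_field_derivative_def .
      then show "(\<lambda>z. M (\<gamma> z)) field_differentiable at z within S"
        using field_differentiable_def field_differentiable_at_within by blast
    qed
    have "uncountable (UNIV :: real set)" by (simp add: uncountable_UNIV_real)
    moreover have "countable {t::real. \<i> * of_real t \<in> - S}"
      by (rule countable_image_inj_on[of "\<lambda>t. \<i> * of_real t"], rule countable_subset[OF _ count]) (auto simp: inj_on_def)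
    ultimately obtain t0 :: real where t0: "\<i> * of_real t0 \<in> S"
      by (metis (mono_tags, lifting) ComplI UNIV_eq_I mem_Collect_eq)
    define U where "U = {z\<in>S. Re z = 0}"
    have "\<i> * of_real t0 islimpt U"
      unfolding islimpt_approachable
    proof (intro allI impI)
      fix e :: real assume e: "e > 0"
      obtain d where d: "d > 0" "ball (\<i> * of_real t0) d \<subseteq> S" using openS t0 open_contains_ball by blast
      define m where "m = min d e / 2"
      have m: "0 < m" "m < d" "m < e" using d e by (auto simp: m_def min_def)
      let ?z = "\<i> * complex_of_real (t0 + m)"
      have dist: "dist ?z (\<i> * of_real t0) = m"
        using m by (simp add: dist_norm norm_mult flip: right_diff_distrib of_real_diff)
      then have "?z \<in> ball (\<i> * of_real t0) d" using m by (simp only: mem_ball dist_commute)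
      then have "?z \<in> U" using d(2) by (auto simp: U_def)
      then show "\<exists>x'\<in>U. x' \<noteq> \<i> * of_real t0 \<and> dist x' (\<i> * of_real t0) < e"
        using dist m by (intro bexI[of _ ?z]) auto
    qed
    moreover have "M1 (\<gamma> z) - M2 (\<gamma> z) = 0" if "z \<in> U" for z
    proof -
      have z: "z = \<i> * of_real (Im z)" using that by (simp add: U_def complex_eq_iff)
      have "imag_functional (Im z *\<^sub>R a + b) \<in> O'" using that \<gamma>i[of "Im z"] z by (auto simp: U_def S_def)
      from imag[OF this] show ?thesis using \<gamma>i[of "Im z"] z by simp
    qed
    moreover have "1 \<in> S" using \<xi> \<gamma>1 by (auto simp: S_def O'_def)
    ultimately have "M1 (\<gamma> 1) - M2 (\<gamma> 1) = 0"
      using field[OF hol(1)] field[OF hol(2)] openS connS t0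
      by (intro analytic_continuation[of "\<lambda>z. M1 (\<gamma> z) - M2 (\<gamma> z)" S U "\<i> * of_real t0" 1] holomorphic_on_diff)
         (auto simp: U_def)
    then show ?thesis by (simp add: \<gamma>1)
  qed
  then show thesis using that[OF C] by blast
qed

section \<open>Simple polytopes near a face\<close>

lemma open_segment_face_eq:
  fixes a :: "'a::euclidean_space"
  assumes "s \<in> open_segment x y" "a \<bullet> x \<le> c" "a \<bullet> y \<le> c" "a \<bullet> s = c"
  shows "a \<bullet> x = c \<and> a \<bullet> y = c"
proof -
  obtain u where u: "0 < u" "u < 1" "s = (1 - u) *\<^sub>R x + u *\<^sub>R y"
    using assms(1) by (auto simp: in_segment)
  have sum0: "(1 - u) * (c - a \<bullet> x) + u * (c - a \<bullet> y) = 0"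
    using assms(4) u(3) by (simp add: inner_add_right algebra_simps)
  moreover have "0 \<le> (1 - u) * (c - a \<bullet> x)" "0 \<le> u * (c - a \<bullet> y)" using u assms by auto
  ultimately have "(1 - u) * (c - a \<bullet> x) = 0" "u * (c - a \<bullet> y) = 0" by linarith+
  then show ?thesis using u by auto
qed

lemma small_step:
  fixes c d :: "'i \<Rightarrow> real"
  assumes "finite J" "\<And>i. i \<in> J \<Longrightarrow> 0 < c i"
  obtains \<delta> where "\<delta> > 0" "\<forall>i\<in>J. \<delta> * \<bar>d i\<bar> < c i"
proof -
  have "\<exists>\<delta>>0. \<forall>i\<in>J. \<delta> * \<bar>d i\<bar> < c i"
    using assms
  proof (induction J rule: finite_induct)
    case empty
    show ?case by (intro exI[of _ 1]) simp
  next
    case (insert i J)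
    then obtain \<delta> where \<delta>: "\<delta> > 0" "\<forall>i\<in>J. \<delta> * \<bar>d i\<bar> < c i" by auto
    define \<delta>' where "\<delta>' = min \<delta> (c i / (\<bar>d i\<bar> + 1))"
    have ci: "c i > 0" using insert by auto
    have "\<delta>' > 0" using \<delta> ci by (simp add: \<delta>'_def add_nonneg_pos)
    have "\<delta>' * \<bar>d j\<bar> \<le> \<delta> * \<bar>d j\<bar>" for j by (intro mult_right_mono) (auto simp: \<delta>'_def)
    then have "\<forall>j\<in>J. \<delta>' * \<bar>d j\<bar> < c j" using \<delta>(2) by (meson le_less_trans)
    moreover have "\<delta>' * \<bar>d i\<bar> < c i"
    proof -
      have "\<delta>' * \<bar>d i\<bar> < \<delta>' * (\<bar>d i\<bar> + 1)" using \<open>\<delta>' > 0\<close> by (intro mult_strict_left_mono) auto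
      also have "\<dots> \<le> (c i / (\<bar>d i\<bar> + 1)) * (\<bar>d i\<bar> + 1)" by (intro mult_right_mono) (auto simp: \<delta>'_def)
      also have "\<dots> = c i" by simp
      finally show ?thesis .
    qed
    ultimately show ?case using \<open>\<delta>' > 0\<close> by auto
  qed
  then show thesis using that by blast
qed

text \<open>
  The indices in \<open>I\<close> stand for the facets of \<open>p\<close>, so that the last assumption, which counts the active
  inequalities at a vertex, says that \<open>p\<close> is simple.
\<close>

locale simple_polytope_face =
  fixes p f :: "'a::euclidean_space set" and I :: "'i set" and a :: "'i \<Rightarrow> 'a" and b :: "'i \<Rightarrow> real"
  assumes finite_I: "finite I"
    and p_eq: "p = {x. \<forall>i\<in>I. a i \<bullet> x \<le> b i}"
    and polytope_p: "polytope p"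
    and face: "f face_of p" and nonempty: "f \<noteq> {}"
    and f_eq: "f = {x\<in>p. \<forall>i\<in>I. (\<forall>z\<in>f. a i \<bullet> z = b i) \<longrightarrow> a i \<bullet> x = b i}"
    and simple: "s \<in> vertices p \<Longrightarrow> card {i\<in>I. a i \<bullet> s = b i} = DIM('a)"
begin

definition T :: "'i set" where "T = {i\<in>I. \<forall>z\<in>f. a i \<bullet> z = b i}"

definition act :: "'a \<Rightarrow> 'i set" where "act s = {i\<in>I. a i \<bullet> s = b i}"

lemma T_subset: "T \<subseteq> I" and finite_T [simp]: "finite T" and act_subset: "act s \<subseteq> I" and finite_act [simp]: "finite (act s)"
  using finite_I by (auto simp: T_def act_def)

lemma f_iff: "x \<in> f \<longleftrightarrow> x \<in> p \<and> (\<forall>i\<in>T. a i \<bullet> x = b i)"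
  using f_eq by (auto simp: T_def)

lemma p_iff: "x \<in> p \<longleftrightarrow> (\<forall>i\<in>I. a i \<bullet> x \<le> b i)"
  using p_eq by blast

lemma convex_p: "convex p" and compact_p: "compact p"
  using polytope_p polytope_imp_convex polytope_imp_compact by auto

lemma face_E: "{x\<in>p. \<forall>i\<in>K. a i \<bullet> x = b i} face_of p" if "K \<subseteq> I"
  unfolding face_of_def
proof (intro conjI ballI impI)
  have "{x\<in>p. \<forall>i\<in>K. a i \<bullet> x = b i} = p \<inter> (\<Inter>i\<in>K. {x. a i \<bullet> x = b i})" by auto
  then show "convex {x\<in>p. \<forall>i\<in>K. a i \<bullet> x = b i}"
    by (simp add: convex_Int convex_INT convex_hyperplane convex_p)
next
  fix x y s assume x: "x \<in> p" and y: "y \<in> p" and s: "s \<in> {x\<in>p. \<forall>i\<in>K. a i \<bullet> x = b i}" "s \<in> open_segment x y"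
  have "a i \<bullet> x = b i \<and> a i \<bullet> y = b i" if "i \<in> K" for i
    using s x y that \<open>K \<subseteq> I\<close> by (intro open_segment_face_eq[OF s(2)]) (auto simp: p_iff)
  then show "x \<in> {x\<in>p. \<forall>i\<in>K. a i \<bullet> x = b i}" "y \<in> {x\<in>p. \<forall>i\<in>K. a i \<bullet> x = b i}" using x y by auto
qed auto

lemma compact_face: "E face_of p \<Longrightarrow> compact E" and convex_face: "E face_of p \<Longrightarrow> convex E"
  using face_of_imp_compact[OF convex_p compact_p] face_of_imp_convex convex_p by blast+

lemma face_vertex: "E face_of p \<Longrightarrow> s extreme_point_of E \<Longrightarrow> s \<in> vertices p \<and> s \<in> E"
  using extreme_point_of_face by (auto simp: vertices_def)

lemma vertices_f: "s \<in> vertices f \<longleftrightarrow> s \<in> vertices p \<and> s \<in> f"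
  using extreme_point_of_face[OF face] by (auto simp: vertices_def)

lemma finite_vertices [simp]: "finite (vertices f)"
  unfolding vertices_def 
  by (rule finite_polyhedron_extreme_points[OF polytope_imp_polyhedron[OF face_of_polytope_polytope[OF polytope_p face]]])

lemma vertices_in_p: "s \<in> vertices p \<Longrightarrow> s \<in> p"
  by (simp add: vertices_def extreme_point_of_def)

lemma T_act: "s \<in> vertices f \<Longrightarrow> T \<subseteq> act s"
  by (auto simp: vertices_f act_def T_def)

lemma small_step_in_p:
  assumes "x \<in> p" "\<And>i. i \<in> act x \<Longrightarrow> a i \<bullet> v \<le> 0"
  obtains t where "t > 0" "x + t *\<^sub>R v \<in> p"
proof -
  obtain \<delta> where \<delta>: "\<delta> > 0" "\<forall>i\<in>I - act x. \<delta> * \<bar>a i \<bullet> v\<bar> < b i - a i \<bullet> x"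
    using assms(1) finite_I by (rule_tac small_step[of "I - act x" "\<lambda>i. b i - a i \<bullet> x" "\<lambda>i. a i \<bullet> v"]) (auto simp: act_def p_iff less_le)
  have "a i \<bullet> (x + \<delta> *\<^sub>R v) \<le> b i" if "i \<in> I" for i
  proof (cases "i \<in> act x")
    case True
    then show ?thesis using assms(2)[OF True] \<delta>(1) by (simp add: act_def inner_add_right mult_nonneg_nonpos)
  next
    case False
    have "\<delta> * (a i \<bullet> v) \<le> \<delta> * \<bar>a i \<bullet> v\<bar>" using \<delta>(1) by (intro mult_left_mono) auto
    also have "\<dots> < b i - a i \<bullet> x" using \<delta>(2) False that by blast
    finally show ?thesis by (simp add: inner_add_right)
  qed
  then show thesis using \<delta>(1) that by (auto simp: p_iff)
qed

text \<open>
  A vector orthogonal to all active normals could be followed in both directions inside \<open>p\<close>, against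
  extremality of \<open>s\<close>.
\<close>

lemma act_separating:
  assumes s: "s \<in> vertices p" and v: "\<And>i. i \<in> act s \<Longrightarrow> a i \<bullet> v = 0"
  shows "v = 0"
proof (rule ccontr)
  assume "v \<noteq> 0"
  obtain t1 where t1: "t1 > 0" "s + t1 *\<^sub>R v \<in> p"
    using small_step_in_p[OF vertices_in_p[OF s], of v] v by auto
  obtain t2 where t2: "t2 > 0" "s + t2 *\<^sub>R (- v) \<in> p"
    using small_step_in_p[OF vertices_in_p[OF s], of "- v"] v by auto
  have "s \<in> open_segment (s + t1 *\<^sub>R v) (s + t2 *\<^sub>R (- v))"
    unfolding in_segment
  proof (intro conjI exI[of _ "t1 / (t1 + t2)"])
    show "s + t1 *\<^sub>R v \<noteq> s + t2 *\<^sub>R - v"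
    proof
      assume "s + t1 *\<^sub>R v = s + t2 *\<^sub>R - v"
      then have "(t1 + t2) *\<^sub>R v = 0" by (simp add: scaleR_add_left eq_neg_iff_add_eq_0)
      then show False using t1 t2 \<open>v \<noteq> 0\<close> by simp
    qed
    have "(1 - u) *\<^sub>R (s + t1 *\<^sub>R v) + u *\<^sub>R (s + t2 *\<^sub>R - v) = s + ((1 - u) * t1 - u * t2) *\<^sub>R v" for u
      by (simp add: algebra_simps)
    moreover have "(1 - t1 / (t1 + t2)) * t1 - t1 / (t1 + t2) * t2 = 0" using t1 t2 by (simp add: field_simps)
    ultimately show "s = (1 - t1 / (t1 + t2)) *\<^sub>R (s + t1 *\<^sub>R v) + (t1 / (t1 + t2)) *\<^sub>R (s + t2 *\<^sub>R - v)"
      by simp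
  qed (use t1 t2 in auto)
  then show False using s t1 t2 unfolding vertices_def extreme_point_of_def by blast
qed

text \<open>
  At a vertex \<open>s\<close> the active normals form a basis; minus the dual basis consists of the edge
  directions of the tangent cone.
\<close>

definition e :: "'a \<Rightarrow> 'i \<Rightarrow> 'a" where
  "e s i = (SOME w. \<forall>j\<in>act s. a j \<bullet> w = (if j = i then - 1 else 0))"

lemma e_dual:
  assumes s: "s \<in> vertices p" and i: "i \<in> act s" and j: "j \<in> act s"
  shows "a j \<bullet> e s i = (if j = i then - 1 else 0)"
proof -
  let ?A = "a ` act s"
  have span: "span ?A = UNIV"
  proof (rule ccontr)
    assume "span ?A \<noteq> UNIV"
    then obtain v where "v \<noteq> 0" "\<forall>x\<in>span ?A. v \<bullet> x = 0" using span_not_UNIV_orthogonal by blast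
    then show False using act_separating[OF s, of v] by (auto simp: inner_commute span_base)
  qed
  have cardI: "card (act s) = DIM('a)" using simple[OF s] by (simp add: act_def)
  have le: "DIM('a) \<le> card ?A" using dim_le_card[of UNIV ?A] span by simp
  have eq: "card ?A = card (act s)" using card_image_le[OF finite_act, of a s] le cardI by simp
  have inj: "inj_on a (act s)" using eq_card_imp_inj_on[OF finite_act eq] .
  have "independent ?A" using card_le_dim_spanning[of ?A UNIV] span eq cardI by auto
  then obtain g where g: "linear g" "\<forall>x\<in>?A. g x = (if x = a i then - 1 else 0 :: real)"
    using linear_independent_extend[of ?A "\<lambda>x. if x = a i then - 1 else 0"] by blast
  have "\<forall>j\<in>act s. a j \<bullet> adjoint g 1 = (if j = i then - 1 else 0)"
    using g(2) inj i by (auto simp: adjoint_works[OF g(1)] inj_on_eq_iff)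
  then have "\<forall>j\<in>act s. a j \<bullet> e s i = (if j = i then - 1 else 0)"
    unfolding e_def by (rule someI)
  then show ?thesis using j by blast
qed

lemma e_nonzero: "s \<in> vertices p \<Longrightarrow> i \<in> act s \<Longrightarrow> e s i \<noteq> 0"
  using e_dual[of s i i] by auto

lemma expansion:
  assumes s: "s \<in> vertices p"
  shows "v = (\<Sum>i\<in>act s. (- (a i \<bullet> v)) *\<^sub>R e s i)"
proof -
  have "v - (\<Sum>i\<in>act s. (- (a i \<bullet> v)) *\<^sub>R e s i) = 0"
  proof (rule act_separating[OF s])
    fix j assume j: "j \<in> act s"
    have "a j \<bullet> (\<Sum>i\<in>act s. (- (a i \<bullet> v)) *\<^sub>R e s i) = (\<Sum>i\<in>act s. if j = i then a j \<bullet> v else 0)"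
      unfolding inner_sum_right using e_dual[OF s _ j] by (intro sum.cong) auto
    also have "\<dots> = a j \<bullet> v" using j by simp
    finally show "a j \<bullet> (v - (\<Sum>i\<in>act s. (- (a i \<bullet> v)) *\<^sub>R e s i)) = 0" by (simp only: inner_diff_right)
  qed
  then show ?thesis by simp
qed

lemma vertex_expansion:
  assumes s: "s \<in> vertices p"
  shows "x = s + (\<Sum>i\<in>act s. (b i - a i \<bullet> x) *\<^sub>R e s i)"
proof -
  have "x - s = (\<Sum>i\<in>act s. (b i - a i \<bullet> x) *\<^sub>R e s i)"
    by (subst expansion[OF s]) (auto intro!: sum.cong simp: act_def inner_diff_right)
  then show ?thesis by (simp add: algebra_simps)
qed

lemma edge_point:
  assumes s: "s \<in> vertices p" and i: "i \<in> act s"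
  obtains t where "t > 0" "s + t *\<^sub>R e s i \<in> p" "\<And>j. j \<in> act s \<Longrightarrow> j \<noteq> i \<Longrightarrow> a j \<bullet> (s + t *\<^sub>R e s i) = b j"
proof -
  have "a j \<bullet> e s i \<le> 0" if "j \<in> act s" for j
    using e_dual[OF s i that] by simp
  from small_step_in_p[OF vertices_in_p[OF s] this]
  obtain t where "t > 0" "s + t *\<^sub>R e s i \<in> p" by blast
  moreover have "a j \<bullet> (s + t *\<^sub>R e s i) = b j" if "j \<in> act s" "j \<noteq> i" for j
    using e_dual[OF s i that(1)] that by (simp add: inner_add_right act_def)
  ultimately show thesis using that by blast
qed

text \<open>
  The edge of \<open>p\<close> in direction \<open>e s i\<close> has a second vertex.  For a rational polytope this makes the
  edge direction rational.
\<close>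

lemma neighbour_vertex:
  assumes s: "s \<in> vertices p" and i: "i \<in> act s"
  obtains s' t where "s' \<in> vertices p" "t > 0" "s' - s = t *\<^sub>R e s i"
proof -
  let ?E = "{x\<in>p. \<forall>j\<in>act s - {i}. a j \<bullet> x = b j}"
  have E: "?E face_of p" using act_subset by (intro face_E) auto
  obtain t where t: "t > 0" "s + t *\<^sub>R e s i \<in> p" "\<And>j. j \<in> act s \<Longrightarrow> j \<noteq> i \<Longrightarrow> a j \<bullet> (s + t *\<^sub>R e s i) = b j"
    using edge_point[OF s i] by blast
  then have tE: "s + t *\<^sub>R e s i \<in> ?E" by auto
  have "\<exists>s'. s' extreme_point_of ?E \<and> s' \<noteq> s"
  proof (rule ccontr)
    assume "\<not> ?thesis"
    then have "{x. x extreme_point_of ?E} \<subseteq> {s}" by auto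
    then have "convex hull {x. x extreme_point_of ?E} \<subseteq> {s}" using hull_mono[of _ "{s}" convex] by simp
    then have "?E \<subseteq> {s}" using Krein_Milman_Minkowski[OF compact_face[OF E] convex_face[OF E]] by simp
    then have "t *\<^sub>R e s i = 0" using tE by auto
    then show False using t(1) e_nonzero[OF s i] by simp
  qed
  then obtain s' where s': "s' extreme_point_of ?E" "s' \<noteq> s" by blast
  then have v: "s' \<in> vertices p" "s' \<in> ?E" using face_vertex[OF E s'(1)] by (simp_all only: simp_thms)
  have "s' = s + (\<Sum>j\<in>act s. (b j - a j \<bullet> s') *\<^sub>R e s j)" by (rule vertex_expansion[OF s])
  also have "(\<Sum>j\<in>act s. (b j - a j \<bullet> s') *\<^sub>R e s j) = (\<Sum>j\<in>{i}. (b j - a j \<bullet> s') *\<^sub>R e s j)"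
    using v(2) i by (intro sum.mono_neutral_right) auto
  finally have "s' = s + (b i - a i \<bullet> s') *\<^sub>R e s i" by simp
  then have d: "s' - s = (b i - a i \<bullet> s') *\<^sub>R e s i" by (metis add_diff_cancel_left')
  have "a i \<bullet> s' \<le> b i" using v i by (auto simp: p_iff act_def)
  moreover have "a i \<bullet> s' \<noteq> b i" using d s'(2) by auto
  ultimately show thesis using that[OF v(1) _ d] by simp
qed

definition subface :: "'i set \<Rightarrow> 'a set" where
  "subface K = {x\<in>f. \<forall>i\<in>K. a i \<bullet> x = b i}"

definition generic :: "'a \<Rightarrow> bool" where
  "generic \<beta> \<longleftrightarrow> (\<forall>s\<in>vertices f. \<forall>i\<in>act s - T. \<beta> \<bullet> e s i \<noteq> 0)"

text \<open>
  For generic \<open>\<beta>\<close> this says that \<open>s\<close> is the vertex at which \<open>\<beta>\<close> is minimal on \<open>subface K\<close>: the edges in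
  question are those that stay in \<open>subface K\<close>.
\<close>

definition min_vertex :: "'a \<Rightarrow> 'i set \<Rightarrow> 'a \<Rightarrow> bool" where
  "min_vertex \<beta> K s \<longleftrightarrow> s \<in> vertices f \<and> K \<subseteq> act s \<and> (\<forall>i\<in>act s - T - K. \<beta> \<bullet> e s i > 0)"

lemma min_vertex_minimal:
  assumes "min_vertex \<beta> K s" "x \<in> subface K"
  shows "\<beta> \<bullet> s \<le> \<beta> \<bullet> x \<and> (\<beta> \<bullet> x = \<beta> \<bullet> s \<longrightarrow> x = s)"
proof -
  have s: "s \<in> vertices p" "s \<in> vertices f" using assms by (auto simp: min_vertex_def vertices_f)
  let ?c = "\<lambda>i. (b i - a i \<bullet> x) * (\<beta> \<bullet> e s i)"
  have x: "x = s + (\<Sum>i\<in>act s. (b i - a i \<bullet> x) *\<^sub>R e s i)" by (rule vertex_expansion[OF s(1)])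
  have "\<beta> \<bullet> x = \<beta> \<bullet> s + (\<Sum>i\<in>act s. ?c i)"
    by (subst x) (simp add: inner_add_right inner_sum_right)
  moreover have nonneg: "0 \<le> ?c i" if "i \<in> act s" for i
  proof (cases "i \<in> T \<union> K")
    case True
    then show ?thesis using assms by (auto simp: subface_def f_iff)
  next
    case False
    then have "\<beta> \<bullet> e s i > 0" using assms(1) that by (simp add: min_vertex_def)
    moreover have "a i \<bullet> x \<le> b i" using assms(2) that act_subset by (auto simp: subface_def f_iff p_iff)
    ultimately show ?thesis by simp
  qed
  moreover have "x = s" if "(\<Sum>i\<in>act s. ?c i) = 0"
  proof -
    have "?c i = 0" if "i \<in> act s" for i
      using sum_nonneg_eq_0_iff[of "act s" ?c] nonneg \<open>(\<Sum>i\<in>act s. ?c i) = 0\<close> that by simp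
    then have "b i - a i \<bullet> x = 0" if "i \<in> act s" for i
    proof (cases "i \<in> T \<union> K")
      case True
      then show ?thesis using assms(2) by (auto simp: subface_def f_iff)
    next
      case False
      then have "\<beta> \<bullet> e s i > 0" using assms(1) that by (simp add: min_vertex_def)
      then show ?thesis using \<open>\<And>i. i \<in> act s \<Longrightarrow> ?c i = 0\<close>[OF that] by simp
    qed
    then show ?thesis by (subst x) simp
  qed
  ultimately show ?thesis using sum_nonneg[of "act s" ?c] by auto
qed

text \<open>
  Any vertex of the set where \<open>\<beta>\<close> is minimal on \<open>subface K\<close> is a vertex of \<open>f\<close>; along the edges of \<open>f\<close> at
  it that stay in \<open>subface K\<close> the functional cannot decrease, and being generic it increases.
\<close>

lemma min_vertex_exists:
  assumes gen: "generic \<beta>" and K: "K \<subseteq> I" and ne: "subface K \<noteq> {}"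
  shows "\<exists>s. min_vertex \<beta> K s"
proof -
  have sub: "subface K = {x\<in>p. \<forall>i\<in>T \<union> K. a i \<bullet> x = b i}" by (auto simp: subface_def f_iff)
  have comp: "compact (subface K)" "convex (subface K)"
    unfolding sub using compact_face convex_face face_E[of "T \<union> K"] K T_subset by auto
  obtain m where m: "m \<in> subface K" "\<And>y. y \<in> subface K \<Longrightarrow> \<beta> \<bullet> m \<le> \<beta> \<bullet> y"
  proof -
    have "continuous_on (subface K) (\<lambda>x. \<beta> \<bullet> x)" by (intro continuous_intros)
    from continuous_attains_inf[OF comp(1) ne this] show thesis using that by blast
  qed
  let ?Q = "subface K \<inter> {x. \<beta> \<bullet> x = \<beta> \<bullet> m}"
  have Q: "compact ?Q" "convex ?Q" "?Q \<noteq> {}"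
    using comp m by (auto intro: compact_Int_closed closed_hyperplane convex_Int convex_hyperplane)
  then obtain s where s: "s extreme_point_of ?Q"
    using Krein_Milman_Minkowski[OF Q(1,2)] by fastforce
  have sQ: "s \<in> ?Q" and sf: "s \<in> f" using s by (auto simp: extreme_point_of_def subface_def)
  have "s extreme_point_of f"
    unfolding extreme_point_of_def
  proof (intro conjI ballI sf)
    fix x y assume xy: "x \<in> f" "y \<in> f"
    show "s \<notin> open_segment x y"
    proof
      assume seg: "s \<in> open_segment x y"
      have "a i \<bullet> x = b i \<and> a i \<bullet> y = b i" if "i \<in> K" for i
        using sQ xy that K by (intro open_segment_face_eq[OF seg]) (auto simp: subface_def f_iff p_iff)
      then have sub: "x \<in> subface K" "y \<in> subface K" using xy by (auto simp: subface_def)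
      have "(- \<beta>) \<bullet> x = - (\<beta> \<bullet> m) \<and> (- \<beta>) \<bullet> y = - (\<beta> \<bullet> m)"
        using m(2)[OF sub(1)] m(2)[OF sub(2)] sQ by (intro open_segment_face_eq[OF seg]) auto
      then show False using s seg sub by (auto simp: extreme_point_of_def)
    qed
  qed
  then have sv: "s \<in> vertices f" by (simp add: vertices_def)
  then have svp: "s \<in> vertices p" by (simp add: vertices_f)
  have Ks: "K \<subseteq> act s" using sQ K by (auto simp: subface_def act_def)
  have "\<beta> \<bullet> e s i > 0" if i: "i \<in> act s - T - K" for i
  proof -
    obtain t where t: "t > 0" "s + t *\<^sub>R e s i \<in> p" "\<And>j. j \<in> act s \<Longrightarrow> j \<noteq> i \<Longrightarrow> a j \<bullet> (s + t *\<^sub>R e s i) = b j"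
      using edge_point[OF svp, of i] i by blast
    have "s + t *\<^sub>R e s i \<in> subface K"
      unfolding sub
    proof (intro CollectI conjI ballI t(2))
      fix j assume "j \<in> T \<union> K"
      then have "j \<in> act s" "j \<noteq> i" using T_act[OF sv] Ks i by auto
      then show "a j \<bullet> (s + t *\<^sub>R e s i) = b j" by (rule t(3))
    qed
    then have "\<beta> \<bullet> s \<le> \<beta> \<bullet> (s + t *\<^sub>R e s i)" using m(2) sQ by auto
    then have "0 \<le> \<beta> \<bullet> e s i" using t(1) by (simp add: inner_add_right zero_le_mult_iff)
    moreover have "\<beta> \<bullet> e s i \<noteq> 0" using gen sv i by (auto simp: generic_def)
    ultimately show ?thesis by simp
  qed
  then show ?thesis using sv Ks by (auto simp: min_vertex_def)
qed

lemma min_vertex_in_subface: "min_vertex \<beta> K s \<Longrightarrow> s \<in> subface K"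
  by (auto simp: min_vertex_def subface_def vertices_f act_def)

lemma card_min_vertex:
  assumes "generic \<beta>" "K \<subseteq> I"
  shows "card {s\<in>vertices f. min_vertex \<beta> K s} = (if subface K = {} then 0 else 1)"
proof (cases "subface K = {}")
  case True
  then show ?thesis using min_vertex_in_subface by auto
next
  case False
  obtain s where s: "min_vertex \<beta> K s" using min_vertex_exists[OF assms False] by blast
  have "s' = s" if "min_vertex \<beta> K s'" for s'
  proof -
    have "\<beta> \<bullet> s' = \<beta> \<bullet> s"
      using conjunct1[OF min_vertex_minimal[OF s min_vertex_in_subface[OF that]]]
        conjunct1[OF min_vertex_minimal[OF that min_vertex_in_subface[OF s]]] by (rule order_antisym[rotated])
    with conjunct2[OF min_vertex_minimal[OF s min_vertex_in_subface[OF that]]] show ?thesis by (rule mp)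
  qed
  moreover have "s \<in> vertices f" using s by (simp add: min_vertex_def)
  ultimately have "{s\<in>vertices f. min_vertex \<beta> K s} = {s}" using s by blast
  then show ?thesis using False by simp
qed

definition violated :: "'a \<Rightarrow> 'i set" where
  "violated x = {i\<in>I - T. a i \<bullet> x > b i}"

text \<open>
  Minus the reduced Euler characteristic of the nerve formed by the violated facets on \<open>f\<close>.  It is
  defined without a functional, whereas each generic \<open>\<beta>\<close> expresses it as an alternating sum of cones
  flipped into the half space \<open>\<beta> > 0\<close>; the freedom in the choice of \<open>\<beta>\<close> is what controls its support.
\<close>

definition \<Psi> :: "'a \<Rightarrow> real" where
  "\<Psi> x = (\<Sum>K | K \<subseteq> violated x \<and> subface K \<noteq> {}. (- 1) ^ card K)"

definition flip_sign :: "'a \<Rightarrow> 'a \<Rightarrow> 'i \<Rightarrow> 'a \<Rightarrow> real" where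
  "flip_sign \<beta> s i x = (if \<beta> \<bullet> e s i > 0 then (if a i \<bullet> x \<le> b i then 1 else 0) else (if a i \<bullet> x \<le> b i then 0 else - 1))"

text \<open>
  Each factor \<open>flip_sign\<close> is a sum of two terms, according to whether the facet \<open>i\<close> is violated and
  whether \<open>\<beta>\<close> increases along the edge.  Expanding the product at \<open>s\<close> leaves the sets \<open>K\<close> of violated
  facets for which \<open>s\<close> is the minimizing vertex, and every \<open>K\<close> with non-empty subface has exactly one
  such vertex.
\<close>

lemma \<Psi>_eq_flipped_cones:
  assumes gen: "generic \<beta>"
  shows "\<Psi> x = (\<Sum>s\<in>vertices f. \<Prod>i\<in>act s - T. flip_sign \<beta> s i x)"
proof -
  let ?J = "violated x"
  have finJ: "finite ?J" using finite_I by (simp add: violated_def)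
  have prod: "(\<Prod>i\<in>act s - T. flip_sign \<beta> s i x) = (\<Sum>K | K \<subseteq> ?J \<and> min_vertex \<beta> K s. (- 1) ^ card K)"
    if s: "s \<in> vertices f" for s
  proof -
    let ?A = "act s - T"
    let ?C = "\<lambda>i. if i \<in> ?J then - 1 else 0 :: real" and ?B = "\<lambda>i. if \<beta> \<bullet> e s i > 0 then 1 else 0 :: real"
    have "(\<Prod>i\<in>?A. flip_sign \<beta> s i x) = (\<Prod>i\<in>?A. ?C i + ?B i)"
      using act_subset by (intro prod.cong) (auto simp: flip_sign_def violated_def)
    also have "\<dots> = (\<Sum>K\<in>Pow ?A. (\<Prod>i\<in>K. ?C i) * (\<Prod>i\<in>?A - K. ?B i))"
      by (rule prod_add) simp
    also have "\<dots> = (\<Sum>K\<in>Pow ?A. if K \<subseteq> ?J \<and> min_vertex \<beta> K s then (- 1) ^ card K else 0)"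
    proof (rule sum.cong[OF refl])
      fix K assume K: "K \<in> Pow ?A"
      have finK: "finite K" using K finite_subset[of K ?A] by auto
      have C: "(\<Prod>i\<in>K. ?C i) = (if K \<subseteq> ?J then (- 1) ^ card K else 0)"
      proof (cases "K \<subseteq> ?J")
        case True
        then have "(\<Prod>i\<in>K. ?C i) = (\<Prod>i\<in>K. - 1)" by (intro prod.cong) auto
        then show ?thesis using True by simp
      next
        case False
        then show ?thesis using finK by (auto simp: prod_zero_iff)
      qed
      have B: "(\<Prod>i\<in>?A - K. ?B i) = (if min_vertex \<beta> K s then 1 else 0)"
      proof (cases "min_vertex \<beta> K s")
        case True
        then have "(\<Prod>i\<in>?A - K. ?B i) = (\<Prod>i\<in>?A - K. 1)" by (intro prod.cong) (auto simp: min_vertex_def)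
        then show ?thesis using True by simp
      next
        case False
        then obtain i where "i \<in> ?A - K" "\<not> \<beta> \<bullet> e s i > 0" using K s by (auto simp: min_vertex_def)
        then have "(\<Prod>i\<in>?A - K. ?B i) = 0" by (intro prod_zero) auto
        then show ?thesis using False by simp
      qed
      show "(\<Prod>i\<in>K. ?C i) * (\<Prod>i\<in>?A - K. ?B i) = (if K \<subseteq> ?J \<and> min_vertex \<beta> K s then (- 1) ^ card K else 0)"
        unfolding C B by simp
    qed
    also have "\<dots> = (\<Sum>K | K \<subseteq> ?J \<and> min_vertex \<beta> K s. (- 1) ^ card K)"
      by (rule sum.mono_neutral_cong_right) (auto simp: min_vertex_def violated_def)
    finally show ?thesis .
  qed
  have "(\<Sum>s\<in>vertices f. \<Prod>i\<in>act s - T. flip_sign \<beta> s i x) 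
      = (\<Sum>s\<in>vertices f. \<Sum>K\<in>Pow ?J. if min_vertex \<beta> K s then (- 1) ^ card K else 0)"
    using finJ by (intro sum.cong refl) (auto simp: prod Pow_def simp flip: sum.inter_filter intro!: sum.cong)
  also have "\<dots> = (\<Sum>K\<in>Pow ?J. \<Sum>s\<in>vertices f. if min_vertex \<beta> K s then (- 1) ^ card K else 0)"
    by (rule sum.swap)
  also have "\<dots> = (\<Sum>K\<in>Pow ?J. if subface K = {} then 0 else (- 1) ^ card K)"
  proof (rule sum.cong[OF refl])
    fix K assume "K \<in> Pow ?J"
    then have "K \<subseteq> I" by (auto simp: violated_def)
    have "(\<Sum>s\<in>vertices f. if min_vertex \<beta> K s then (- 1) ^ card K else 0) = 
       real (card {s\<in>vertices f. min_vertex \<beta> K s}) * (- 1) ^ card K"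
      by (simp flip: sum.inter_filter)
    then show "(\<Sum>s\<in>vertices f. if min_vertex \<beta> K s then (- 1) ^ card K else 0) = (if subface K = {} then 0 else (- 1) ^ card K :: real)"
      using card_min_vertex[OF gen \<open>K \<subseteq> I\<close>] by simp
  qed
  also have "\<dots> = \<Psi> x"
    unfolding \<Psi>_def using finJ by (intro sum.mono_neutral_cong_right) auto
  finally show ?thesis ..
qed

lemma \<Psi>_on_p:
  assumes "x \<in> p" shows "\<Psi> x = 1"
proof -
  have v: "violated x = {}" using assms by (fastforce simp: violated_def p_iff)
  have "{K. K \<subseteq> violated x \<and> subface K \<noteq> {}} = {{}}" using nonempty by (auto simp: subface_def v)
  then show ?thesis by (simp add: \<Psi>_def)
qed

text \<open>
  In the slice through \<open>x\<close> parallel to \<open>f\<close>, the vertex \<open>s\<close> of \<open>f\<close> is replaced by the point at which the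
  facets through \<open>s\<close> not containing \<open>f\<close> meet.
\<close>

definition vertex_shift :: "'a \<Rightarrow> 'a \<Rightarrow> 'a" where
  "vertex_shift s x = s + (\<Sum>j\<in>T. (b j - a j \<bullet> x) *\<^sub>R e s j)"

lemma vertex_shift_expansion:
  assumes s: "s \<in> vertices f"
  shows "x = vertex_shift s x + (\<Sum>i\<in>act s - T. (b i - a i \<bullet> x) *\<^sub>R e s i)"
proof -
  have "x = s + (\<Sum>i\<in>act s. (b i - a i \<bullet> x) *\<^sub>R e s i)" using s by (intro vertex_expansion) (simp add: vertices_f)
  also have "(\<Sum>i\<in>act s. (b i - a i \<bullet> x) *\<^sub>R e s i) = (\<Sum>i\<in>act s - T. (b i - a i \<bullet> x) *\<^sub>R e s i) + (\<Sum>i\<in>T. (b i - a i \<bullet> x) *\<^sub>R e s i)"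
    by (rule sum.subset_diff[OF T_act[OF s] finite_act])
  finally show ?thesis unfolding vertex_shift_def by (simp add: algebra_simps)
qed

lemma generic_exists:
  assumes "\<epsilon> > 0" obtains \<beta> where "\<beta> \<in> ball \<beta>0 \<epsilon>" "generic \<beta>"
proof -
  let ?C = "\<Union>s\<in>vertices f. e s ` (act s - T)"
  have "0 \<notin> ?C" using e_nonzero by (fastforce simp: vertices_f)
  moreover have "finite ?C" by simp
  ultimately obtain \<beta> where "\<beta> \<in> ball \<beta>0 \<epsilon>" "\<And>g. g \<in> ?C \<Longrightarrow> \<beta> \<bullet> g \<noteq> 0"
    using generic_vector[of ?C \<epsilon> \<beta>0] assms by metis
  then show thesis by (intro that[of \<beta>]) (auto simp: generic_def)
qed

text \<open>
  Flipping along a functional that separates \<open>x\<close> from the shifted vertices puts \<open>x\<close> outside all flipped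
  cones, so \<open>\<Psi>\<close> has bounded support on each fibre.
\<close>

lemma \<Psi>_support:
  assumes "\<Psi> x \<noteq> 0"
  shows "x \<in> convex hull ((\<lambda>s. vertex_shift s x) ` vertices f)"
proof (rule ccontr)
  let ?V = "(\<lambda>s. vertex_shift s x) ` vertices f"
  assume "x \<notin> convex hull ?V"
  moreover have "compact (convex hull ?V)" by (intro finite_imp_compact_convex_hull) simp
  ultimately obtain \<beta>0 c where \<beta>0: "\<beta>0 \<bullet> x < c" "\<forall>y\<in>convex hull ?V. \<beta>0 \<bullet> y > c"
    using separating_hyperplane_closed_point[of "convex hull ?V" x] compact_imp_closed convex_convex_hull by blast
  have "\<forall>s\<in>vertices f. 0 < \<beta>0 \<bullet> (vertex_shift s x - x)"
    using \<beta>0 hull_subset[of ?V convex] by (fastforce simp: inner_diff_right)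
  then obtain \<epsilon> where \<epsilon>: "\<epsilon> > 0" "\<forall>s\<in>vertices f. \<epsilon> * \<bar>norm (vertex_shift s x - x)\<bar> < \<beta>0 \<bullet> (vertex_shift s x - x)"
    using small_step[of "vertices f" "\<lambda>s. \<beta>0 \<bullet> (vertex_shift s x - x)" "\<lambda>s. norm (vertex_shift s x - x)"] by auto
  obtain \<beta> where \<beta>: "\<beta> \<in> ball \<beta>0 \<epsilon>" "generic \<beta>" using generic_exists[OF \<epsilon>(1)] by blast
  have pos: "0 < \<beta> \<bullet> (vertex_shift s x - x)" if s: "s \<in> vertices f" for s
  proof -
    have "(\<beta>0 - \<beta>) \<bullet> (vertex_shift s x - x) \<le> norm (\<beta>0 - \<beta>) * norm (vertex_shift s x - x)"
      by (rule norm_cauchy_schwarz)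
    also have "\<dots> \<le> \<epsilon> * norm (vertex_shift s x - x)"
      using \<beta>(1) by (intro mult_right_mono) (auto simp: dist_norm)
    also have "\<dots> < \<beta>0 \<bullet> (vertex_shift s x - x)" using \<epsilon>(2) s by simp
    finally show ?thesis by (simp add: inner_diff_left)
  qed
  obtain s where s: "s \<in> vertices f" "(\<Prod>i\<in>act s - T. flip_sign \<beta> s i x) \<noteq> 0"
    using assms \<Psi>_eq_flipped_cones[OF \<beta>(2), of x] by (metis (no_types, lifting) sum.neutral)
  have "0 \<le> (b i - a i \<bullet> x) * (\<beta> \<bullet> e s i)" if i: "i \<in> act s - T" for i
  proof -
    have "flip_sign \<beta> s i x \<noteq> 0" using s(2) i by (simp add: prod_zero_iff)
    then show ?thesis by (auto simp: flip_sign_def zero_le_mult_iff split: if_splits)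
  qed
  then have "0 \<le> (\<Sum>i\<in>act s - T. (b i - a i \<bullet> x) * (\<beta> \<bullet> e s i))" by (rule sum_nonneg)
  also have "\<dots> = \<beta> \<bullet> (\<Sum>i\<in>act s - T. (b i - a i \<bullet> x) *\<^sub>R e s i)" by (simp add: inner_sum_right)
  also have "(\<Sum>i\<in>act s - T. (b i - a i \<bullet> x) *\<^sub>R e s i) = x - vertex_shift s x"
    using vertex_shift_expansion[OF s(1), of x] by (metis add_diff_cancel_left')
  finally show False using pos[OF s(1)] by (simp add: inner_diff_right)
qed

text \<open>
  The inequalities of \<open>p\<close> that are inactive at a vertex are strict there, hence survive a small shift.
\<close>

lemma vertex_shift_near:
  obtains \<delta> where "\<delta> > 0" "\<And>x s. s \<in> vertices f \<Longrightarrow> (\<And>j. j \<in> T \<Longrightarrow> a j \<bullet> x \<le> b j \<and> b j - a j \<bullet> x < \<delta>) \<Longrightarrow> vertex_shift s x \<in> p"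
proof -
  let ?S = "SIGMA s:vertices f. I - act s"
  have "finite ?S" using finite_I by auto
  moreover have "0 < (\<lambda>(s,i). b i - a i \<bullet> s) si" if "si \<in> ?S" for si
    using that by (force simp: act_def vertices_f f_iff p_iff less_le)
  ultimately obtain \<delta> where \<delta>: "\<delta> > 0" "\<forall>si\<in>?S. \<delta> * \<bar>(\<lambda>(s,i). \<Sum>j\<in>T. \<bar>a i \<bullet> e s j\<bar>) si\<bar> < (\<lambda>(s,i). b i - a i \<bullet> s) si"
    by (rule small_step)
  have "vertex_shift s x \<in> p" if s: "s \<in> vertices f" and x: "\<And>j. j \<in> T \<Longrightarrow> a j \<bullet> x \<le> b j \<and> b j - a j \<bullet> x < \<delta>" for x s
    unfolding p_iff
  proof
    fix i assume i: "i \<in> I"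
    have sp: "s \<in> vertices p" using s by (simp add: vertices_f)
    have eq: "a i \<bullet> vertex_shift s x = a i \<bullet> s + (\<Sum>j\<in>T. (b j - a j \<bullet> x) * (a i \<bullet> e s j))"
      by (simp add: vertex_shift_def inner_add_right inner_sum_right)
    show "a i \<bullet> vertex_shift s x \<le> b i"
    proof (cases "i \<in> act s")
      case True
      have "(\<Sum>j\<in>T. (b j - a j \<bullet> x) * (a i \<bullet> e s j)) \<le> 0"
      proof (rule sum_nonpos)
        fix j assume j: "j \<in> T"
        then have "a i \<bullet> e s j \<le> 0" using e_dual[OF sp _ True, of j] T_act[OF s] by auto
        then show "(b j - a j \<bullet> x) * (a i \<bullet> e s j) \<le> 0" using x[OF j] by (intro mult_nonneg_nonpos) auto
      qed
      then show ?thesis using True eq by (simp add: act_def)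
    next
      case False
      have "(\<Sum>j\<in>T. (b j - a j \<bullet> x) * (a i \<bullet> e s j)) \<le> (\<Sum>j\<in>T. \<delta> * \<bar>a i \<bullet> e s j\<bar>)"
      proof (rule sum_mono)
        fix j assume j: "j \<in> T"
        have "(b j - a j \<bullet> x) * (a i \<bullet> e s j) \<le> (b j - a j \<bullet> x) * \<bar>a i \<bullet> e s j\<bar>"
          using x[OF j] by (intro mult_left_mono) auto
        also have "\<dots> \<le> \<delta> * \<bar>a i \<bullet> e s j\<bar>" using x[OF j] by (intro mult_right_mono) auto
        finally show "(b j - a j \<bullet> x) * (a i \<bullet> e s j) \<le> \<delta> * \<bar>a i \<bullet> e s j\<bar>" .
      qed
      also have "\<dots> = \<delta> * \<bar>\<Sum>j\<in>T. \<bar>a i \<bullet> e s j\<bar>\<bar>" by (simp add: sum_distrib_left sum_nonneg)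
      also have "\<dots> < b i - a i \<bullet> s" using \<delta>(2) s i False by fastforce
      finally show ?thesis using eq by simp
    qed
  qed
  then show thesis using \<delta>(1) that by blast
qed

lemma subspace_T: "subspace {v. \<forall>j\<in>T. a j \<bullet> v = 0}"
  by (auto simp: subspace_def inner_add_right)

lemma e_in_lin:
  assumes s: "s \<in> vertices f" and i: "i \<in> act s - T" shows "e s i \<in> lin f"
proof -
  have sp: "s \<in> vertices p" using s by (simp add: vertices_f)
  obtain t where t: "t > 0" "s + t *\<^sub>R e s i \<in> p" "\<And>j. j \<in> act s \<Longrightarrow> j \<noteq> i \<Longrightarrow> a j \<bullet> (s + t *\<^sub>R e s i) = b j"
    using edge_point[OF sp, of i] i by blast
  have "s + t *\<^sub>R e s i \<in> f" using t T_act[OF s] i by (fastforce simp: f_iff)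
  moreover have "s \<in> f" using s by (simp add: vertices_f)
  ultimately have "(s + t *\<^sub>R e s i) - s \<in> lin f" unfolding lin_def by (intro span_base) blast
  then have "t *\<^sub>R e s i \<in> lin f" by simp
  then have "(1 / t) *\<^sub>R (t *\<^sub>R e s i) \<in> lin f" unfolding lin_def by (rule span_scale)
  then show ?thesis using t(1) by simp
qed

lemma vertices_f_nonempty: "vertices f \<noteq> {}"
  using Krein_Milman_Minkowski[OF compact_face[OF face] convex_face[OF face]] nonempty
  by (auto simp: vertices_def)

lemma lin_eq: "lin f = {v. \<forall>j\<in>T. a j \<bullet> v = 0}"
proof
  show "lin f \<subseteq> {v. \<forall>j\<in>T. a j \<bullet> v = 0}"
    unfolding lin_def by (rule span_minimal[OF _ subspace_T]) (auto simp: T_def inner_diff_right)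
  obtain s where s: "s \<in> vertices f" using vertices_f_nonempty by blast
  show "{v. \<forall>j\<in>T. a j \<bullet> v = 0} \<subseteq> lin f"
  proof
    fix v assume v: "v \<in> {v. \<forall>j\<in>T. a j \<bullet> v = 0}"
    have "v = (\<Sum>i\<in>act s. (- (a i \<bullet> v)) *\<^sub>R e s i)" using s by (intro expansion) (simp add: vertices_f)
    also have "\<dots> = (\<Sum>i\<in>act s - T. (- (a i \<bullet> v)) *\<^sub>R e s i)"
      using v by (intro sum.mono_neutral_right) auto
    also have "\<dots> \<in> lin f"
      unfolding lin_def using e_in_lin[OF s, unfolded lin_def] by (intro span_sum span_scale) auto
    finally show "v \<in> lin f" .
  qed
qed

lemma cone_point:
  assumes "x0 \<in> p" "\<And>i. i \<in> act x0 \<Longrightarrow> a i \<bullet> v \<le> b i"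
  obtains z t where "z \<in> p" "t \<ge> 0" "v = x0 + t *\<^sub>R (z - x0)"
proof -
  have "a i \<bullet> (v - x0) \<le> 0" if "i \<in> act x0" for i
    using assms(2)[OF that] that by (simp add: act_def inner_diff_right)
  from small_step_in_p[OF assms(1) this] obtain t where t: "t > 0" "x0 + t *\<^sub>R (v - x0) \<in> p" by blast
  show thesis
    by (rule that[OF t(2), of "1 / t"]) (use t(1) in auto)
qed

lemma tangent_cone_vertex:
  assumes "s \<in> vertices p" shows "tangent_cone p {s} = {x. \<forall>i\<in>act s. a i \<bullet> x \<le> b i}"
proof (intro equalityI subsetI)
  fix x assume "x \<in> tangent_cone p {s}"
  then obtain z t where z: "z \<in> p" "0 \<le> t" "x = s + t *\<^sub>R (z - s)" by (auto simp: tangent_cone_def)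
  have "a i \<bullet> x \<le> b i" if i: "i \<in> act s" for i
  proof -
    have "a i \<bullet> (z - s) \<le> 0" using z(1) i by (auto simp: p_iff act_def inner_diff_right)
    then show ?thesis using z i by (simp add: act_def inner_add_right mult_nonneg_nonpos)
  qed
  then show "x \<in> {x. \<forall>i\<in>act s. a i \<bullet> x \<le> b i}" by blast
next
  fix x assume "x \<in> {x. \<forall>i\<in>act s. a i \<bullet> x \<le> b i}"
  then obtain z t where "z \<in> p" "t \<ge> 0" "x = s + t *\<^sub>R (z - s)"
    using cone_point[OF vertices_in_p[OF assms], of x] by auto
  then show "x \<in> tangent_cone p {s}" unfolding tangent_cone_def by blast
qed

text \<open>
  For every facet not containing \<open>f\<close> pick a point of \<open>f\<close> off that facet; the average of these points
  lies on no further facet.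
\<close>

lemma relative_interior_point:
  obtains x0 where "x0 \<in> f" "act x0 = T"
proof -
  have "\<exists>z\<in>f. a i \<bullet> z < b i" if i: "i \<in> I - T" for i
  proof -
    obtain z where z: "z \<in> f" "a i \<bullet> z \<noteq> b i" using i by (auto simp: T_def)
    then have "a i \<bullet> z \<le> b i" using i by (simp add: f_iff p_iff)
    then show ?thesis using z by (intro bexI[of _ z]) auto
  qed
  then obtain z where z: "\<And>i. i \<in> I - T \<Longrightarrow> z i \<in> f \<and> a i \<bullet> z i < b i" by metis
  obtain y where y: "y \<in> f" using nonempty by blast
  \<comment> \<open>The extra point \<open>y\<close> keeps the average meaningful when \<open>I - T\<close> is empty.\<close>
  let ?N = "real (card (I - T)) + 1"
  define w where "w i = (if i \<in> I - T then z i else y)" for i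
  have w: "w i \<in> f" for i using z y by (auto simp: w_def)
  define x0 where "x0 = (1 / ?N) *\<^sub>R y + (\<Sum>i\<in>I - T. (1 / ?N) *\<^sub>R w i)"
  have aff: "c \<bullet> x0 = (c \<bullet> y + (\<Sum>i\<in>I - T. c \<bullet> w i)) / ?N" for c
    by (simp add: x0_def inner_add_right inner_sum_right add_divide_distrib sum_divide_distrib)
  have le: "a i \<bullet> x0 \<le> b i \<and> (i \<in> I - T \<longrightarrow> a i \<bullet> x0 < b i)" if i: "i \<in> I" for i
  proof -
    have ub: "a i \<bullet> w k \<le> b i" "a i \<bullet> y \<le> b i" for k using w[of k] y i by (auto simp: f_iff p_iff)
    have N: "(\<Sum>k\<in>I - T. b i) + b i = ?N * b i" by (simp add: algebra_simps)
    have "(\<Sum>k\<in>I - T. a i \<bullet> w k) \<le> (\<Sum>k\<in>I - T. b i)" using ub by (intro sum_mono)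
    then have "a i \<bullet> y + (\<Sum>k\<in>I - T. a i \<bullet> w k) \<le> ?N * b i" using ub N by linarith
    moreover have "a i \<bullet> y + (\<Sum>k\<in>I - T. a i \<bullet> w k) < ?N * b i" if iT: "i \<in> I - T"
    proof -
      have "(\<Sum>k\<in>I - T. a i \<bullet> w k) < (\<Sum>k\<in>I - T. b i)"
      proof (rule sum_strict_mono_ex1)
        have "w i = z i" using iT by (simp only: w_def if_True)
        then have "a i \<bullet> w i < b i" using z[OF iT] by simp
        with iT show "\<exists>k\<in>I - T. a i \<bullet> w k < b i" by (rule bexI[rotated])
      qed (use ub finite_I in auto)
      then show ?thesis using ub N by linarith
    qed
    ultimately show ?thesis unfolding aff by (simp add: pos_divide_le_eq pos_divide_less_eq add_nonneg_pos mult.commute)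
  qed
  have eqT: "a i \<bullet> x0 = b i" if "i \<in> T" for i
  proof -
    have "a i \<bullet> w k = b i" "a i \<bullet> y = b i" for k using w[of k] y that by (auto simp: f_iff)
    then have "a i \<bullet> x0 = (?N * b i) / ?N" unfolding aff by (simp add: algebra_simps)
    then show ?thesis by (simp add: add_nonneg_pos)
  qed
  have "x0 \<in> p" using le by (auto simp: p_iff)
  then have "x0 \<in> f" using eqT by (simp add: f_iff)
  moreover have "act x0 = T" using le eqT T_subset unfolding act_def by fastforce
  ultimately show thesis by (rule that)
qed

lemma tangent_cone_face: "tangent_cone p f = {x. \<forall>i\<in>T. a i \<bullet> x \<le> b i}"
proof (intro equalityI subsetI)
  fix x assume "x \<in> tangent_cone p f"
  then obtain y z t where z: "y \<in> f" "z \<in> p" "0 \<le> t" "x = y + t *\<^sub>R (z - y)" by (auto simp: tangent_cone_def)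
  have "a i \<bullet> x \<le> b i" if i: "i \<in> T" for i
  proof -
    have yi: "a i \<bullet> y = b i" using z i by (simp add: f_iff)
    then have "a i \<bullet> (z - y) \<le> 0" using z(2) i T_subset by (auto simp: p_iff inner_diff_right)
    then show ?thesis using z yi by (simp add: inner_add_right mult_nonneg_nonpos)
  qed
  then show "x \<in> {x. \<forall>i\<in>T. a i \<bullet> x \<le> b i}" by blast
next
  fix x assume x: "x \<in> {x. \<forall>i\<in>T. a i \<bullet> x \<le> b i}"
  obtain x0 where x0: "x0 \<in> f" "act x0 = T" by (rule relative_interior_point)
  then obtain z t where "z \<in> p" "t \<ge> 0" "x = x0 + t *\<^sub>R (z - x0)"
    using cone_point[of x0 x] x by (auto simp: f_iff)
  then show "x \<in> tangent_cone p f" using x0(1) unfolding tangent_cone_def by blast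
qed

text \<open>
  Dropping the facet \<open>j\<close> enlarges \<open>f\<close> by one dimension, spanned by the edge \<open>e s j\<close>.  A functional
  vanishing on \<open>lin f\<close> and on \<open>e s j\<close> is therefore constant on a face strictly containing \<open>f\<close>.
\<close>

lemma larger_face:
  assumes s: "s \<in> vertices f" and j: "j \<in> T"
  obtains h where "h face_of p" "f \<subset> h" "\<And>x. x \<in> h \<Longrightarrow> x - s - (b j - a j \<bullet> x) *\<^sub>R e s j \<in> lin f"
proof -
  have sp: "s \<in> vertices p" using s by (simp add: vertices_f)
  let ?h = "{x\<in>p. \<forall>i\<in>T - {j}. a i \<bullet> x = b i}"
  obtain t where t: "t > 0" "s + t *\<^sub>R e s j \<in> p" "\<And>i. i \<in> act s \<Longrightarrow> i \<noteq> j \<Longrightarrow> a i \<bullet> (s + t *\<^sub>R e s j) = b i"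
    using edge_point[OF sp, of j] j T_act[OF s] by blast
  have "s + t *\<^sub>R e s j \<in> ?h" using t T_act[OF s] by auto
  moreover have "a j \<bullet> (s + t *\<^sub>R e s j) \<noteq> b j"
    using e_dual[OF sp, of j j] T_act[OF s] j t(1) by (auto simp: inner_add_right act_def subset_iff)
  then have "s + t *\<^sub>R e s j \<notin> f" using j by (auto simp: f_iff)
  moreover have "f \<subseteq> ?h" by (auto simp: f_iff)
  ultimately have "f \<subset> ?h" by blast
  moreover have "?h face_of p" using T_subset by (intro face_E) auto
  moreover have "x - s - (b j - a j \<bullet> x) *\<^sub>R e s j \<in> lin f" if x: "x \<in> ?h" for x
    unfolding lin_eq
  proof (safe)
    fix i assume i: "i \<in> T"
    then have "a i \<bullet> e s j = (if i = j then - 1 else 0)" using e_dual[OF sp, of j i] T_act[OF s] j by blast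
    moreover have "a i \<bullet> s = b i" using i T_act[OF s] by (auto simp: act_def)
    ultimately show "a i \<bullet> (x - s - (b j - a j \<bullet> x) *\<^sub>R e s j) = 0"
      using x i by (cases "i = j") (auto simp: inner_diff_right)
  qed
  ultimately show thesis using that by blast
qed

end

section \<open>Lattices\<close>

lemma lattice_zero: "is_lattice L \<Longrightarrow> 0 \<in> L"
  and lattice_add: "is_lattice L \<Longrightarrow> x \<in> L \<Longrightarrow> y \<in> L \<Longrightarrow> x + y \<in> L"
  and lattice_scale: "is_lattice L \<Longrightarrow> x \<in> L \<Longrightarrow> real_of_int k *\<^sub>R x \<in> L"
proof -
  assume "is_lattice L"
  then obtain B where B: "L = range (\<lambda>c :: 'a \<Rightarrow> int. \<Sum>b\<in>B. real_of_int (c b) *\<^sub>R b)"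
    unfolding is_lattice_def by blast
  show "0 \<in> L" unfolding B by (rule image_eqI[of _ _ "\<lambda>_. 0"]) auto
  show "x + y \<in> L" if xy: "x \<in> L" "y \<in> L"
  proof -
    obtain c d where "x = (\<Sum>b\<in>B. real_of_int (c b) *\<^sub>R b)" "y = (\<Sum>b\<in>B. real_of_int (d b) *\<^sub>R b)"
      using xy unfolding B by auto
    then show ?thesis
      unfolding B by (intro image_eqI[of _ _ "\<lambda>b. c b + d b"]) (auto simp: scaleR_add_left sum.distrib)
  qed
  show "real_of_int k *\<^sub>R x \<in> L" if xL: "x \<in> L"
  proof -
    obtain c where "x = (\<Sum>b\<in>B. real_of_int (c b) *\<^sub>R b)"
      using xL unfolding B by auto
    then show ?thesis
      unfolding B by (intro image_eqI[of _ _ "\<lambda>b. k * c b"]) (auto simp: scaleR_sum_right)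
  qed
qed

lemma lattice_minus: "is_lattice L \<Longrightarrow> x \<in> L \<Longrightarrow> - x \<in> L"
  using lattice_scale[of L x "- 1"] by simp

lemma lattice_diff: "is_lattice L \<Longrightarrow> x \<in> L \<Longrightarrow> y \<in> L \<Longrightarrow> x - y \<in> L"
  using lattice_add[of L x "- y"] lattice_minus[of L y] by simp

lemma lattice_sum: "is_lattice L \<Longrightarrow> (\<And>i. i \<in> A \<Longrightarrow> g i \<in> L) \<Longrightarrow> (\<Sum>i\<in>A. real_of_int (k i) *\<^sub>R g i) \<in> L"
  by (induction A rule: infinite_finite_induct) (auto simp: lattice_zero intro!: lattice_add lattice_scale)

lemma lattice_minus_cancel: "is_lattice L \<Longrightarrow> v \<in> L \<Longrightarrow> x - v \<in> L \<longleftrightarrow> x \<in> L"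
  using lattice_add[of L "x - v" v] lattice_diff[of L x v] by auto

lemma lattice_finite_bounded:
  assumes "is_lattice (L :: 'a::euclidean_space set)" "bounded S" "S \<subseteq> L"
  shows "finite S"
proof -
  obtain B where B: "independent B" "L = range (\<lambda>c :: 'a \<Rightarrow> int. \<Sum>b\<in>B. real_of_int (c b) *\<^sub>R b)"
    using assms(1) unfolding is_lattice_def by blast
  obtain C where C: "C \<ge> 0" "\<And>c b. b \<in> B \<Longrightarrow> \<bar>c b\<bar> \<le> C * norm (\<Sum>b\<in>B. c b *\<^sub>R b)"
    using independent_coeff_bound[OF B(1)] by blast
  obtain r where r: "\<forall>x\<in>S. norm x \<le> r" using assms(2) unfolding bounded_iff by blast
  define N where "N = \<lceil>C * r\<rceil>"
  have "S \<subseteq> (\<lambda>c. \<Sum>b\<in>B. real_of_int (c b) *\<^sub>R b) ` (PiE B (\<lambda>_. {-N..N}))"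
  proof
    fix x assume x: "x \<in> S"
    then obtain c :: "'a \<Rightarrow> int" where c: "x = (\<Sum>b\<in>B. real_of_int (c b) *\<^sub>R b)" using assms(3) unfolding B(2) by blast
    have "c b \<in> {-N..N}" if "b \<in> B" for b
    proof -
      have "\<bar>real_of_int (c b)\<bar> \<le> C * norm x" unfolding c by (rule C(2)[OF that])
      also have "\<dots> \<le> C * r" using r x C(1) by (intro mult_left_mono) auto
      also have "\<dots> \<le> real_of_int N" by (simp add: N_def)
      finally show ?thesis by auto
    qed
    then have "restrict c B \<in> PiE B (\<lambda>_. {-N..N})" by auto
    moreover have "x = (\<Sum>b\<in>B. real_of_int (restrict c B b) *\<^sub>R b)" unfolding c by (intro sum.cong) auto
    ultimately show "x \<in> (\<lambda>c. \<Sum>b\<in>B. real_of_int (c b) *\<^sub>R b) ` (PiE B (\<lambda>_. {-N..N}))" by blast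
  qed
  moreover have "finite (PiE B (\<lambda>_. {-N..N}))"
    using B(1) independent_imp_finite by (intro finite_PiE) auto
  ultimately show ?thesis using finite_surj by blast
qed

text \<open>
  Reducing coordinates modulo \<open>1\<close> leaves finitely many lattice points, so a spanning family of lattice
  vectors generates a subgroup of finite index and every lattice point has a multiple in it.
\<close>

lemma lattice_residues:
  fixes L :: "'a::euclidean_space set" and g :: "'i \<Rightarrow> 'a"
  assumes L: "is_lattice L" and A: "finite A" and g: "\<And>i. i \<in> A \<Longrightarrow> g i \<in> L"
    and span: "\<And>x. \<exists>c. x = (\<Sum>i\<in>A. c i *\<^sub>R g i)"
  obtains R where "finite R" "R \<subseteq> L" "\<forall>x\<in>L. \<exists>k :: 'i \<Rightarrow> int. x - (\<Sum>i\<in>A. real_of_int (k i) *\<^sub>R g i) \<in> R"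
proof -
  let ?R = "L \<inter> cball 0 (\<Sum>i\<in>A. norm (g i))"
  have fin: "finite ?R" using L by (rule lattice_finite_bounded) auto
  have ex: "\<exists>k :: 'i \<Rightarrow> int. x - (\<Sum>i\<in>A. real_of_int (k i) *\<^sub>R g i) \<in> ?R" if x: "x \<in> L" for x
  proof -
    obtain c where c: "x = (\<Sum>i\<in>A. c i *\<^sub>R g i)" using span by blast
    have "x - (\<Sum>i\<in>A. real_of_int \<lfloor>c i\<rfloor> *\<^sub>R g i) = (\<Sum>i\<in>A. (c i - real_of_int \<lfloor>c i\<rfloor>) *\<^sub>R g i)"
      by (simp add: c scaleR_diff_left sum_subtractf)
    also have "norm \<dots> \<le> (\<Sum>i\<in>A. norm (g i))"
    proof (rule sum_norm_le)
      fix i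
      have "\<bar>c i - real_of_int \<lfloor>c i\<rfloor>\<bar> \<le> 1" by linarith
      then show "norm ((c i - real_of_int \<lfloor>c i\<rfloor>) *\<^sub>R g i) \<le> norm (g i)" 
        using mult_right_mono[of "\<bar>c i - real_of_int \<lfloor>c i\<rfloor>\<bar>" 1 "norm (g i)"] by simp
    qed
    finally have "norm (x - (\<Sum>i\<in>A. real_of_int \<lfloor>c i\<rfloor> *\<^sub>R g i)) \<le> (\<Sum>i\<in>A. norm (g i))" .
    moreover have "x - (\<Sum>i\<in>A. real_of_int \<lfloor>c i\<rfloor> *\<^sub>R g i) \<in> L"
      by (rule lattice_diff[OF L x lattice_sum[OF L g]])
    ultimately show ?thesis by (intro exI[of _ "\<lambda>i. \<lfloor>c i\<rfloor>"]) (simp only: Int_iff mem_cball_0 simp_thms)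
  qed
  show thesis
    by (rule that[OF fin inf_le1]) (rule ballI[OF ex])
qed

lemma lattice_multiple:
  fixes L :: "'a::euclidean_space set" and g :: "'i \<Rightarrow> 'a"
  assumes L: "is_lattice L" and A: "finite A" and g: "\<And>i. i \<in> A \<Longrightarrow> g i \<in> L"
    and span: "\<And>x. \<exists>c. x = (\<Sum>i\<in>A. c i *\<^sub>R g i)" and x: "x \<in> L"
  obtains N :: nat and k :: "'i \<Rightarrow> int" where "N > 0" "real N *\<^sub>R x = (\<Sum>i\<in>A. real_of_int (k i) *\<^sub>R g i)"
proof -
  obtain R where R: "finite R" "R \<subseteq> L" "\<forall>x\<in>L. \<exists>k :: 'i \<Rightarrow> int. x - (\<Sum>i\<in>A. real_of_int (k i) *\<^sub>R g i) \<in> R"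
    by (rule lattice_residues[OF L A g span])
  have "real n *\<^sub>R x \<in> L" for n using lattice_scale[OF L x, of "int n"] by simp
  then have "\<forall>n. \<exists>k :: 'i \<Rightarrow> int. real n *\<^sub>R x - (\<Sum>i\<in>A. real_of_int (k i) *\<^sub>R g i) \<in> R" using R(3) by blast
  then obtain k :: "nat \<Rightarrow> 'i \<Rightarrow> int" where k: "\<And>n. real n *\<^sub>R x - (\<Sum>i\<in>A. real_of_int (k n i) *\<^sub>R g i) \<in> R"
    by metis
  let ?f = "\<lambda>n. real n *\<^sub>R x - (\<Sum>i\<in>A. real_of_int (k n i) *\<^sub>R g i)"
  have "\<not> inj ?f"
    using finite_imageD[of ?f UNIV] finite_subset[OF _ R(1), of "range ?f"] k by auto
  then obtain m n where "?f m = ?f n" "m \<noteq> n" by (auto simp: inj_def)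
  then obtain m n where mn: "?f m = ?f n" "m < n" by (metis linorder_neqE_nat)
  have "real (n - m) *\<^sub>R x = (\<Sum>i\<in>A. real_of_int (k n i - k m i) *\<^sub>R g i)"
    using mn by (simp add: of_nat_diff scaleR_diff_left sum_subtractf algebra_simps)
  then show thesis using that[of "n - m" "\<lambda>i. k n i - k m i"] mn(2) by simp
qed

lemma quasi_polynomial_on_const:
  assumes "is_lattice L" shows "quasi_polynomial_on L (\<lambda>_. c)"
  unfolding quasi_polynomial_on_def
proof (intro exI[of _ L] conjI ballI)
  have "(+) x ` L = L" if "x \<in> L" for x
  proof
    show "(+) x ` L \<subseteq> L" using lattice_add[OF assms that] by auto
    show "L \<subseteq> (+) x ` L"
    proof
      fix y assume "y \<in> L"
      then have "y - x \<in> L" using lattice_diff[OF assms] that by blast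
      then show "y \<in> (+) x ` L" by (rule image_eqI[rotated]) simp
    qed
  qed
  then have "(\<lambda>x. (+) x ` L) ` L \<subseteq> {L}" by auto
  then show "finite ((\<lambda>x. (+) x ` L) ` L)" by (rule finite_subset) simp
qed (use assms in \<open>auto intro: real_polynomial_function.intros(2) exI[of _ "\<lambda>_. c"]\<close>)

lemma fsupp_lattice:
  assumes "is_lattice (L :: 'a::euclidean_space set)" "bounded S" "\<And>x. h x \<noteq> 0 \<Longrightarrow> x \<in> L \<and> x \<in> S"
  shows "fsupp h"
  unfolding fsupp_def using assms(3)
  by (intro lattice_finite_bounded[OF assms(1)]) (auto intro: bounded_subset[OF assms(2)])

section \<open>Summation over the fibres of a linear map\<close>

definition push :: "('a::euclidean_space \<Rightarrow>\<^sub>L 'b::euclidean_space) \<Rightarrow> ('a \<Rightarrow> real) \<Rightarrow> 'b \<Rightarrow> real" where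
  "push \<pi> h y = (\<Sum>x | h x \<noteq> 0 \<and> blinfun_apply \<pi> x = y. h x)"

definition fibre_finite :: "('a::euclidean_space \<Rightarrow>\<^sub>L 'b::euclidean_space) \<Rightarrow> ('a \<Rightarrow> real) \<Rightarrow> bool" where
  "fibre_finite \<pi> h \<longleftrightarrow> (\<forall>y. finite {x. h x \<noteq> 0 \<and> blinfun_apply \<pi> x = y})"

lemma push_eq:
  assumes "finite S" "\<And>x. h x \<noteq> 0 \<Longrightarrow> blinfun_apply \<pi> x = y \<Longrightarrow> x \<in> S" "\<And>x. x \<in> S \<Longrightarrow> blinfun_apply \<pi> x = y"
  shows "push \<pi> h y = (\<Sum>x\<in>S. h x)"
  unfolding push_def by (rule sum.mono_neutral_left) (use assms in auto)

lemma fibre_finite_shift: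
  assumes "fibre_finite \<pi> h"
  shows "finite {x. h (x - g) \<noteq> 0 \<and> blinfun_apply \<pi> x = y}"
proof -
  have "{x. h (x - g) \<noteq> 0 \<and> blinfun_apply \<pi> x = y} \<subseteq> (+) g ` {x. h x \<noteq> 0 \<and> blinfun_apply \<pi> x = y - blinfun_apply \<pi> g}"
  proof
    fix x assume "x \<in> {x. h (x - g) \<noteq> 0 \<and> blinfun_apply \<pi> x = y}"
    then have "x - g \<in> {x. h x \<noteq> 0 \<and> blinfun_apply \<pi> x = y - blinfun_apply \<pi> g}" by (auto simp: blinfun.diff_right)
    then show "x \<in> (+) g ` {x. h x \<noteq> 0 \<and> blinfun_apply \<pi> x = y - blinfun_apply \<pi> g}" by (rule image_eqI[rotated]) simp
  qed
  then show ?thesis using assms finite_subset unfolding fibre_finite_def by blast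
qed

lemma push_backward_diff:
  assumes "fibre_finite \<pi> h"
  shows "push \<pi> (backward_diff g h) = backward_diff (blinfun_apply \<pi> g) (push \<pi> h)"
    and "fibre_finite \<pi> (backward_diff g h)"
proof -
  have fin: "finite ({x. h x \<noteq> 0 \<and> blinfun_apply \<pi> x = y} \<union> {x. h (x - g) \<noteq> 0 \<and> blinfun_apply \<pi> x = y})" for y
    using assms fibre_finite_shift[OF assms] by (auto simp: fibre_finite_def)
  show "fibre_finite \<pi> (backward_diff g h)"
    unfolding fibre_finite_def backward_diff_def by (intro allI finite_subset[OF _ fin]) auto
  show "push \<pi> (backward_diff g h) = backward_diff (blinfun_apply \<pi> g) (push \<pi> h)"
  proof
    fix y
    let ?S = "{x. h x \<noteq> 0 \<and> blinfun_apply \<pi> x = y} \<union> {x. h (x - g) \<noteq> 0 \<and> blinfun_apply \<pi> x = y}"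
    have "push \<pi> (backward_diff g h) y = (\<Sum>x\<in>?S. h x - h (x - g))"
      unfolding backward_diff_def by (rule push_eq[OF fin]) auto
    also have "\<dots> = (\<Sum>x\<in>?S. h x) - (\<Sum>x\<in>?S. h (x - g))" by (rule sum_subtractf)
    also have "(\<Sum>x\<in>?S. h x) = push \<pi> h y" by (rule push_eq[OF fin, symmetric]) auto
    also have "(\<Sum>x\<in>?S. h (x - g)) = (\<Sum>x | h (x - g) \<noteq> 0 \<and> blinfun_apply \<pi> x = y. h (x - g))"
      by (rule sum.mono_neutral_right[OF fin]) auto
    also have "\<dots> = push \<pi> h (y - blinfun_apply \<pi> g)"
      unfolding push_def
      by (rule sum.reindex_bij_witness[of _ "\<lambda>x. x + g" "\<lambda>x. x - g"]) (auto simp: blinfun.diff_right blinfun.add_right)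
    finally show "push \<pi> (backward_diff g h) y = backward_diff (blinfun_apply \<pi> g) (push \<pi> h) y"
      by (simp add: backward_diff_def)
  qed
qed

text \<open>
  Summation over the fibres corresponds to restricting functionals to those that factor through \<open>\<pi>\<close>;
  it turns steps \<open>g\<close> into steps \<open>\<pi> g\<close>.
\<close>

lemma push_mixed_diff:
  assumes "fibre_finite \<pi> h"
  shows "push \<pi> (mixed_diff D h) = mixed_diff (image_mset (blinfun_apply \<pi>) D) (push \<pi> h) \<and> fibre_finite \<pi> (mixed_diff D h)"
  by (induction D) (auto simp: mixed_diff_add_mset push_backward_diff assms)

lemma fsupp_push: "fsupp h \<Longrightarrow> fsupp (push \<pi> h)"
proof -
  assume "fsupp h"
  moreover have "{y. push \<pi> h y \<noteq> 0} \<subseteq> blinfun_apply \<pi> ` {x. h x \<noteq> 0}"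
  proof
    fix y assume "y \<in> {y. push \<pi> h y \<noteq> 0}"
    then have "{x. h x \<noteq> 0 \<and> blinfun_apply \<pi> x = y} \<noteq> {}" unfolding push_def by (metis (mono_tags, lifting) mem_Collect_eq sum.empty)
    then show "y \<in> blinfun_apply \<pi> ` {x. h x \<noteq> 0}" by blast
  qed
  ultimately show ?thesis unfolding fsupp_def using finite_surj by blast
qed

lemma expsum_push:
  assumes "fsupp h"
  shows "expsum (push \<pi> h) \<eta> = expsum h (\<eta> o\<^sub>L \<pi>)"
proof -
  let ?S = "{x. h x \<noteq> 0}"
  have S: "finite ?S" using assms by (simp add: fsupp_def)
  have "expsum h (\<eta> o\<^sub>L \<pi>) = (\<Sum>x\<in>?S. of_real (h x) * exp (blinfun_apply \<eta> (blinfun_apply \<pi> x)))"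
    by (simp add: expsum_def)
  also have "\<dots> = (\<Sum>y\<in>blinfun_apply \<pi> ` ?S. \<Sum>x | x \<in> ?S \<and> blinfun_apply \<pi> x = y. of_real (h x) * exp (blinfun_apply \<eta> (blinfun_apply \<pi> x)))"
    by (rule sum.group[symmetric]) (use S in auto)
  also have "\<dots> = (\<Sum>y\<in>blinfun_apply \<pi> ` ?S. of_real (push \<pi> h y) * exp (blinfun_apply \<eta> y))"
    by (intro sum.cong refl) (auto simp: push_def sum_distrib_right)
  also have "\<dots> = expsum (push \<pi> h) \<eta>"
  proof (rule expsum_eq[symmetric])
    show "push \<pi> h y = 0" if "y \<notin> blinfun_apply \<pi> ` ?S" for y
    proof -
      have "{x. h x \<noteq> 0 \<and> blinfun_apply \<pi> x = y} = {}" using that by auto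
      then show ?thesis unfolding push_def by (simp only: sum.empty)
    qed
  qed (use S in auto)
  finally show ?thesis ..
qed

lemma den_image: "den (image_mset (blinfun_apply \<pi>) D) \<eta> = den D (\<eta> o\<^sub>L \<pi>)"
  by (simp add: den_def image_mset.compositionality o_def)

section \<open>Convex cones and unit boxes\<close>

lemma convex_cone_hull_sum:
  assumes "\<And>i. i \<in> A \<Longrightarrow> c i \<ge> 0" "\<And>i. i \<in> A \<Longrightarrow> g i \<in> G"
  shows "(\<Sum>i\<in>A. c i *\<^sub>R g i) \<in> convex_cone hull G"
  using assms
  by (induction A rule: infinite_finite_induct)
     (auto simp: convex_cone_hull_contains_0 hull_inc intro!: convex_cone_hull_add convex_cone_hull_mul)

text \<open>
  Both a half line and minus the complementary half line have the unit interval as their backward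
  difference: this is why flipping a generator does not change the generating function.
\<close>

definition half_line :: "bool \<Rightarrow> real \<Rightarrow> real" where
  "half_line pos t = (if pos then (if t \<ge> 0 then 1 else 0) else (if t \<ge> 0 then 0 else - 1))"

lemma half_line_diff: "half_line pos t - half_line pos (t - 1) = (if 0 \<le> t \<and> t < 1 then 1 else 0)"
  by (auto simp: half_line_def)

section \<open>Lattice generators of the edges\<close>

lemma (in simple_polytope_face) edge_generator:
  assumes L: "is_full_lattice L" and rat: "rational_polytope L p" and s: "s \<in> vertices p" and i: "i \<in> act s"
  obtains \<mu> where "\<mu> > 0" "\<mu> *\<^sub>R e s i \<in> L"
proof -
  have lat: "is_lattice L" using L by (simp add: is_full_lattice_def)
  obtain X where X: "X \<subseteq> rational_points L" "p = convex hull X" using rat unfolding rational_polytope_def by blast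
  have vr: "v \<in> rational_points L" if "v \<in> vertices p" for v
    using that X extreme_point_of_convex_hull[of v X] by (auto simp: vertices_def)
  obtain s' t where s': "s' \<in> vertices p" "t > 0" "s' - s = t *\<^sub>R e s i" by (rule neighbour_vertex[OF s i])
  obtain M N :: nat where M: "M > 0" "real M *\<^sub>R s \<in> L" and N: "N > 0" "real N *\<^sub>R s' \<in> L"
    using vr[OF s] vr[OF s'(1)] by (auto simp: rational_points_def)
  have "real_of_int (int M) *\<^sub>R (real N *\<^sub>R s') - real_of_int (int N) *\<^sub>R (real M *\<^sub>R s) \<in> L"
    by (intro lattice_diff[OF lat] lattice_scale[OF lat] M N)
  moreover have "real_of_int (int M) *\<^sub>R (real N *\<^sub>R s') - real_of_int (int N) *\<^sub>R (real M *\<^sub>R s) = (real M * real N) *\<^sub>R (s' - s)"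
    by (simp add: algebra_simps)
  ultimately have "(real M * real N * t) *\<^sub>R e s i \<in> L" using s'(3) by simp
  then show thesis using that[of "real M * real N * t"] M N s' by simp
qed

text \<open>
  Scaled edge directions can be chosen in \<open>L\<close> with the same scaling at all vertices of a facet, because
  the values of the facet normal on \<open>L\<close> are commensurable.
\<close>

lemma (in simple_polytope_face) common_edge_scaling:
  assumes L: "is_full_lattice L" and rat: "rational_polytope L p"
  shows "\<exists>\<mu>>0. \<forall>s\<in>vertices f. i \<in> act s \<longrightarrow> \<mu> *\<^sub>R e s i \<in> L"
proof (cases "\<exists>s0\<in>vertices f. i \<in> act s0")
  case False
  then show ?thesis by (intro exI[of _ 1]) auto
next
  case True
  then obtain s0 where s0: "s0 \<in> vertices p" "i \<in> act s0" by (auto simp: vertices_f)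
  have lat: "is_lattice L" using L by (simp add: is_full_lattice_def)
  obtain \<mu> where \<mu>: "\<mu> > 0" "\<mu> *\<^sub>R e s0 i \<in> L" by (rule edge_generator[OF L rat s0])
  have "\<exists>N::nat. N > 0 \<and> (real N * \<mu>) *\<^sub>R e s i \<in> L" if s: "s \<in> vertices f" "i \<in> act s" for s
  proof -
    have sp: "s \<in> vertices p" using s by (simp add: vertices_f)
    have "\<forall>k\<in>act s. \<exists>\<nu>>0. \<nu> *\<^sub>R e s k \<in> L" using edge_generator[OF L rat sp] by blast
    from bchoice[OF this] obtain \<nu> where \<nu>: "\<forall>k\<in>act s. \<nu> k > 0 \<and> \<nu> k *\<^sub>R e s k \<in> L" ..
    let ?g = "\<lambda>k. \<nu> k *\<^sub>R e s k"
    have sp': "\<exists>c. x = (\<Sum>k\<in>act s. c k *\<^sub>R ?g k)" for x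
    proof -
      have "x = (\<Sum>k\<in>act s. (- (a k \<bullet> x)) *\<^sub>R e s k)" by (rule expansion[OF sp])
      also have "\<dots> = (\<Sum>k\<in>act s. (- (a k \<bullet> x) / \<nu> k) *\<^sub>R ?g k)"
      proof (rule sum.cong[OF refl])
        fix k assume "k \<in> act s"
        then have "\<nu> k \<noteq> 0" using \<nu> by force
        then show "(- (a k \<bullet> x)) *\<^sub>R e s k = (- (a k \<bullet> x) / \<nu> k) *\<^sub>R ?g k" by simp
      qed
      finally show ?thesis by (rule exI[of _ "\<lambda>k. - (a k \<bullet> x) / \<nu> k"])
    qed
    have gL: "?g k \<in> L" if "k \<in> act s" for k using \<nu> that by blast
    obtain N :: nat and k :: "'i \<Rightarrow> int" where N: "N > 0" "real N *\<^sub>R (\<mu> *\<^sub>R e s0 i) = (\<Sum>l\<in>act s. real_of_int (k l) *\<^sub>R ?g l)"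
      by (rule lattice_multiple[OF lat finite_act gL sp' \<mu>(2)])
    have l1: "a i \<bullet> (real N *\<^sub>R (\<mu> *\<^sub>R e s0 i)) = - (real N * \<mu>)" using e_dual[OF s0 s0(2)] by simp
    have l2: "a i \<bullet> (\<Sum>l\<in>act s. real_of_int (k l) *\<^sub>R ?g l) = (\<Sum>l\<in>act s. if l = i then - (real_of_int (k i) * \<nu> i) else 0)"
      unfolding inner_sum_right using e_dual[OF sp _ s(2)] by (intro sum.cong) auto
    have "real N * \<mu> = real_of_int (k i) * \<nu> i"
      using trans[OF l1[unfolded N(2), symmetric] l2] s(2) by simp
    then have "(real N * \<mu>) *\<^sub>R e s i = real_of_int (k i) *\<^sub>R (\<nu> i *\<^sub>R e s i)" by simp
    also have "\<dots> \<in> L" using \<nu> s(2) by (intro lattice_scale[OF lat]) auto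
    finally show ?thesis using N(1) by blast
  qed
  then have "\<forall>s\<in>{s\<in>vertices f. i \<in> act s}. \<exists>N::nat. N > 0 \<and> (real N * \<mu>) *\<^sub>R e s i \<in> L" by auto
  from bchoice[OF this] obtain N :: "'a \<Rightarrow> nat" where 
    N: "\<forall>s\<in>{s\<in>vertices f. i \<in> act s}. N s > 0 \<and> (real (N s) * \<mu>) *\<^sub>R e s i \<in> L" ..
  let ?S = "{s\<in>vertices f. i \<in> act s}"
  have "(real (\<Prod>s\<in>?S. N s) * \<mu>) *\<^sub>R e s i \<in> L" if s: "s \<in> ?S" for s
  proof -
    have "(\<Prod>s\<in>?S. N s) = N s * (\<Prod>s\<in>?S - {s}. N s)" using s by (intro prod.remove) auto
    then have "(real (\<Prod>s\<in>?S. N s) * \<mu>) *\<^sub>R e s i = real_of_int (int (\<Prod>s\<in>?S - {s}. N s)) *\<^sub>R ((real (N s) * \<mu>) *\<^sub>R e s i)"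
      by (simp add: mult_ac)
    also have "\<dots> \<in> L" using N s by (intro lattice_scale[OF lat]) auto
    finally show ?thesis .
  qed
  moreover have "real (\<Prod>s\<in>?S. N s) * \<mu> > 0" using N \<mu>(1) by (intro mult_pos_pos) (auto intro!: prod_pos)
  ultimately show ?thesis by (intro exI[of _ "real (\<Prod>s\<in>?S. N s) * \<mu>"]) auto
qed

section \<open>The transverse cone\<close>

locale quotient_face = simple_polytope_face p f I a b
  for p f :: "'a::euclidean_space set" and I :: "'i set" and a b +
  fixes \<pi> :: "'a \<Rightarrow>\<^sub>L 'b::euclidean_space"
  assumes ker: "{x. blinfun_apply \<pi> x = 0} = lin f"
begin

lemma \<pi>_eq_0_iff: "blinfun_apply \<pi> x = 0 \<longleftrightarrow> (\<forall>j\<in>T. a j \<bullet> x = 0)"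
  using ker lin_eq by auto

lemma \<pi>_eq_iff: "blinfun_apply \<pi> x = blinfun_apply \<pi> y \<longleftrightarrow> (\<forall>j\<in>T. a j \<bullet> x = a j \<bullet> y)"
  using \<pi>_eq_0_iff[of "x - y"] by (simp add: blinfun.diff_right inner_diff_right)

text \<open>
  A linear section of \<open>\<pi>\<close> over its range, which may be a proper subspace.  Through it the normals of
  the facets containing \<open>f\<close> become functionals \<open>\<alpha> j\<close> on the quotient.
\<close>

definition \<sigma> :: "'b \<Rightarrow> 'a" where
  "\<sigma> = (SOME \<sigma>. linear \<sigma> \<and> (\<forall>x. blinfun_apply \<pi> (\<sigma> (blinfun_apply \<pi> x)) = blinfun_apply \<pi> x))"

lemma linear_\<sigma>: "linear \<sigma>" and \<pi>_\<sigma>: "blinfun_apply \<pi> (\<sigma> (blinfun_apply \<pi> x)) = blinfun_apply \<pi> x"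
proof -
  have "\<exists>\<sigma>. linear \<sigma> \<and> (\<forall>x. blinfun_apply \<pi> (\<sigma> (blinfun_apply \<pi> x)) = blinfun_apply \<pi> x)"
    using linear_exists_right_inverse_on[OF bounded_linear.linear[OF blinfun.bounded_linear_right[of \<pi>]] subspace_UNIV] by blast
  then have "linear \<sigma> \<and> (\<forall>x. blinfun_apply \<pi> (\<sigma> (blinfun_apply \<pi> x)) = blinfun_apply \<pi> x)"
    unfolding \<sigma>_def by (rule someI_ex)
  then show "linear \<sigma>" "blinfun_apply \<pi> (\<sigma> (blinfun_apply \<pi> x)) = blinfun_apply \<pi> x" by auto
qed

definition \<alpha> :: "'i \<Rightarrow> 'b \<Rightarrow> real" where "\<alpha> j y = a j \<bullet> \<sigma> y"

lemma bounded_linear_\<alpha>: "bounded_linear (\<alpha> j)"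
  unfolding \<alpha>_def[abs_def]
  by (rule bounded_linear_compose[OF bounded_linear_inner_right linear_conv_bounded_linear[THEN iffD1, OF linear_\<sigma>]])

lemma \<alpha>_\<pi>: "j \<in> T \<Longrightarrow> \<alpha> j (blinfun_apply \<pi> x) = a j \<bullet> x"
  using \<pi>_\<sigma>[of x] unfolding \<pi>_eq_iff \<alpha>_def by blast

lemma tangent_cone_fibre:
  "blinfun_apply \<pi> x \<in> blinfun_apply \<pi> ` tangent_cone p f \<longleftrightarrow> (\<forall>j\<in>T. a j \<bullet> x \<le> b j)"
  unfolding tangent_cone_face by (auto simp: \<pi>_eq_iff image_iff)

text \<open>
  The neighbourhood of the apex in which the slices keep the combinatorial type of \<open>f\<close> depends on
  \<open>p\<close>, \<open>f\<close> and \<open>\<pi>\<close> only.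
\<close>

lemma near_vertex_image:
  obtains \<epsilon> where "\<epsilon> > 0" "\<And>x z s. \<forall>j\<in>T. a j \<bullet> x \<le> b j \<Longrightarrow> z \<in> f \<Longrightarrow> dist (blinfun_apply \<pi> x) (blinfun_apply \<pi> z) < \<epsilon> \<Longrightarrow>
    s \<in> vertices f \<Longrightarrow> vertex_shift s x \<in> p"
proof -
  obtain \<delta> where \<delta>: "\<delta> > 0" "\<And>x s. s \<in> vertices f \<Longrightarrow> (\<And>j. j \<in> T \<Longrightarrow> a j \<bullet> x \<le> b j \<and> b j - a j \<bullet> x < \<delta>) \<Longrightarrow> vertex_shift s x \<in> p"
    using vertex_shift_near by blast
  have "\<exists>C\<ge>0. \<forall>y. \<bar>\<alpha> j y\<bar> \<le> norm y * C" for j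
    using bounded_linear.nonneg_bounded[OF bounded_linear_\<alpha>] by auto
  then obtain C where C: "\<And>j. C j \<ge> 0" "\<And>j y. \<bar>\<alpha> j y\<bar> \<le> norm y * C j" by metis
  obtain \<epsilon> where \<epsilon>: "\<epsilon> > 0" "\<forall>j\<in>T. \<epsilon> * \<bar>C j\<bar> < \<delta>"
    using small_step[of T "\<lambda>_. \<delta>" C] \<delta>(1) by auto
  have "vertex_shift s x \<in> p" if x: "\<forall>j\<in>T. a j \<bullet> x \<le> b j" and z: "z \<in> f" 
      and d: "dist (blinfun_apply \<pi> x) (blinfun_apply \<pi> z) < \<epsilon>" and s: "s \<in> vertices f" for x z s
  proof (rule \<delta>(2)[OF s])
    fix j assume j: "j \<in> T"
    have "b j - a j \<bullet> x = \<alpha> j (blinfun_apply \<pi> (z - x))" using z j by (simp add: \<alpha>_\<pi> f_iff inner_diff_right)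
    also have "\<dots> \<le> norm (blinfun_apply \<pi> (z - x)) * C j" using C(2)[of j "blinfun_apply \<pi> (z - x)"] by linarith
    also have "\<dots> \<le> \<epsilon> * C j" using d C(1) by (intro mult_right_mono) (auto simp: dist_norm blinfun.diff_right norm_minus_commute)
    also have "\<dots> < \<delta>" using \<epsilon>(2) j C(1)[of j] by auto
    finally show "a j \<bullet> x \<le> b j \<and> b j - a j \<bullet> x < \<delta>" using x j by simp
  qed
  then show thesis using that[OF \<epsilon>(1)] by blast
qed

end

lemma in_sum_multisets: "finite A \<Longrightarrow> x \<in># (\<Sum>i\<in>A. M i) \<longleftrightarrow> (\<exists>i\<in>A. x \<in># M i)"
  by (induction A rule: finite_induct) auto

text \<open>
  The factor \<open>lam i\<close> scaling an edge direction into the lattice depends on the facet only.  Thus the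
  scaled edges that leave the same facet at different vertices agree modulo \<open>lin f\<close>.
\<close>

locale lattice_face = quotient_face p f I a b \<pi>
  for p f :: "'a::euclidean_space set" and I :: "'i set" and a b and \<pi> :: "'a \<Rightarrow>\<^sub>L 'b::euclidean_space" +
  fixes L :: "'a set" and lam :: "'i \<Rightarrow> real"
  assumes lattice: "is_lattice L"
    and lam_pos: "lam i > 0"
    and lam_e: "s \<in> vertices f \<Longrightarrow> i \<in> act s \<Longrightarrow> lam i *\<^sub>R e s i \<in> L"
begin

definition g :: "'a \<Rightarrow> 'i \<Rightarrow> 'a" where "g s i = lam i *\<^sub>R e s i"

text \<open>
  At each vertex \<open>s\<close> of \<open>f\<close> the \<open>t i\<close> with \<open>i\<close> in \<open>act s\<close> are the coordinates with origin \<open>s\<close> and basis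
  \<open>g s i\<close>.
\<close>

definition t :: "'i \<Rightarrow> 'a \<Rightarrow> real" where "t i x = (b i - a i \<bullet> x) / lam i"

lemma T_actD: "s \<in> vertices f \<Longrightarrow> j \<in> T \<Longrightarrow> j \<in> act s"
  using T_act by blast

lemma vertex_p: "s \<in> vertices f \<Longrightarrow> s \<in> vertices p"
  by (simp add: vertices_f)

lemma g_L: "s \<in> vertices f \<Longrightarrow> i \<in> act s \<Longrightarrow> g s i \<in> L"
  by (simp add: g_def lam_e)

lemma lam_nonzero [simp]: "lam i \<noteq> 0"
  using lam_pos[of i] by simp

lemma a_g: "s \<in> vertices f \<Longrightarrow> i \<in> act s \<Longrightarrow> j \<in> act s \<Longrightarrow> a j \<bullet> g s i = (if j = i then - lam i else 0)"
  using e_dual[OF vertex_p] by (simp add: g_def)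

lemma g_nonzero: "s \<in> vertices f \<Longrightarrow> i \<in> act s \<Longrightarrow> g s i \<noteq> 0"
  using e_nonzero[OF vertex_p] by (simp add: g_def)

lemma t_nonneg_iff: "0 \<le> t i x \<longleftrightarrow> a i \<bullet> x \<le> b i"
  using lam_pos[of i] by (simp add: t_def zero_le_divide_iff)

lemma t_shift: "s \<in> vertices f \<Longrightarrow> i \<in> act s \<Longrightarrow> l \<in> act s \<Longrightarrow> t i (x - g s l) = t i x - (if i = l then 1 else 0)"
  using a_g[of s l i] by (auto simp: t_def inner_diff_right field_simps)

lemma coordinates: 
  assumes "s \<in> vertices f" shows "x = s + (\<Sum>i\<in>act s. t i x *\<^sub>R g s i)"
  using vertex_expansion[OF vertex_p[OF assms], of x] by (simp add: t_def g_def)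

lemma bounded_coordinates:
  assumes "s \<in> vertices f" "\<And>x i. x \<in> S \<Longrightarrow> i \<in> act s \<Longrightarrow> \<bar>t i x\<bar> \<le> R"
  shows "bounded S"
  unfolding bounded_iff
proof (intro exI[of _ "norm s + (\<Sum>i\<in>act s. R * norm (g s i))"] ballI)
  fix x assume x: "x \<in> S"
  have "norm (\<Sum>i\<in>act s. t i x *\<^sub>R g s i) \<le> (\<Sum>i\<in>act s. R * norm (g s i))"
    using assms(2)[OF x] by (intro sum_norm_le) (auto intro!: mult_right_mono)
  then have "norm (s + (\<Sum>i\<in>act s. t i x *\<^sub>R g s i)) \<le> norm s + (\<Sum>i\<in>act s. R * norm (g s i))"
    by (intro norm_triangle_mono) auto
  then show "norm x \<le> norm s + (\<Sum>i\<in>act s. R * norm (g s i))"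
    using coordinates[OF assms(1), of x] by simp
qed

definition ind :: "'a \<Rightarrow> real" where "ind x = (if x \<in> L then 1 else 0)"

lemma ind_shift: "v \<in> L \<Longrightarrow> ind (x - v) = ind x"
  by (simp add: ind_def lattice_minus_cancel[OF lattice])

definition edge_steps :: "'a \<Rightarrow> 'a multiset" where "edge_steps s = image_mset (g s) (mset_set (act s))"

lemma mixed_diff_halflines:
  assumes s: "s \<in> vertices f" and A: "A \<subseteq> act s" and k: "\<And>i x. i \<in> A \<Longrightarrow> k (x - g s i) = k x"
  shows "mixed_diff (image_mset (g s) (mset_set A)) (\<lambda>x. k x * (\<Prod>i\<in>A. half_line (pos i) (t i x)))
    = (\<lambda>x. k x * (\<Prod>i\<in>A. if 0 \<le> t i x \<and> t i x < 1 then 1 else 0))"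
proof -
  have "mixed_diff (image_mset (g s) (mset_set A)) (\<lambda>x. k x * (\<Prod>i\<in>A. (\<lambda>i. half_line (pos i)) i (t i x)))
    = (\<lambda>x. k x * (\<Prod>i\<in>A. half_line (pos i) (t i x) - half_line (pos i) (t i x - 1)))"
    using A by (intro mixed_diff_product k) (auto simp: t_shift[OF s] subset_iff intro: finite_subset[OF A])
  then show ?thesis by (simp only: half_line_diff)
qed

lemma prod_indicator: "finite A \<Longrightarrow> (\<Prod>i\<in>A. if Q i then 1 else 0 :: real) = (if \<forall>i\<in>A. Q i then 1 else 0)"
  by (induction A rule: finite_induct) auto

definition vertex_cone :: "'a \<Rightarrow> 'a \<Rightarrow> real" where
  "vertex_cone s x = (if x \<in> L \<inter> tangent_cone p {s} then 1 else 0)"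

text \<open>
  The numerator of the generating function of the vertex cone: the lattice points of the half-open
  fundamental box.
\<close>

definition unit_box :: "'a \<Rightarrow> 'a \<Rightarrow> real" where
  "unit_box s x = ind x * (\<Prod>i\<in>act s. if 0 \<le> t i x \<and> t i x < 1 then 1 else 0)"

lemma vertex_cone_eq:
  assumes "s \<in> vertices f" shows "vertex_cone s x = ind x * (\<Prod>i\<in>act s. half_line True (t i x))"
  unfolding half_line_def using tangent_cone_vertex[OF vertex_p[OF assms]]
  by (simp add: vertex_cone_def ind_def prod_indicator t_nonneg_iff)

lemma mixed_diff_vertex_cone:
  assumes s: "s \<in> vertices f" shows "mixed_diff (edge_steps s) (vertex_cone s) = unit_box s"
  unfolding edge_steps_def unit_box_def[abs_def] vertex_cone_eq[OF s, abs_def]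
  by (rule mixed_diff_halflines[OF s subset_refl]) (simp add: ind_shift g_L[OF s])

lemma fsupp_unit_box:
  assumes s: "s \<in> vertices f" shows "fsupp (unit_box s)"
proof (rule fsupp_lattice[OF lattice])
  show "bounded {x. \<forall>i\<in>act s. \<bar>t i x\<bar> \<le> 1}" by (rule bounded_coordinates[OF s]) auto
  show "x \<in> L \<and> x \<in> {x. \<forall>i\<in>act s. \<bar>t i x\<bar> \<le> 1}" if "unit_box s x \<noteq> 0" for x
    using that unfolding unit_box_def prod_indicator[OF finite_act] by (fastforce simp: ind_def split: if_splits)
qed

lemma tangent_cone_generators:
  assumes s: "s \<in> vertices f"
  shows "tangent_cone p {s} = (+) s ` (convex_cone hull (g s ` act s))"
proof (intro equalityI subsetI)
  fix x assume "x \<in> tangent_cone p {s}"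
  then have "\<forall>i\<in>act s. 0 \<le> t i x" using tangent_cone_vertex[OF vertex_p[OF s]] by (simp add: t_nonneg_iff)
  then have "(\<Sum>i\<in>act s. t i x *\<^sub>R g s i) \<in> convex_cone hull (g s ` act s)"
    by (intro convex_cone_hull_sum) auto
  then show "x \<in> (+) s ` (convex_cone hull (g s ` act s))" using coordinates[OF s, of x] by blast
next
  fix x assume "x \<in> (+) s ` (convex_cone hull (g s ` act s))"
  then obtain v where v: "v \<in> convex_cone hull (g s ` act s)" "x = s + v" by blast
  have cc: "convex_cone {v. \<forall>i\<in>act s. a i \<bullet> v \<le> 0}"
    unfolding convex_cone_iff by (auto simp: inner_add_right mult_nonneg_nonpos intro: add_nonpos_nonpos)
  have "convex_cone hull (g s ` act s) \<subseteq> {v. \<forall>i\<in>act s. a i \<bullet> v \<le> 0}"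
    using a_g[OF s] lam_pos less_imp_le by (intro hull_minimal cc) (auto simp: less_imp_le)
  then have "\<forall>i\<in>act s. a i \<bullet> x \<le> b i" using v by (auto simp: inner_add_right act_def)
  then show "x \<in> tangent_cone p {s}" using tangent_cone_vertex[OF vertex_p[OF s]] by simp
qed

lemma vertex_cone_represented:
  assumes s: "s \<in> vertices f"
  shows "exp_sum_represents L (tangent_cone p {s}) (\<lambda>_. 1) (\<lambda>\<xi>. expsum (unit_box s) \<xi> / den (edge_steps s) \<xi>)"
proof -
  have "exp_sum_represents L (tangent_cone p {s}) (\<lambda>_. 1) 
     (\<lambda>\<xi>. expsum (mixed_diff (edge_steps s) (\<lambda>x. if x \<in> L \<inter> tangent_cone p {s} then 1 else 0)) \<xi> / den (edge_steps s) \<xi>)"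
  proof (rule exp_sum_representsI[OF quasi_polynomial_on_const[OF lattice] _ _ tangent_cone_generators[OF s]])
    show "g s ` act s \<subseteq> L - {0}" using g_L[OF s] g_nonzero[OF s] by auto
    show "fsupp (mixed_diff (edge_steps s) (\<lambda>x. if x \<in> L \<inter> tangent_cone p {s} then 1 else 0))"
      using mixed_diff_vertex_cone[OF s] fsupp_unit_box[OF s] by (simp add: vertex_cone_def[abs_def])
  qed (auto simp: edge_steps_def)
  then show ?thesis using mixed_diff_vertex_cone[OF s] by (simp add: vertex_cone_def[abs_def])
qed

text \<open>
  \<open>total\<close> is \<open>\<Psi>\<close> on the lattice points of the tangent cone to \<open>p\<close> at \<open>f\<close>.  Differencing it only along the
  transverse edges already leaves a finitely supported function.
\<close>

definition total :: "'a \<Rightarrow> real" where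
  "total x = (if x \<in> L \<and> (\<forall>j\<in>T. a j \<bullet> x \<le> b j) then \<Psi> x else 0)"

definition flipped :: "'a \<Rightarrow> 'a \<Rightarrow> 'a \<Rightarrow> real" where
  "flipped \<beta> s x = ind x * (\<Prod>i\<in>act s. half_line (i \<in> T \<or> \<beta> \<bullet> e s i > 0) (t i x))"

lemma flip_sign_half_line: "flip_sign \<beta> s i x = half_line (\<beta> \<bullet> e s i > 0) (t i x)"
  by (simp add: flip_sign_def half_line_def t_nonneg_iff)

lemma prod_act_split: "s \<in> vertices f \<Longrightarrow> (\<Prod>i\<in>act s. F i) = (\<Prod>i\<in>act s - T. F i) * (\<Prod>i\<in>T. F i)"
  by (rule prod.subset_diff[OF T_act finite_act])

lemma flipped_split:
  assumes s: "s \<in> vertices f"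
  shows "flipped \<beta> s x = ind x * (\<Prod>i\<in>act s - T. flip_sign \<beta> s i x) * (\<Prod>i\<in>T. half_line True (t i x))"
proof -
  have "(\<Prod>i\<in>act s - T. half_line (i \<in> T \<or> \<beta> \<bullet> e s i > 0) (t i x)) = (\<Prod>i\<in>act s - T. flip_sign \<beta> s i x)"
    by (intro prod.cong) (auto simp: flip_sign_half_line)
  moreover have "(\<Prod>i\<in>T. half_line (i \<in> T \<or> \<beta> \<bullet> e s i > 0) (t i x)) = (\<Prod>i\<in>T. half_line True (t i x))"
    by (intro prod.cong) auto
  ultimately show ?thesis unfolding flipped_def prod_act_split[OF s] by simp
qed

lemma total_eq_flipped:
  assumes "generic \<beta>"
  shows "total = (\<lambda>x. \<Sum>s\<in>vertices f. flipped \<beta> s x)"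
proof
  fix x
  have T: "(\<Prod>i\<in>T. half_line True (t i x)) = (if \<forall>j\<in>T. a j \<bullet> x \<le> b j then 1 else 0)"
    unfolding half_line_def by (simp add: prod_indicator t_nonneg_iff)
  have "(\<Sum>s\<in>vertices f. flipped \<beta> s x) = (\<Sum>s\<in>vertices f. ind x * (if \<forall>j\<in>T. a j \<bullet> x \<le> b j then 1 else 0) * (\<Prod>i\<in>act s - T. flip_sign \<beta> s i x))"
    by (intro sum.cong) (auto simp: flipped_split T)
  also have "\<dots> = ind x * (if \<forall>j\<in>T. a j \<bullet> x \<le> b j then 1 else 0) * \<Psi> x"
    unfolding \<Psi>_eq_flipped_cones[OF assms] by (rule sum_distrib_left[symmetric])
  finally show "total x = (\<Sum>s\<in>vertices f. flipped \<beta> s x)" by (simp add: total_def ind_def)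
qed

lemma mixed_diff_flipped:
  assumes s: "s \<in> vertices f" shows "mixed_diff (edge_steps s) (flipped \<beta> s) = unit_box s"
  unfolding edge_steps_def unit_box_def[abs_def] flipped_def[abs_def]
  by (rule mixed_diff_halflines[OF s subset_refl]) (simp add: ind_shift g_L[OF s])

definition transverse_steps :: "'a multiset" where
  "transverse_steps = (\<Sum>s\<in>vertices f. image_mset (g s) (mset_set T))"

definition face_steps :: "'a multiset" where
  "face_steps = (\<Sum>s\<in>vertices f. image_mset (g s) (mset_set (act s - T)))"

lemma in_transverse_steps: "v \<in># transverse_steps \<longleftrightarrow> (\<exists>s\<in>vertices f. \<exists>j\<in>T. v = g s j)"
  unfolding transverse_steps_def by (subst in_sum_multisets) auto

lemma in_face_steps: "v \<in># face_steps \<longleftrightarrow> (\<exists>s\<in>vertices f. \<exists>j\<in>act s - T. v = g s j)"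
  unfolding face_steps_def by (subst in_sum_multisets) auto

lemma edge_steps_split: 
  assumes "s \<in> vertices f" 
  shows "edge_steps s = image_mset (g s) (mset_set T) + image_mset (g s) (mset_set (act s - T))"
proof -
  have "mset_set (act s) = mset_set T + mset_set (act s - T)"
    using T_act[OF assms] by (subst mset_set_Union[symmetric]) (auto simp: Un_absorb1)
  then show ?thesis by (simp add: edge_steps_def)
qed

lemma all_steps: "(\<Sum>s\<in>vertices f. edge_steps s) = transverse_steps + face_steps"
  unfolding transverse_steps_def face_steps_def sum.distrib[symmetric]
  by (intro sum.cong) (auto simp: edge_steps_split)

text \<open>
  Bounded transverse coordinates keep the shifted vertices in a bounded set, and \<open>\<Psi>\<close> is supported in
  their convex hull.
\<close>

lemma bounded_\<Psi>:
  "bounded {x. \<Psi> x \<noteq> 0 \<and> (\<forall>j\<in>T. \<bar>t j x\<bar> \<le> R)}"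
proof -
  define M where "M = (\<Sum>s\<in>vertices f. norm s + (\<Sum>j\<in>T. R * norm (g s j)))"
  have "norm x \<le> M" if x: "\<Psi> x \<noteq> 0" "\<forall>j\<in>T. \<bar>t j x\<bar> \<le> R" for x
  proof -
    have nn: "0 \<le> norm s + (\<Sum>j\<in>T. R * norm (g s j))" for s
      using x(2) by (intro add_nonneg_nonneg sum_nonneg mult_nonneg_nonneg) (auto intro: order_trans[OF abs_ge_zero])
    have "norm (vertex_shift s x) \<le> M" if s: "s \<in> vertices f" for s
    proof -
      have "vertex_shift s x = s + (\<Sum>j\<in>T. t j x *\<^sub>R g s j)" by (simp add: vertex_shift_def t_def g_def)
      also have "norm \<dots> \<le> norm s + (\<Sum>j\<in>T. R * norm (g s j))"
        using x(2) by (intro norm_triangle_mono sum_norm_le) (auto intro!: mult_right_mono)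
      also have "\<dots> \<le> M" unfolding M_def using s nn by (intro member_le_sum) auto
      finally show ?thesis .
    qed
    then have "(\<lambda>s. vertex_shift s x) ` vertices f \<subseteq> cball 0 M" by auto
    then have "convex hull ((\<lambda>s. vertex_shift s x) ` vertices f) \<subseteq> cball 0 M" by (intro hull_minimal) auto
    then show ?thesis using \<Psi>_support[OF x(1)] by auto
  qed
  then show ?thesis unfolding bounded_iff by blast
qed

lemma steps_L: "set_mset transverse_steps \<subseteq> L" "set_mset face_steps \<subseteq> L"
  using T_actD g_L by (auto simp: in_transverse_steps in_face_steps)

text \<open>
  Along each transverse direction \<open>j\<close> every flipped cone contributes a step \<open>g s j\<close> of its own, which
  bounds its \<open>j\<close>-th coordinate; the steps of the other vertices only enlarge the bound.  Over the
  resulting bounded set of slices the function \<open>\<Psi>\<close> has bounded support.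
\<close>

lemma fsupp_transverse: "fsupp (mixed_diff transverse_steps total)"
proof -
  obtain \<beta> where gen: "generic \<beta>" using generic_exists[of 1 0] by auto
  \<comment> \<open>The differences are supported where the transverse coordinates are bounded.\<close>
  have supp: "\<exists>R. \<forall>x. mixed_diff transverse_steps (flipped \<beta> s) x \<noteq> 0 \<longrightarrow> (\<forall>j\<in>T. \<bar>t j x\<bar> \<le> R)" if s: "s \<in> vertices f" for s
  proof -
    define k where "k x = ind x * (\<Prod>i\<in>act s - T. flip_sign \<beta> s i x)" for x
    have k: "k (x - g s j) = k x" if j: "j \<in> T" for j x
    proof -
      have "flip_sign \<beta> s i (x - g s j) = flip_sign \<beta> s i x" if "i \<in> act s - T" for i
        using that j T_act[OF s] t_shift[OF s, of i j x] by (auto simp: flip_sign_half_line)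
      then have "(\<Prod>i\<in>act s - T. flip_sign \<beta> s i (x - g s j)) = (\<Prod>i\<in>act s - T. flip_sign \<beta> s i x)"
        by (intro prod.cong) auto
      moreover have "g s j \<in> L" using j T_act[OF s] g_L[OF s] by blast
      ultimately show ?thesis by (simp add: k_def ind_shift)
    qed
    have fl: "flipped \<beta> s = (\<lambda>x. k x * (\<Prod>i\<in>T. half_line True (t i x)))"
      by (intro ext) (simp only: flipped_split[OF s] k_def)
    have d: "mixed_diff (image_mset (g s) (mset_set T)) (flipped \<beta> s) = (\<lambda>x. k x * (\<Prod>i\<in>T. if 0 \<le> t i x \<and> t i x < 1 then 1 else 0))"
      unfolding fl by (rule mixed_diff_halflines[OF s T_act[OF s] k])
    define rest where "rest = (\<Sum>s\<in>vertices f - {s}. image_mset (g s) (mset_set T))"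
    have split: "transverse_steps = image_mset (g s) (mset_set T) + rest"
      unfolding transverse_steps_def rest_def using s by (intro sum.remove) auto
    obtain R where R: "\<forall>v\<in>subsums rest. \<forall>j\<in>T. \<bar>a j \<bullet> v / lam j\<bar> \<le> R"
    proof -
      have "finite ((\<lambda>(v, j). \<bar>a j \<bullet> v / lam j\<bar>) ` (subsums rest \<times> T))" by (intro finite_imageI finite_cartesian_product finite_subsums finite_T)
      from bdd_above_finite[OF this] obtain R where "\<forall>r\<in>(\<lambda>(v, j). \<bar>a j \<bullet> v / lam j\<bar>) ` (subsums rest \<times> T). r \<le> R"
        unfolding bdd_above_def by blast
      then show thesis by (intro that[of R]) auto
    qed
    have "\<bar>t j x\<bar> \<le> 1 + R" if x: "mixed_diff transverse_steps (flipped \<beta> s) x \<noteq> 0" and j: "j \<in> T" for x j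
    proof -
      obtain v where v: "v \<in> subsums rest" "mixed_diff (image_mset (g s) (mset_set T)) (flipped \<beta> s) (x - v) \<noteq> 0"
        using x unfolding split mixed_diff_union by (rule mixed_diff_nonzeroE)
      have "0 \<le> t j (x - v) \<and> t j (x - v) < 1"
        using v(2) j unfolding d prod_indicator[OF finite_T] by (auto split: if_splits)
      moreover have "t j (x - v) = t j x + a j \<bullet> v / lam j" by (simp add: t_def inner_diff_right field_simps)
      moreover have "\<bar>a j \<bullet> v / lam j\<bar> \<le> R" using R v(1) j by blast
      ultimately show ?thesis by linarith
    qed
    then show ?thesis by blast
  qed
  then have "\<forall>s\<in>vertices f. \<exists>R. \<forall>x. mixed_diff transverse_steps (flipped \<beta> s) x \<noteq> 0 \<longrightarrow> (\<forall>j\<in>T. \<bar>t j x\<bar> \<le> R)" by blast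
  from bchoice[OF this] obtain Rs where Rs: "\<forall>s\<in>vertices f. \<forall>x. mixed_diff transverse_steps (flipped \<beta> s) x \<noteq> 0 \<longrightarrow> (\<forall>j\<in>T. \<bar>t j x\<bar> \<le> Rs s)" ..
  define R where "R = (\<Sum>s\<in>vertices f. \<bar>Rs s\<bar>)"
  have R: "\<bar>t j x\<bar> \<le> R" if x: "mixed_diff transverse_steps total x \<noteq> 0" and j: "j \<in> T" for x j
  proof -
    have "(\<Sum>s\<in>vertices f. mixed_diff transverse_steps (flipped \<beta> s) x) \<noteq> 0"
      using x unfolding total_eq_flipped[OF gen] mixed_diff_sum .
    then obtain s where s: "s \<in> vertices f" "mixed_diff transverse_steps (flipped \<beta> s) x \<noteq> 0"
      by (rule sum.not_neutral_contains_not_neutral)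
    then have "\<bar>t j x\<bar> \<le> \<bar>Rs s\<bar>" using Rs j by (meson abs_ge_self order_trans)
    also have "\<dots> \<le> R" unfolding R_def using s(1) by (intro member_le_sum) auto
    finally show ?thesis .
  qed
  let ?V = "subsums transverse_steps"
  obtain R' where R': "\<forall>v\<in>?V. \<forall>j\<in>T. \<bar>a j \<bullet> v / lam j\<bar> \<le> R'"
  proof -
    have "finite ((\<lambda>(v, j). \<bar>a j \<bullet> v / lam j\<bar>) ` (?V \<times> T))" by (intro finite_imageI finite_cartesian_product finite_subsums finite_T)
    from bdd_above_finite[OF this] obtain R where "\<forall>r\<in>(\<lambda>(v, j). \<bar>a j \<bullet> v / lam j\<bar>) ` (?V \<times> T). r \<le> R"
      unfolding bdd_above_def by blast
    then show thesis by (intro that[of R]) auto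
  qed
  define S where "S = {x. \<Psi> x \<noteq> 0 \<and> (\<forall>j\<in>T. \<bar>t j x\<bar> \<le> R + R')}"
  have "bounded (\<Union>v\<in>?V. (+) v ` S)"
    using finite_subsums bounded_\<Psi> unfolding S_def by (intro bounded_UN) (auto intro: bounded_translation)
  moreover have "x \<in> L \<and> x \<in> (\<Union>v\<in>?V. (+) v ` S)" if x: "mixed_diff transverse_steps total x \<noteq> 0" for x
  proof
    show "x \<in> L"
    proof (rule ccontr)
      assume "x \<notin> L"
      have "mixed_diff transverse_steps total x = 0"
        by (rule mixed_diff_supported[OF _ lattice_zero[OF lattice] steps_L(1) _ \<open>x \<notin> L\<close>])
           (auto simp: total_def intro: lattice_add[OF lattice])
      then show False using x by simp
    qed
    obtain v where v: "v \<in> ?V" "total (x - v) \<noteq> 0" using x by (rule mixed_diff_nonzeroE)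
    have "\<Psi> (x - v) \<noteq> 0" using v(2) by (auto simp: total_def split: if_splits)
    moreover have "\<bar>t j (x - v)\<bar> \<le> R + R'" if j: "j \<in> T" for j
    proof -
      have "t j (x - v) = t j x + a j \<bullet> v / lam j" by (simp add: t_def inner_diff_right field_simps)
      moreover have "\<bar>a j \<bullet> v / lam j\<bar> \<le> R'" using R' v(1) j by blast
      ultimately show ?thesis using R[OF x j] by linarith
    qed
    ultimately have "x - v \<in> S" by (auto simp: S_def)
    then have "x \<in> (+) v ` S" by (rule image_eqI[rotated]) simp
    then show "x \<in> (\<Union>v\<in>?V. (+) v ` S)" using v(1) by blast
  qed
  ultimately show ?thesis by (rule fsupp_lattice[OF lattice])
qed

text \<open>The sum of the generating functions of the vertex cones, written without the poles along \<open>f\<close>.\<close>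

definition numerator :: "'a \<Rightarrow> real" where "numerator = mixed_diff transverse_steps total"

definition G :: "('a \<Rightarrow>\<^sub>L complex) \<Rightarrow> complex" where
  "G \<xi> = expsum numerator \<xi> / den transverse_steps \<xi>"

text \<open>
  Multiply by all denominators.  Differencing a flipped cone along the edges at its own vertex gives
  the same box as the vertex cone, so both sides are the exponential sum of \<open>total\<close> differenced along
  the edges at all vertices.
\<close>

lemma sum_vertex_cones:
  assumes "\<And>s i. s \<in> vertices f \<Longrightarrow> i \<in> act s \<Longrightarrow> exp (blinfun_apply \<xi> (g s i)) \<noteq> 1"
  shows "(\<Sum>s\<in>vertices f. expsum (unit_box s) \<xi> / den (edge_steps s) \<xi>) = G \<xi>"
proof -
  obtain \<beta> where gen: "generic \<beta>" using generic_exists[of 1 0] by auto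
  define all where "all = (\<Sum>s\<in>vertices f. edge_steps s)"
  define rest where "rest s = (\<Sum>s'\<in>vertices f - {s}. edge_steps s')" for s
  have all1: "all = edge_steps s + rest s" if "s \<in> vertices f" for s
    unfolding all_def rest_def using that by (intro sum.remove) auto
  have all2: "all = transverse_steps + face_steps" unfolding all_def by (rule all_steps)
  have nz: "den all \<xi> \<noteq> 0"
    unfolding all2 den_union using assms T_actD by (auto simp: den_eq_0_iff in_transverse_steps in_face_steps)
  have "mixed_diff all total = (\<lambda>x. \<Sum>s\<in>vertices f. mixed_diff all (flipped \<beta> s) x)"
    unfolding total_eq_flipped[OF gen] mixed_diff_sum ..
  also have "\<dots> = (\<lambda>x. \<Sum>s\<in>vertices f. mixed_diff (rest s) (unit_box s) x)"
    by (intro ext sum.cong refl) (simp add: all1 mixed_diff_union mixed_diff_flipped)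
  finally have m: "mixed_diff all total = (\<lambda>x. \<Sum>s\<in>vertices f. mixed_diff (rest s) (unit_box s) x)" .
  have "expsum (mixed_diff all total) \<xi> = (\<Sum>s\<in>vertices f. expsum (mixed_diff (rest s) (unit_box s)) \<xi>)"
    unfolding m by (rule expsum_sum) (auto intro: fsupp_mixed_diff fsupp_unit_box)
  also have "\<dots> = (\<Sum>s\<in>vertices f. den (rest s) \<xi> * expsum (unit_box s) \<xi>)"
    by (intro sum.cong refl expsum_mixed_diff fsupp_unit_box)
  also have "\<dots> = (\<Sum>s\<in>vertices f. den all \<xi> * (expsum (unit_box s) \<xi> / den (edge_steps s) \<xi>))"
  proof (intro sum.cong refl)
    fix s assume s: "s \<in> vertices f"
    then have "den (edge_steps s) \<xi> \<noteq> 0" using nz unfolding all1[OF s] den_union by auto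
    then show "den (rest s) \<xi> * expsum (unit_box s) \<xi> = den all \<xi> * (expsum (unit_box s) \<xi> / den (edge_steps s) \<xi>)"
      unfolding all1[OF s] den_union by simp
  qed
  finally have 1: "expsum (mixed_diff all total) \<xi> = den all \<xi> * (\<Sum>s\<in>vertices f. expsum (unit_box s) \<xi> / den (edge_steps s) \<xi>)"
    by (simp add: sum_distrib_left)
  have "mixed_diff all total = mixed_diff face_steps numerator"
    unfolding all2 mixed_diff_union numerator_def ..
  then have "expsum (mixed_diff all total) \<xi> = den face_steps \<xi> * expsum numerator \<xi>"
    using expsum_mixed_diff[OF fsupp_transverse, of face_steps \<xi>] by (simp add: numerator_def)
  also have "\<dots> = den all \<xi> * G \<xi>"
    using nz unfolding G_def all2 den_union by auto
  finally show ?thesis using 1 nz by simp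
qed

text \<open>
  Each \<open>cone_gf\<close> is determined by the sum it represents only off some hyperplanes, which may be more
  than the poles of the explicit quotient.
\<close>

lemma vertex_cone_sum_eq:
  obtains C where "finite C" "0 \<notin> C" "set_mset transverse_steps \<subseteq> C" "\<forall>\<xi>. (\<forall>v\<in>C. exp (blinfun_apply \<xi> v) \<noteq> 1) \<longrightarrow> vertex_cone_sum L p f \<xi> = G \<xi>"
proof -
  have "\<exists>C. finite C \<and> 0 \<notin> C \<and> (\<forall>\<xi>. (\<forall>v\<in>C. exp (blinfun_apply \<xi> v) \<noteq> 1) \<longrightarrow> 
      cone_gf L (tangent_cone p {s}) \<xi> = expsum (unit_box s) \<xi> / den (edge_steps s) \<xi>)" if s: "s \<in> vertices f" for s
  proof -
    have "exp_sum_represents L (tangent_cone p {s}) (\<lambda>_. 1) (cone_gf L (tangent_cone p {s}))"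
      unfolding cone_gf_def
      by (rule someI[where P = "exp_sum_represents L (tangent_cone p {s}) (\<lambda>_. 1)", OF vertex_cone_represented[OF s]])
    then obtain C where "finite C" "0 \<notin> C" "\<forall>\<xi>. (\<forall>v\<in>C. exp (blinfun_apply \<xi> v) \<noteq> 1) \<longrightarrow> 
      cone_gf L (tangent_cone p {s}) \<xi> = expsum (unit_box s) \<xi> / den (edge_steps s) \<xi>"
      by (rule exp_sum_represents_unique[OF _ vertex_cone_represented[OF s]])
    then show ?thesis by (intro exI[of _ C]) (simp only: simp_thms)
  qed
  then have "\<forall>s\<in>vertices f. \<exists>C. finite C \<and> 0 \<notin> C \<and> (\<forall>\<xi>. (\<forall>v\<in>C. exp (blinfun_apply \<xi> v) \<noteq> 1) \<longrightarrow> 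
      cone_gf L (tangent_cone p {s}) \<xi> = expsum (unit_box s) \<xi> / den (edge_steps s) \<xi>)" by blast
  from bchoice[OF this] obtain C where C: "\<forall>s\<in>vertices f. finite (C s) \<and> 0 \<notin> C s \<and> (\<forall>\<xi>. (\<forall>v\<in>C s. exp (blinfun_apply \<xi> v) \<noteq> 1) \<longrightarrow> 
      cone_gf L (tangent_cone p {s}) \<xi> = expsum (unit_box s) \<xi> / den (edge_steps s) \<xi>)" ..
  define C' where "C' = (\<Union>s\<in>vertices f. C s) \<union> (\<Union>s\<in>vertices f. g s ` act s)"
  have "finite C'" "0 \<notin> C'" using C g_nonzero by (auto simp: C'_def)
  moreover have "set_mset transverse_steps \<subseteq> C'"
  proof
    fix v assume "v \<in> set_mset transverse_steps"
    then obtain s j where v: "s \<in> vertices f" "j \<in> T" "v = g s j" by (auto simp: in_transverse_steps)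
    then have "v \<in> g s ` act s" using T_actD by blast
    then show "v \<in> C'" using v(1) unfolding C'_def by blast
  qed
  moreover have "vertex_cone_sum L p f \<xi> = G \<xi>" if \<xi>: "\<forall>v\<in>C'. exp (blinfun_apply \<xi> v) \<noteq> 1" for \<xi>
  proof -
    have "vertex_cone_sum L p f \<xi> = (\<Sum>s\<in>vertices f. expsum (unit_box s) \<xi> / den (edge_steps s) \<xi>)"
      unfolding vertex_cone_sum_def using C \<xi> by (intro sum.cong refl) (auto simp: C'_def)
    also have "\<dots> = G \<xi>" using \<xi> by (intro sum_vertex_cones) (auto simp: C'_def)
    finally show ?thesis .
  qed
  ultimately show thesis using that by blast
qed

lemma den_transverse_off: "set_mset transverse_steps \<subseteq> C \<Longrightarrow> \<forall>v\<in>C. exp (blinfun_apply \<xi> v) \<noteq> 1 \<Longrightarrow> den transverse_steps \<xi> \<noteq> 0"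
  by (auto simp: den_eq_0_iff)

lemma restricts: "meromorphic_restricts (vertex_cone_sum L p f) (annihilator (lin f)) G"
  unfolding meromorphic_restricts_def
proof (intro ballI exI conjI)
  fix \<xi>0 :: "'a \<Rightarrow>\<^sub>L complex"
  obtain C where C: "finite C" "0 \<notin> C" "set_mset transverse_steps \<subseteq> C" "\<forall>\<xi>. (\<forall>v\<in>C. exp (blinfun_apply \<xi> v) \<noteq> 1) \<longrightarrow> vertex_cone_sum L p f \<xi> = G \<xi>"
    by (rule vertex_cone_sum_eq)
  show "\<xi>0 \<in> UNIV" by simp
  show "local_quotient (vertex_cone_sum L p f) UNIV (expsum numerator) (den transverse_steps)"
    using C den_transverse_off[OF C(3)]
    by (intro local_quotient_off_poles[OF C(1,2)] holomorphic_dual_expsum holomorphic_dual_den) (auto simp: G_def)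
  \<comment> \<open>This functional vanishes on \<open>lin f\<close> and is positive on all transverse edges.\<close>
  define \<kappa> where "\<kappa> = real_functional (\<Sum>j\<in>T. - a j)"
  have "annihilator (lin f) \<subseteq> closure {\<xi>\<in>annihilator (lin f). \<forall>v\<in>set_mset transverse_steps. exp (blinfun_apply \<xi> v) \<noteq> 1}"
  proof (rule dense_off_poles[where \<kappa> = \<kappa>])
    fix \<xi> :: "'a \<Rightarrow>\<^sub>L complex" and t :: real assume "\<xi> \<in> annihilator (lin f)"
    then show "\<xi> + t *\<^sub>R \<kappa> \<in> annihilator (lin f)"
      by (auto simp: annihilator_def lin_eq \<kappa>_def blinfun.add_left blinfun.scaleR_left real_functional.rep_eq inner_sum_left sum_negf)
  next
    fix v assume "v \<in> set_mset transverse_steps"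
    then obtain s j where v: "s \<in> vertices f" "j \<in> T" "v = g s j" by (auto simp: in_transverse_steps)
    have "(\<Sum>j\<in>T. - a j) \<bullet> v = (\<Sum>i\<in>T. if i = j then lam j else 0)"
      unfolding inner_sum_left using v T_act[OF v(1)] a_g[OF v(1), of j] by (intro sum.cong) (auto simp: subset_iff)
    also have "\<dots> = lam j" using v(2) by simp
    finally show "Re (blinfun_apply \<kappa> v) \<noteq> 0" by (simp add: \<kappa>_def real_functional.rep_eq)
  qed simp
  also have "{\<xi>\<in>annihilator (lin f). \<forall>v\<in>set_mset transverse_steps. exp (blinfun_apply \<xi> v) \<noteq> 1} = {\<xi>\<in>UNIV \<inter> annihilator (lin f). den transverse_steps \<xi> \<noteq> 0}"
    by (auto simp: den_eq_0_iff)
  finally show "UNIV \<inter> annihilator (lin f) \<subseteq> closure {\<xi>\<in>UNIV \<inter> annihilator (lin f). den transverse_steps \<xi> \<noteq> 0}" by simp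
qed (auto simp: G_def)

text \<open>
  A real functional that makes some \<open>exp \<langle>\<xi>, g s j\<rangle>\<close> equal to \<open>1\<close> vanishes on this edge, and
  is then constant on a larger face.
\<close>

lemma holomorphic_at_regular:
  assumes real: "\<xi> \<in> real_dual" and ann: "\<xi> \<in> annihilator (lin f)"
    and reg: "\<forall>h. h face_of p \<and> f \<subset> h \<longrightarrow> \<not> blinfun_apply \<xi> constant_on h"
  shows "holomorphic_dual_at (vertex_cone_sum L p f) \<xi>"
proof -
  obtain C where C: "finite C" "0 \<notin> C" "set_mset transverse_steps \<subseteq> C" "\<forall>\<xi>. (\<forall>v\<in>C. exp (blinfun_apply \<xi> v) \<noteq> 1) \<longrightarrow> vertex_cone_sum L p f \<xi> = G \<xi>"
    by (rule vertex_cone_sum_eq)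
  define U where "U = {\<xi> :: 'a \<Rightarrow>\<^sub>L complex. \<forall>v\<in>set_mset transverse_steps. exp (blinfun_apply \<xi> v) \<noteq> 1}"
  have "open U" unfolding U_def by (rule open_off_poles) simp
  have U: "den transverse_steps \<zeta> \<noteq> 0" if "\<zeta> \<in> U" for \<zeta> using that by (auto simp: U_def den_eq_0_iff)
  have "exp (blinfun_apply \<xi> (g s j)) \<noteq> 1" if s: "s \<in> vertices f" and j: "j \<in> T" for s j
  proof
    assume e1: "exp (blinfun_apply \<xi> (g s j)) = 1"
    obtain r where r: "blinfun_apply \<xi> (g s j) = of_real r" using real by (auto simp: real_dual_def Reals_def)
    then have "r = 0" using e1 by (simp add: exp_eq_1)
    then have e0: "blinfun_apply \<xi> (e s j) = 0" using r by (simp add: g_def blinfun.scaleR_right)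
    obtain h where h: "h face_of p" "f \<subset> h" "\<And>x. x \<in> h \<Longrightarrow> x - s - (b j - a j \<bullet> x) *\<^sub>R e s j \<in> lin f"
      using larger_face[OF s j] by blast
    have "blinfun_apply \<xi> x = blinfun_apply \<xi> s" if "x \<in> h" for x
    proof -
      have "blinfun_apply \<xi> (x - s - (b j - a j \<bullet> x) *\<^sub>R e s j) = 0" using ann h(3)[OF that] by (simp add: annihilator_def)
      then show ?thesis by (simp add: blinfun.diff_right blinfun.scaleR_right e0)
    qed
    then have "blinfun_apply \<xi> constant_on h" unfolding constant_on_def by blast
    then show False using reg h by blast
  qed
  then have "\<xi> \<in> U" by (auto simp: U_def in_transverse_steps)
  moreover have "local_quotient (vertex_cone_sum L p f) U G (\<lambda>_. 1)"
    unfolding G_def[abs_def]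
    using C U \<open>open U\<close>
    by (intro local_quotient_off_poles[OF C(1,2)] holomorphic_dual_divide holomorphic_dual_expsum holomorphic_dual_den holomorphic_dual_const)
       (auto simp: G_def)
  ultimately show ?thesis unfolding holomorphic_dual_at_def by blast
qed

end

section \<open>Slices parallel to the face\<close>

context lattice_face
begin

definition s0 :: 'a where "s0 = (SOME s. s \<in> vertices f)"

lemma s0: "s0 \<in> vertices f"
proof -
  obtain s where "s \<in> vertices f" using vertices_f_nonempty by blast
  then show ?thesis unfolding s0_def by (rule someI)
qed

text \<open>
  The generators of the transverse cone; any vertex of \<open>f\<close> gives the same ones.
\<close>

definition u :: "'i \<Rightarrow> 'b" where "u j = blinfun_apply \<pi> (g s0 j)"

lemma \<pi>_g: "s \<in> vertices f \<Longrightarrow> j \<in> T \<Longrightarrow> blinfun_apply \<pi> (g s j) = u j"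
  unfolding u_def \<pi>_eq_iff using a_g T_actD s0 by simp

lemma \<pi>_g_face: "s \<in> vertices f \<Longrightarrow> i \<in> act s - T \<Longrightarrow> blinfun_apply \<pi> (g s i) = 0"
  unfolding \<pi>_eq_0_iff using a_g T_actD by auto

lemma \<alpha>_u: "i \<in> T \<Longrightarrow> j \<in> T \<Longrightarrow> \<alpha> i (u j) = (if i = j then - lam i else 0)"
  unfolding u_def using a_g[OF s0] T_actD[OF s0] by (simp add: \<alpha>_\<pi>)

lemma \<alpha>_sum_u: "i \<in> T \<Longrightarrow> \<alpha> i (\<Sum>j\<in>T. c j *\<^sub>R u j) = - (c i * lam i)"
proof -
  assume i: "i \<in> T"
  have lin: "linear (\<alpha> i)" using bounded_linear_\<alpha> by (rule bounded_linear.linear)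
  have "\<alpha> i (\<Sum>j\<in>T. c j *\<^sub>R u j) = (\<Sum>j\<in>T. c j * \<alpha> i (u j))"
    by (simp add: linear_sum[OF lin] linear_cmul[OF lin])
  also have "\<dots> = (\<Sum>j\<in>T. if j = i then - (c i * lam i) else 0)"
    using i by (intro sum.cong) (auto simp: \<alpha>_u)
  finally show ?thesis using i by simp
qed

lemma inj_u: "inj_on u T"
proof (rule inj_onI)
  fix i j assume ij: "i \<in> T" "j \<in> T" "u i = u j"
  then have "\<alpha> i (u i) = \<alpha> i (u j)" by simp
  then show "i = j" using \<alpha>_u ij(1,2) by (simp split: if_splits)
qed

lemma u_nonzero: "j \<in> T \<Longrightarrow> u j \<noteq> 0"
  using \<alpha>_u[of j j] linear_0[OF bounded_linear.linear[OF bounded_linear_\<alpha>]] by auto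

lemma u_L: "j \<in> T \<Longrightarrow> u j \<in> blinfun_apply \<pi> ` L"
  unfolding u_def using g_L[OF s0] T_actD[OF s0] by blast

lemma independent_u: "independent (u ` T)"
proof (rule independent_if_scalars_zero)
  fix c v assume c: "(\<Sum>v\<in>u ` T. c v *\<^sub>R v) = 0" and v: "v \<in> u ` T"
  then obtain i where i: "i \<in> T" "v = u i" by blast
  have "(\<Sum>j\<in>T. c (u j) *\<^sub>R u j) = 0" using c by (simp add: sum.reindex[OF inj_u])
  then have "\<alpha> i 0 = - (c (u i) * lam i)" using \<alpha>_sum_u[OF i(1), of "\<lambda>j. c (u j)"] by simp
  then show "c v = 0" using linear_0[OF bounded_linear.linear[OF bounded_linear_\<alpha>]] i(2) by simp
qed simp

definition period :: "'b set" where
  "period = range (\<lambda>c :: 'b \<Rightarrow> int. \<Sum>v\<in>u ` T. real_of_int (c v) *\<^sub>R v)"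

lemma lattice_period: "is_lattice period"
  unfolding is_lattice_def period_def using independent_u by blast

lemma period_iff: "w \<in> period \<longleftrightarrow> (\<exists>m :: 'i \<Rightarrow> int. w = (\<Sum>j\<in>T. real_of_int (m j) *\<^sub>R u j))"
proof
  assume "w \<in> period"
  then obtain c :: "'b \<Rightarrow> int" where "w = (\<Sum>v\<in>u ` T. real_of_int (c v) *\<^sub>R v)" unfolding period_def by blast
  then have "w = (\<Sum>j\<in>T. real_of_int (c (u j)) *\<^sub>R u j)" by (simp add: sum.reindex[OF inj_u])
  then show "\<exists>m :: 'i \<Rightarrow> int. w = (\<Sum>j\<in>T. real_of_int (m j) *\<^sub>R u j)" by (rule exI[of _ "\<lambda>j. c (u j)"])
next
  assume "\<exists>m :: 'i \<Rightarrow> int. w = (\<Sum>j\<in>T. real_of_int (m j) *\<^sub>R u j)"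
  then obtain m :: "'i \<Rightarrow> int" where m: "w = (\<Sum>j\<in>T. real_of_int (m j) *\<^sub>R u j)" by blast
  have "w = (\<Sum>v\<in>u ` T. real_of_int (m (the_inv_into T u v)) *\<^sub>R v)"
    unfolding m by (subst sum.reindex[OF inj_u]) (auto intro!: sum.cong simp: the_inv_into_f_f[OF inj_u])
  then show "w \<in> period" unfolding period_def by (rule image_eqI[of _ _ "\<lambda>v. m (the_inv_into T u v)"]) simp
qed

definition P :: "'b \<Rightarrow> real" where "P = push \<pi> (\<lambda>x. ind x * \<Psi> x)"

lemma fibre_finite_\<Psi>: "fibre_finite \<pi> (\<lambda>x. ind x * \<Psi> x)"
  unfolding fibre_finite_def
proof
  fix y
  define R where "R = (\<Sum>j\<in>T. \<bar>(b j - \<alpha> j y) / lam j\<bar>)"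
  have sub: "{x. ind x * \<Psi> x \<noteq> 0 \<and> blinfun_apply \<pi> x = y} \<subseteq> {x. \<Psi> x \<noteq> 0 \<and> (\<forall>j\<in>T. \<bar>t j x\<bar> \<le> R)}"
  proof
    fix x assume "x \<in> {x. ind x * \<Psi> x \<noteq> 0 \<and> blinfun_apply \<pi> x = y}"
    then have x: "\<Psi> x \<noteq> 0" "blinfun_apply \<pi> x = y" by auto
    have "\<bar>t j x\<bar> \<le> R" if j: "j \<in> T" for j
    proof -
      have "\<alpha> j y = a j \<bullet> x" using \<alpha>_\<pi>[OF j, of x] x(2) by simp
      then have "\<bar>t j x\<bar> = \<bar>(b j - \<alpha> j y) / lam j\<bar>" by (simp only: t_def)
      also have "\<dots> \<le> R" unfolding R_def using j by (intro member_le_sum) auto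
      finally show ?thesis .
    qed
    then show "x \<in> {x. \<Psi> x \<noteq> 0 \<and> (\<forall>j\<in>T. \<bar>t j x\<bar> \<le> R)}" using x(1) by blast
  qed
  show "finite {x. ind x * \<Psi> x \<noteq> 0 \<and> blinfun_apply \<pi> x = y}"
    by (rule lattice_finite_bounded[OF lattice bounded_subset[OF bounded_\<Psi> sub]]) (auto simp: ind_def split: if_splits)
qed

lemma total_on_cone: "\<forall>j\<in>T. a j \<bullet> x \<le> b j \<Longrightarrow> total x = ind x * \<Psi> x"
  by (simp add: total_def ind_def)

lemma fibre_finite_total: "fibre_finite \<pi> total"
  unfolding fibre_finite_def
proof
  fix y
  have "{x. total x \<noteq> 0 \<and> blinfun_apply \<pi> x = y} \<subseteq> {x. ind x * \<Psi> x \<noteq> 0 \<and> blinfun_apply \<pi> x = y}"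
    by (auto simp: total_def ind_def split: if_splits)
  then show "finite {x. total x \<noteq> 0 \<and> blinfun_apply \<pi> x = y}"
    using fibre_finite_\<Psi> finite_subset unfolding fibre_finite_def by blast
qed

lemma push_total: "push \<pi> total = (\<lambda>y. if y \<in> blinfun_apply \<pi> ` L \<inter> blinfun_apply \<pi> ` tangent_cone p f then P y else 0)"
proof
  fix y
  show "push \<pi> total y = (if y \<in> blinfun_apply \<pi> ` L \<inter> blinfun_apply \<pi> ` tangent_cone p f then P y else 0)"
  proof (cases "y \<in> blinfun_apply \<pi> ` L \<inter> blinfun_apply \<pi> ` tangent_cone p f")
    case True
    have "total x = ind x * \<Psi> x" if "blinfun_apply \<pi> x = y" for x
    proof (rule total_on_cone)
      have "blinfun_apply \<pi> x \<in> blinfun_apply \<pi> ` tangent_cone p f" using True that by simp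
      then show "\<forall>j\<in>T. a j \<bullet> x \<le> b j" by (simp only: tangent_cone_fibre)
    qed
    then have "push \<pi> total y = P y"
      unfolding push_def P_def by (intro sum.cong) auto
    then show ?thesis using True by simp
  next
    case False
    have "{x. total x \<noteq> 0 \<and> blinfun_apply \<pi> x = y} = {}"
    proof (rule ccontr)
      assume "{x. total x \<noteq> 0 \<and> blinfun_apply \<pi> x = y} \<noteq> {}"
      then obtain x where x: "total x \<noteq> 0" "blinfun_apply \<pi> x = y" by blast
      then have "x \<in> L" "\<forall>j\<in>T. a j \<bullet> x \<le> b j" by (auto simp: total_def split: if_splits)
      then have "y \<in> blinfun_apply \<pi> ` L \<inter> blinfun_apply \<pi> ` tangent_cone p f"
        using x(2) tangent_cone_fibre[of x] by blast
      then show False using False by contradiction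
    qed
    then show ?thesis using False unfolding push_def by (simp only: sum.empty if_False)
  qed
qed

lemma transverse_cone_generators:
  "blinfun_apply \<pi> ` tangent_cone p f = (+) (blinfun_apply \<pi> s0) ` (convex_cone hull (u ` T))"
proof (intro equalityI subsetI)
  fix y assume "y \<in> blinfun_apply \<pi> ` tangent_cone p f"
  then obtain x where x: "x \<in> tangent_cone p f" "y = blinfun_apply \<pi> x" by blast
  have "y = blinfun_apply \<pi> (s0 + (\<Sum>i\<in>act s0. t i x *\<^sub>R g s0 i))" using coordinates[OF s0, of x] x(2) by simp
  also have "\<dots> = blinfun_apply \<pi> s0 + (\<Sum>i\<in>act s0. t i x *\<^sub>R blinfun_apply \<pi> (g s0 i))"
    by (simp add: blinfun.add_right blinfun.sum_right blinfun.scaleR_right)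
  also have "(\<Sum>i\<in>act s0. t i x *\<^sub>R blinfun_apply \<pi> (g s0 i)) = (\<Sum>j\<in>T. t j x *\<^sub>R u j)"
    using T_act[OF s0] by (intro sum.mono_neutral_cong_right) (auto simp: \<pi>_g_face[OF s0] u_def)
  finally have y: "y = blinfun_apply \<pi> s0 + (\<Sum>j\<in>T. t j x *\<^sub>R u j)" .
  have "(\<Sum>j\<in>T. t j x *\<^sub>R u j) \<in> convex_cone hull (u ` T)"
    using x(1) by (intro convex_cone_hull_sum) (auto simp: tangent_cone_face t_nonneg_iff)
  then show "y \<in> (+) (blinfun_apply \<pi> s0) ` (convex_cone hull (u ` T))" unfolding y by (rule imageI)
next
  fix y assume "y \<in> (+) (blinfun_apply \<pi> s0) ` (convex_cone hull (u ` T))"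
  then obtain v where v: "v \<in> convex_cone hull (u ` T)" "y = blinfun_apply \<pi> s0 + v" by blast
  have "convex_cone {v. \<forall>i\<in>T. a i \<bullet> v \<le> 0}"
    unfolding convex_cone_iff by (auto simp: inner_add_right mult_nonneg_nonpos intro: add_nonpos_nonpos)
  then have cc: "convex_cone (blinfun_apply \<pi> ` {v. \<forall>i\<in>T. a i \<bullet> v \<le> 0})"
    by (intro convex_cone_linear_image conjI bounded_linear.linear[OF blinfun.bounded_linear_right])
  have "u ` T \<subseteq> blinfun_apply \<pi> ` {v. \<forall>i\<in>T. a i \<bullet> v \<le> 0}"
  proof
    fix v assume "v \<in> u ` T"
    then obtain j where j: "j \<in> T" "v = blinfun_apply \<pi> (g s0 j)" by (auto simp: u_def)
    have "a i \<bullet> g s0 j \<le> 0" if "i \<in> T" for i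
      using a_g[OF s0 T_actD[OF s0 j(1)] T_actD[OF s0 that]] lam_pos[of j] by simp
    then show "v \<in> blinfun_apply \<pi> ` {v. \<forall>i\<in>T. a i \<bullet> v \<le> 0}" using j(2) by blast
  qed
  then have "convex_cone hull (u ` T) \<subseteq> blinfun_apply \<pi> ` {v. \<forall>i\<in>T. a i \<bullet> v \<le> 0}"
    using cc by (rule hull_minimal)
  then obtain w where w: "\<forall>i\<in>T. a i \<bullet> w \<le> 0" "v = blinfun_apply \<pi> w" using v(1) by blast
  have "a i \<bullet> (s0 + w) \<le> b i" if i: "i \<in> T" for i
    using w(1) i T_actD[OF s0 i] by (simp add: act_def inner_add_right)
  then have "s0 + w \<in> tangent_cone p f" by (simp add: tangent_cone_face)
  moreover have "y = blinfun_apply \<pi> (s0 + w)" using v(2) w(2) by (simp add: blinfun.add_right)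
  ultimately show "y \<in> blinfun_apply \<pi> ` tangent_cone p f" by blast
qed

text \<open>
  Moving the slice by \<open>w\<close> in \<open>period\<close> translates the flipped cone at the vertex \<open>s\<close> by the lattice
  vector \<open>shift s w\<close>, which depends on \<open>s\<close>.
\<close>

definition coeff_u :: "'i \<Rightarrow> 'b \<Rightarrow> real" where "coeff_u j w = - (\<alpha> j w / lam j)"

definition shift :: "'a \<Rightarrow> 'b \<Rightarrow> 'a" where "shift s w = (\<Sum>j\<in>T. coeff_u j w *\<^sub>R g s j)"

lemma shift_period:
  assumes s: "s \<in> vertices f" and w: "w \<in> period"
  shows "shift s w \<in> L" "blinfun_apply \<pi> (shift s w) = w" "\<And>i. i \<in> act s - T \<Longrightarrow> a i \<bullet> shift s w = 0"
proof -
  obtain m :: "'i \<Rightarrow> int" where m: "w = (\<Sum>j\<in>T. real_of_int (m j) *\<^sub>R u j)" using w period_iff by blast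
  have c: "coeff_u j w = real_of_int (m j)" if "j \<in> T" for j
    unfolding coeff_u_def m \<alpha>_sum_u[OF that] by simp
  have eq: "shift s w = (\<Sum>j\<in>T. real_of_int (m j) *\<^sub>R g s j)"
    unfolding shift_def by (intro sum.cong) (auto simp: c)
  show "shift s w \<in> L" unfolding eq using g_L[OF s] T_actD[OF s] by (intro lattice_sum[OF lattice]) auto
  have "blinfun_apply \<pi> (shift s w) = (\<Sum>j\<in>T. real_of_int (m j) *\<^sub>R blinfun_apply \<pi> (g s j))"
    unfolding eq by (simp add: blinfun.sum_right blinfun.scaleR_right)
  also have "\<dots> = w" unfolding m by (intro sum.cong) (auto simp: \<pi>_g[OF s])
  finally show "blinfun_apply \<pi> (shift s w) = w" .
  show "a i \<bullet> shift s w = 0" if i: "i \<in> act s - T" for i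
    unfolding shift_def inner_sum_right using i a_g[OF s] T_actD[OF s] by (intro sum.neutral) auto
qed

definition slice_cone :: "'a \<Rightarrow> 'b \<Rightarrow> 'a \<Rightarrow> 'a \<Rightarrow> real" where
  "slice_cone \<beta> y s x = (if x \<in> L \<and> blinfun_apply \<pi> x = y then 1 else 0) * (\<Prod>i\<in>act s - T. flip_sign \<beta> s i x)"

lemma slice_cone_shift:
  assumes s: "s \<in> vertices f" and w: "w \<in> period"
  shows "slice_cone \<beta> (y + w) s x = slice_cone \<beta> y s (x - shift s w)"
proof -
  have "flip_sign \<beta> s i (x - shift s w) = flip_sign \<beta> s i x" if "i \<in> act s - T" for i
    using shift_period(3)[OF s w that] by (simp add: flip_sign_def inner_diff_right)
  then have "(\<Prod>i\<in>act s - T. flip_sign \<beta> s i (x - shift s w)) = (\<Prod>i\<in>act s - T. flip_sign \<beta> s i x)"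
    by (intro prod.cong) auto
  moreover have "(x - shift s w \<in> L \<and> blinfun_apply \<pi> (x - shift s w) = y) \<longleftrightarrow> (x \<in> L \<and> blinfun_apply \<pi> x = y + w)"
    using lattice_minus_cancel[OF lattice shift_period(1)[OF s w]] shift_period(2)[OF s w]
    by (auto simp: blinfun.diff_right)
  ultimately show ?thesis by (simp only: slice_cone_def)
qed

text \<open>
  On one slice the coordinates in \<open>T\<close> are fixed, and differencing along the edges of \<open>f\<close> at \<open>s\<close> bounds
  the remaining ones.
\<close>

lemma fsupp_slice_cone: 
  assumes s: "s \<in> vertices f" 
  shows "fsupp (mixed_diff face_steps (slice_cone \<beta> y s))"
proof -
  define rest where "rest = (\<Sum>s\<in>vertices f - {s}. image_mset (g s) (mset_set (act s - T)))"
  have split: "face_steps = image_mset (g s) (mset_set (act s - T)) + rest"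
    unfolding face_steps_def rest_def using s by (intro sum.remove) auto
  define k :: "'a \<Rightarrow> real" where "k x = (if x \<in> L \<and> blinfun_apply \<pi> x = y then 1 else 0)" for x
  have k: "k (x - g s i) = k x" if "i \<in> act s - T" for i x
    using that lattice_minus_cancel[OF lattice g_L[OF s]] \<pi>_g_face[OF s that]
    by (auto simp: k_def blinfun.diff_right)
  have "slice_cone \<beta> y s = (\<lambda>x. k x * (\<Prod>i\<in>act s - T. half_line (\<beta> \<bullet> e s i > 0) (t i x)))"
    by (intro ext) (simp only: slice_cone_def k_def flip_sign_half_line)
  then have d: "mixed_diff (image_mset (g s) (mset_set (act s - T))) (slice_cone \<beta> y s)
     = (\<lambda>x. k x * (\<Prod>i\<in>act s - T. if 0 \<le> t i x \<and> t i x < 1 then 1 else 0))"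
    using mixed_diff_halflines[OF s Diff_subset, of T k "\<lambda>i. \<beta> \<bullet> e s i > 0"] k by simp
  define R where "R = 1 + (\<Sum>j\<in>T. \<bar>(b j - \<alpha> j y) / lam j\<bar>)"
  have R1: "1 \<le> R" unfolding R_def by (simp add: sum_nonneg)
  have "fsupp (mixed_diff (image_mset (g s) (mset_set (act s - T))) (slice_cone \<beta> y s))"
  proof (rule fsupp_lattice[OF lattice])
    show "bounded {x. \<forall>i\<in>act s. \<bar>t i x\<bar> \<le> R}" by (rule bounded_coordinates[OF s]) auto
    fix x assume "mixed_diff (image_mset (g s) (mset_set (act s - T))) (slice_cone \<beta> y s) x \<noteq> 0"
    then have x: "x \<in> L" "blinfun_apply \<pi> x = y" "\<forall>i\<in>act s - T. 0 \<le> t i x \<and> t i x < 1"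
      unfolding d k_def by (auto simp: prod_indicator split: if_splits)
    have "\<bar>t i x\<bar> \<le> R" if i: "i \<in> act s" for i
    proof (cases "i \<in> T")
      case True
      then have "\<alpha> i y = a i \<bullet> x" using \<alpha>_\<pi>[OF True, of x] x(2) by simp
      then have "\<bar>t i x\<bar> = \<bar>(b i - \<alpha> i y) / lam i\<bar>" by (simp only: t_def)
      also have "\<dots> \<le> (\<Sum>j\<in>T. \<bar>(b j - \<alpha> j y) / lam j\<bar>)" using True by (intro member_le_sum) auto
      finally show ?thesis by (simp add: R_def)
    next
      case False
      then have "0 \<le> t i x \<and> t i x < 1" using x(3) i by blast
      then show ?thesis using R1 by linarith
    qed
    then show "x \<in> L \<and> x \<in> {x. \<forall>i\<in>act s. \<bar>t i x\<bar> \<le> R}" using x(1) by blast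
  qed
  then show ?thesis unfolding split mixed_diff_union by (rule fsupp_mixed_diff)
qed

lemma sum_supp_translates:
  fixes n :: "'s \<Rightarrow> 'a \<Rightarrow> real"
  assumes "finite V" "\<And>s. s \<in> V \<Longrightarrow> fsupp (n s)"
  shows "(\<Sum>x | (\<Sum>s\<in>V. n s (x - \<tau> s)) \<noteq> 0. (\<Sum>s\<in>V. n s (x - \<tau> s)) * F x) = (\<Sum>s\<in>V. \<Sum>x | n s x \<noteq> 0. n s x * F (x + \<tau> s))"
proof -
  let ?S = "\<Union>s\<in>V. {x. n s (x - \<tau> s) \<noteq> 0}"
  have fin: "finite ?S" using assms fsupp_translate by (auto simp: fsupp_def)
  have "(\<Sum>x | (\<Sum>s\<in>V. n s (x - \<tau> s)) \<noteq> 0. (\<Sum>s\<in>V. n s (x - \<tau> s)) * F x) = (\<Sum>x\<in>?S. (\<Sum>s\<in>V. n s (x - \<tau> s)) * F x)"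
    by (rule sum_supp_eq[OF fin]) (auto intro!: sum.neutral)
  also have "\<dots> = (\<Sum>x\<in>?S. \<Sum>s\<in>V. n s (x - \<tau> s) * F x)" by (simp add: sum_distrib_right)
  also have "\<dots> = (\<Sum>s\<in>V. \<Sum>x\<in>?S. n s (x - \<tau> s) * F x)" by (rule sum.swap)
  also have "\<dots> = (\<Sum>s\<in>V. \<Sum>x | n s (x - \<tau> s) \<noteq> 0. n s (x - \<tau> s) * F x)"
    by (intro sum.cong refl sum_supp_eq[symmetric] fin) auto
  also have "\<dots> = (\<Sum>s\<in>V. \<Sum>x | n s x \<noteq> 0. n s x * F (x + \<tau> s))"
  proof (rule sum.cong[OF refl])
    fix s
    show "(\<Sum>x | n s (x - \<tau> s) \<noteq> 0. n s (x - \<tau> s) * F x) = (\<Sum>x | n s x \<noteq> 0. n s x * F (x + \<tau> s))"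
      using sum_translate_supp[where h = "n s" and v = "\<tau> s" and F = "\<lambda>x. n s (x - \<tau> s) * F x"] by simp
  qed
  finally show ?thesis .
qed

lemma bounded_linear_coeff_u: "bounded_linear (coeff_u j)"
  unfolding coeff_u_def[abs_def]
  by (intro bounded_linear_minus bounded_linear_compose[OF bounded_linear_divide bounded_linear_\<alpha>])

text \<open>
  Differencing along the edges of \<open>f\<close> turns the slice of \<open>\<Psi>\<close> over \<open>y + w\<close> into a sum of fixed finitely
  supported functions, translated by \<open>shift s w\<close>.  By \<open>sum_from_mixed_diff\<close> the value \<open>P (y + w)\<close> is, up
  to a non-zero constant, a \<open>K\<close>-th moment of this sum, which is polynomial in the translations and hence
  in \<open>w\<close>.
\<close>

lemma polynomial_on_coset:
  "\<exists>q. real_polynomial_function q \<and> (\<forall>w\<in>period. P (y + w) = q w)"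
proof -
  obtain \<beta> where gen: "generic \<beta>" using generic_exists[of 1 0] by auto
  define K where "K = size face_steps"
  define c where "c = (\<Prod>v\<in>#face_steps. - (\<beta> \<bullet> v))"
  have "\<beta> \<bullet> v \<noteq> 0" if "v \<in># face_steps" for v
    using that gen by (auto simp: in_face_steps generic_def g_def)
  then have c: "c \<noteq> 0" unfolding c_def by (auto simp: prod_mset_zero_iff)
  define n where "n s = mixed_diff face_steps (slice_cone \<beta> y s)" for s
  have fn: "fsupp (n s)" if "s \<in> vertices f" for s unfolding n_def by (rule fsupp_slice_cone[OF that])
  define q where "q w = (\<Sum>s\<in>vertices f. \<Sum>x | n s x \<noteq> 0. n s x * (\<beta> \<bullet> x + (\<Sum>j\<in>T. coeff_u j w * (\<beta> \<bullet> g s j))) ^ K) / fact K / c" for w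
  have "real_polynomial_function q"
    unfolding q_def[abs_def] divide_inverse
    by (intro real_polynomial_function.intros(2-4) real_polynomial_function_sum real_polynomial_function_power
        real_polynomial_function.intros(1)[OF bounded_linear_coeff_u] finite_T finite_vertices)
       (use fn in \<open>auto simp: fsupp_def\<close>)
  moreover have "P (y + w) = q w" if w: "w \<in> period" for w
  proof -
    define \<psi> where "\<psi> x = (if x \<in> L \<and> blinfun_apply \<pi> x = y + w then 1 else 0) * \<Psi> x" for x
    have supp: "{x. \<psi> x \<noteq> 0} = {x. ind x * \<Psi> x \<noteq> 0 \<and> blinfun_apply \<pi> x = y + w}"
      by (auto simp: \<psi>_def ind_def)
    have f\<psi>: "fsupp \<psi>" unfolding fsupp_def supp using fibre_finite_\<Psi> unfolding fibre_finite_def by blast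
    have P: "(\<Sum>x | \<psi> x \<noteq> 0. \<psi> x) = P (y + w)"
      unfolding supp P_def push_def by (intro sum.cong) (auto simp: \<psi>_def ind_def)
    have "\<psi> = (\<lambda>x. \<Sum>s\<in>vertices f. slice_cone \<beta> (y + w) s x)"
      unfolding \<psi>_def[abs_def] \<Psi>_eq_flipped_cones[OF gen] slice_cone_def sum_distrib_left ..
    also have "\<dots> = (\<lambda>x. \<Sum>s\<in>vertices f. slice_cone \<beta> y s (x - shift s w))"
      by (intro ext sum.cong refl) (rule slice_cone_shift[OF _ w])
    finally have "mixed_diff face_steps \<psi> = (\<lambda>x. \<Sum>s\<in>vertices f. n s (x - shift s w))"
      by (simp add: mixed_diff_sum mixed_diff_translate n_def)
    then have "(\<Sum>x | mixed_diff face_steps \<psi> x \<noteq> 0. mixed_diff face_steps \<psi> x * (\<beta> \<bullet> x) ^ K)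
       = (\<Sum>s\<in>vertices f. \<Sum>x | n s x \<noteq> 0. n s x * (\<beta> \<bullet> (x + shift s w)) ^ K)"
      using sum_supp_translates[of "vertices f" n "\<lambda>s. shift s w" "\<lambda>x. (\<beta> \<bullet> x) ^ K"] fn by simp
    also have "\<dots> = q w * c * fact K"
      using c by (simp add: q_def shift_def inner_add_right inner_sum_right)
    finally have "q w * c = c * P (y + w)"
      using sum_from_mixed_diff[OF f\<psi>, of face_steps \<beta>] unfolding K_def[symmetric] c_def[symmetric] P by simp
    then show ?thesis using c by simp
  qed
  ultimately show ?thesis by blast
qed

lemma period_coset:
  assumes "w \<in> period" shows "(+) (y + w) ` period = (+) y ` period"
proof -
  have "(+) (y + w) ` period = (+) y ` ((+) w ` period)" by (simp add: image_image add.assoc)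
  also have "(+) w ` period = period"
  proof (intro equalityI subsetI)
    fix v assume "v \<in> (+) w ` period"
    then obtain v' where "v' \<in> period" "v = w + v'" by blast
    then show "v \<in> period" using lattice_add[OF lattice_period assms] by simp
  next
    fix v assume "v \<in> period"
    then have "v - w \<in> period" by (rule lattice_diff[OF lattice_period _ assms])
    then show "v \<in> (+) w ` period" by (rule image_eqI[rotated]) simp
  qed
  finally show ?thesis .
qed

lemma quasi_polynomial_P: "quasi_polynomial_on (blinfun_apply \<pi> ` L) P"
  unfolding quasi_polynomial_on_def
proof (intro exI[of _ period] conjI ballI lattice_period polynomial_on_coset)
  show "period \<subseteq> blinfun_apply \<pi> ` L"
  proof
    fix w assume w: "w \<in> period"
    show "w \<in> blinfun_apply \<pi> ` L"
      by (rule image_eqI[where f = "blinfun_apply \<pi>", OF shift_period(2)[OF s0 w, symmetric] shift_period(1)[OF s0 w]])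
  qed
  have span: "\<exists>c. x = (\<Sum>i\<in>act s0. c i *\<^sub>R g s0 i)" for x
  proof -
    have "x + s0 = s0 + (\<Sum>i\<in>act s0. t i (x + s0) *\<^sub>R g s0 i)" by (rule coordinates[OF s0])
    then have "x = (\<Sum>i\<in>act s0. t i (x + s0) *\<^sub>R g s0 i)" by (metis add.commute add_left_cancel)
    then show ?thesis by (rule exI[of _ "\<lambda>i. t i (x + s0)"])
  qed
  obtain R where R: "finite R" "R \<subseteq> L" "\<forall>x\<in>L. \<exists>k :: 'i \<Rightarrow> int. x - (\<Sum>i\<in>act s0. real_of_int (k i) *\<^sub>R g s0 i) \<in> R"
    by (rule lattice_residues[OF lattice finite_act g_L[OF s0] span])
  have "(\<lambda>y. (+) y ` period) ` blinfun_apply \<pi> ` L \<subseteq> (\<lambda>r. (+) (blinfun_apply \<pi> r) ` period) ` R"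
  proof
    fix Y assume "Y \<in> (\<lambda>y. (+) y ` period) ` blinfun_apply \<pi> ` L"
    then obtain x where x: "x \<in> L" "Y = (+) (blinfun_apply \<pi> x) ` period" by blast
    then obtain k :: "'i \<Rightarrow> int" where k: "x - (\<Sum>i\<in>act s0. real_of_int (k i) *\<^sub>R g s0 i) \<in> R" using R(3) by blast
    define r where "r = x - (\<Sum>i\<in>act s0. real_of_int (k i) *\<^sub>R g s0 i)"
    define w where "w = (\<Sum>j\<in>T. real_of_int (k j) *\<^sub>R u j)"
    have "w \<in> period" unfolding w_def period_iff by blast
    have "blinfun_apply \<pi> x - blinfun_apply \<pi> r = (\<Sum>i\<in>act s0. real_of_int (k i) *\<^sub>R blinfun_apply \<pi> (g s0 i))"
      by (simp add: r_def blinfun.diff_right blinfun.sum_right blinfun.scaleR_right)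
    also have "\<dots> = w"
      unfolding w_def using T_act[OF s0] by (intro sum.mono_neutral_cong_right) (auto simp: \<pi>_g_face[OF s0] u_def)
    finally have "blinfun_apply \<pi> x = blinfun_apply \<pi> r + w" by (simp add: algebra_simps)
    then have "Y = (+) (blinfun_apply \<pi> r) ` period" using x(2) period_coset[OF \<open>w \<in> period\<close>] by simp
    then show "Y \<in> (\<lambda>r. (+) (blinfun_apply \<pi> r) ` period) ` R" using k unfolding r_def[symmetric] by blast
  qed
  then show "finite ((\<lambda>y. (+) y ` period) ` blinfun_apply \<pi> ` L)"
    by (rule finite_subset[OF _ finite_imageI[OF R(1)]])
qed

lemma transverse_cone_represented:
  "exp_sum_represents (blinfun_apply \<pi> ` L) (blinfun_apply \<pi> ` tangent_cone p f) P (\<lambda>\<eta>. G (\<eta> o\<^sub>L \<pi>))"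
proof -
  let ?D = "image_mset (blinfun_apply \<pi>) transverse_steps"
  have N: "mixed_diff ?D (push \<pi> total) = push \<pi> numerator"
    using push_mixed_diff[OF fibre_finite_total, of transverse_steps] by (simp add: numerator_def)
  have fN: "fsupp numerator" unfolding numerator_def by (rule fsupp_transverse)
  have "exp_sum_represents (blinfun_apply \<pi> ` L) (blinfun_apply \<pi> ` tangent_cone p f) P 
     (\<lambda>\<eta>. expsum (mixed_diff ?D (\<lambda>y. if y \<in> blinfun_apply \<pi> ` L \<inter> blinfun_apply \<pi> ` tangent_cone p f then P y else 0)) \<eta> / den ?D \<eta>)"
  proof (rule exp_sum_representsI[OF quasi_polynomial_P _ _ transverse_cone_generators])
    show "u ` T \<subseteq> blinfun_apply \<pi> ` L - {0}" using u_L u_nonzero by auto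
    show "set_mset ?D \<subseteq> u ` T" using \<pi>_g by (auto simp: in_transverse_steps)
    show "fsupp (mixed_diff ?D (\<lambda>y. if y \<in> blinfun_apply \<pi> ` L \<inter> blinfun_apply \<pi> ` tangent_cone p f then P y else 0))"
      unfolding push_total[symmetric] N by (rule fsupp_push[OF fN])
  qed simp
  then show ?thesis
    unfolding push_total[symmetric] N G_def expsum_push[OF fN] den_image .
qed

text \<open>
  When the shifted vertices lie in \<open>p\<close>, so does the support of \<open>\<Psi>\<close> on the slice, and \<open>\<Psi>\<close> is \<open>1\<close> on \<open>p\<close>.
\<close>

lemma P_counts_slice:
  assumes "\<And>x s. blinfun_apply \<pi> x = y \<Longrightarrow> s \<in> vertices f \<Longrightarrow> vertex_shift s x \<in> p"
  shows "P y = real (card (L \<inter> (p \<inter> {x. blinfun_apply \<pi> x = y})))"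
proof -
  have "{x. ind x * \<Psi> x \<noteq> 0 \<and> blinfun_apply \<pi> x = y} = L \<inter> (p \<inter> {x. blinfun_apply \<pi> x = y})"
  proof (intro equalityI subsetI)
    fix x assume x: "x \<in> {x. ind x * \<Psi> x \<noteq> 0 \<and> blinfun_apply \<pi> x = y}"
    then have "x \<in> L" "\<Psi> x \<noteq> 0" by (auto simp: ind_def split: if_splits)
    moreover have "convex hull ((\<lambda>s. vertex_shift s x) ` vertices f) \<subseteq> p"
      using assms x by (intro hull_minimal convex_p) auto
    ultimately show "x \<in> L \<inter> (p \<inter> {x. blinfun_apply \<pi> x = y})" using \<Psi>_support x by blast
  next
    fix x assume "x \<in> L \<inter> (p \<inter> {x. blinfun_apply \<pi> x = y})"
    then show "x \<in> {x. ind x * \<Psi> x \<noteq> 0 \<and> blinfun_apply \<pi> x = y}" by (auto simp: ind_def \<Psi>_on_p)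
  qed
  then have "P y = (\<Sum>x\<in>L \<inter> (p \<inter> {x. blinfun_apply \<pi> x = y}). ind x * \<Psi> x)"
    unfolding P_def push_def by simp
  also have "\<dots> = (\<Sum>x\<in>L \<inter> (p \<inter> {x. blinfun_apply \<pi> x = y}). 1)"
    by (intro sum.cong) (auto simp: ind_def \<Psi>_on_p)
  finally show ?thesis by simp
qed

end

section \<open>Facet description of a simple polytope\<close>

text \<open>
  A segment from an interior point to a point outside leaves \<open>p\<close> through some facet, whose inequality
  the outer point violates.
\<close>

lemma facet_inequalities:
  fixes p :: "'a::euclidean_space set"
  assumes poly: "polytope p" and full: "aff_dim p = int DIM('a)"
  obtains a b where "\<And>F. F facet_of p \<Longrightarrow> p \<subseteq> {x. a F \<bullet> x \<le> b F} \<and> F = p \<inter> {x. a F \<bullet> x = b F}"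
    "p = {x. \<forall>F\<in>{F. F facet_of p}. a F \<bullet> x \<le> b F}"
proof -
  have ph: "polyhedron p" using poly by (rule polytope_imp_polyhedron)
  have conv: "convex p" and clo: "closed p" using ph polyhedron_imp_convex polyhedron_imp_closed by auto
  have "\<exists>a b. p \<subseteq> {x. a \<bullet> x \<le> b} \<and> F = p \<inter> {x. a \<bullet> x = b}" if "F facet_of p" for F
  proof -
    have "F exposed_face_of p" using exposed_face_of_polyhedron[OF ph] facet_of_imp_face_of[OF that] by blast
    then show ?thesis unfolding exposed_face_of_def by blast
  qed
  then obtain a b where ab: "\<And>F. F facet_of p \<Longrightarrow> p \<subseteq> {x. a F \<bullet> x \<le> b F} \<and> F = p \<inter> {x. a F \<bullet> x = b F}"
    by metis
  have aff: "affine hull p = UNIV" using full aff_dim_eq_full by blast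
  have ne: "p \<noteq> {}" using full by auto
  have "interior p \<noteq> {}"
    using rel_interior_interior[OF aff] rel_interior_eq_empty[OF conv] ne by simp
  then obtain x0 where x0: "x0 \<in> interior p" by blast
  have "x \<in> p" if x: "\<forall>F\<in>{F. F facet_of p}. a F \<bullet> x \<le> b F" for x
  proof (rule ccontr)
    assume "x \<notin> p"
    have "closed_segment x0 x \<inter> frontier p \<noteq> {}"
    proof (rule connected_Int_frontier)
      show "closed_segment x0 x \<inter> p \<noteq> {}" using x0 interior_subset by fastforce
      show "closed_segment x0 x - p \<noteq> {}" using \<open>x \<notin> p\<close> by auto
    qed auto
    then obtain z where z: "z \<in> closed_segment x0 x" "z \<in> frontier p" by blast
    have "z \<in> p" using z(2) clo frontier_subset_closed by blast
    have "z \<in> rel_frontier p" using z(2) rel_frontier_frontier[OF aff] by simp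
    then obtain F where F: "F facet_of p" "z \<in> F" using rel_frontier_of_polyhedron[OF ph] by blast
    have a0: "a F \<noteq> 0"
    proof
      assume "a F = 0"
      then have "F = p \<inter> (if b F = 0 then UNIV else {})" using ab[OF F(1)] by auto
      then have "F = p \<or> F = {}" by (simp split: if_splits)
      then show False using F(1) by (auto simp: facet_of_def)
    qed
    have "interior p \<subseteq> interior {x. a F \<bullet> x \<le> b F}" using ab[OF F(1)] by (intro interior_mono) auto
    then have lt: "a F \<bullet> x0 < b F" using x0 interior_halfspace_le[OF a0] by auto
    have eq: "a F \<bullet> z = b F" using F(2) ab[OF F(1)] by blast
    obtain t where t: "0 \<le> t" "t \<le> 1" "z = (1 - t) *\<^sub>R x0 + t *\<^sub>R x" using z(1) by (auto simp: in_segment)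
    have le: "a F \<bullet> x \<le> b F" using x F(1) by blast
    have sum0: "(1 - t) * (b F - a F \<bullet> x0) + t * (b F - a F \<bullet> x) = 0"
      using eq t(3) by (simp add: inner_add_right algebra_simps)
    moreover have "0 \<le> (1 - t) * (b F - a F \<bullet> x0)" "0 \<le> t * (b F - a F \<bullet> x)" using t lt le by auto
    ultimately have "(1 - t) * (b F - a F \<bullet> x0) = 0" by linarith
    then have "t = 1" using lt by simp
    then have "z = x" using t(3) by simp
    then show False using \<open>z \<in> p\<close> \<open>x \<notin> p\<close> by simp
  qed
  then have "p = {x. \<forall>F\<in>{F. F facet_of p}. a F \<bullet> x \<le> b F}" using ab by blast
  then show thesis using that ab by blast
qed

lemma simple_polytope_face_facets:
  fixes p :: "'a::euclidean_space set"
  assumes simple: "simple_polytope p" and face: "f face_of p" and ne: "f \<noteq> {}"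
  obtains a b where "simple_polytope_face p f {F. F facet_of p} a b"
proof -
  have poly: "polytope p" and full: "aff_dim p = int DIM('a)" 
    and card: "\<And>s. s \<in> vertices p \<Longrightarrow> card {F. F facet_of p \<and> s \<in> F} = DIM('a)"
    using simple by (auto simp: simple_polytope_def)
  have ph: "polyhedron p" using poly by (rule polytope_imp_polyhedron)
  obtain a b where ab: "\<And>F. F facet_of p \<Longrightarrow> p \<subseteq> {x. a F \<bullet> x \<le> b F} \<and> F = p \<inter> {x. a F \<bullet> x = b F}"
    and p: "p = {x. \<forall>F\<in>{F. F facet_of p}. a F \<bullet> x \<le> b F}"
    using facet_inequalities[OF poly full] by blast
  have "simple_polytope_face p f {F. F facet_of p} a b"
  proof
    show "finite {F. F facet_of p}" by (rule finite_polytope_facets[OF poly])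
    show "f = {x\<in>p. \<forall>i\<in>{F. F facet_of p}. (\<forall>z\<in>f. a i \<bullet> z = b i) \<longrightarrow> a i \<bullet> x = b i}" (is "f = ?R")
    proof (intro equalityI subsetI)
      fix x assume "x \<in> f"
      then show "x \<in> ?R" using face_of_imp_subset[OF face] by blast
    next
      fix x assume x: "x \<in> ?R"
      show "x \<in> f"
      proof (cases "f = p")
        case True
        then show ?thesis using x by blast
      next
        case False
        have "f = \<Inter>{h. h facet_of p \<and> f \<subseteq> h}" by (rule face_of_polyhedron[OF ph face ne False])
        moreover have "x \<in> h" if h: "h facet_of p" "f \<subseteq> h" for h
        proof -
          have "\<forall>z\<in>f. a h \<bullet> z = b h" using ab[OF h(1)] h(2) by blast
          then have "a h \<bullet> x = b h" using x h(1) by blast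
          then show ?thesis using x ab[OF h(1)] by blast
        qed
        ultimately show ?thesis by blast
      qed
    qed
    show "card {i \<in> {F. F facet_of p}. a i \<bullet> s = b i} = DIM('a)" if s: "s \<in> vertices p" for s
    proof -
      have "s \<in> p" using s by (simp add: vertices_def extreme_point_of_def)
      then have "{i \<in> {F. F facet_of p}. a i \<bullet> s = b i} = {F. F facet_of p \<and> s \<in> F}" using ab by blast
      then show ?thesis using card[OF s] by simp
    qed
  qed (use p poly face ne in auto)
  then show thesis by (rule that)
qed

theorem theorem58:
  fixes p f :: "'a::euclidean_space set"
    and \<pi> :: "'a \<Rightarrow>\<^sub>L 'b::euclidean_space"
  assumes "simple_polytope p"
    and "f face_of p" and "f \<noteq> {}"
    and "realizes_quotient \<pi> (lin f)"
  shows "\<exists>\<epsilon>>0. \<forall>L. is_full_lattice L \<and> rational_polytope L p \<longrightarrow>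
    (\<exists>P G.
      quasi_polynomial_on (\<pi> ` L) P \<and>
      meromorphic_restricts (vertex_cone_sum L p f) (annihilator (lin f)) G \<and>
      exp_sum_represents (\<pi> ` L) (\<pi> ` tangent_cone p f) P (\<lambda>\<eta>. G (\<eta> o\<^sub>L \<pi>)) \<and>
      (\<forall>\<xi> \<in> real_dual \<inter> annihilator (lin f).
         (\<forall>h. h face_of p \<and> f \<subset> h \<longrightarrow> \<not> blinfun_apply \<xi> constant_on h) \<longrightarrow>
         holomorphic_dual_at (vertex_cone_sum L p f) \<xi>) \<and>
      (\<forall>y \<in> \<pi> ` tangent_cone p f \<inter> \<pi> ` L. \<forall>y0 \<in> \<pi> ` f. dist y y0 < \<epsilon> \<longrightarrow>
         P y = real (card (L \<inter> (p \<inter> {x. \<pi> x = y})))))"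
proof -
  obtain a b where "simple_polytope_face p f {F. F facet_of p} a b"
    by (rule simple_polytope_face_facets[OF assms(1-3)])
  then interpret spf: simple_polytope_face p f "{F. F facet_of p}" a b .
  interpret qf: quotient_face p f "{F. F facet_of p}" a b \<pi>
    by standard (use assms(4) in \<open>simp add: realizes_quotient_def\<close>)
  obtain \<epsilon> where \<epsilon>: "\<epsilon> > 0" "\<And>x z s. \<forall>j\<in>spf.T. a j \<bullet> x \<le> b j \<Longrightarrow> z \<in> f \<Longrightarrow> dist (blinfun_apply \<pi> x) (blinfun_apply \<pi> z) < \<epsilon> \<Longrightarrow>
    s \<in> vertices f \<Longrightarrow> spf.vertex_shift s x \<in> p"
    using qf.near_vertex_image by blast
  show ?thesis
  proof (intro exI[of _ \<epsilon>] conjI allI impI \<epsilon>(1))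
    fix L :: "'a set" assume L: "is_full_lattice L \<and> rational_polytope L p"
    have "\<forall>i. \<exists>\<mu>>0. \<forall>s\<in>vertices f. i \<in> spf.act s \<longrightarrow> \<mu> *\<^sub>R spf.e s i \<in> L"
      using spf.common_edge_scaling L by blast
    then obtain lam where lam: "\<And>i. lam i > 0" "\<And>i s. s \<in> vertices f \<Longrightarrow> i \<in> spf.act s \<Longrightarrow> lam i *\<^sub>R spf.e s i \<in> L"
      by metis
    interpret lf: lattice_face p f "{F. F facet_of p}" a b \<pi> L lam
      by standard (use L lam in \<open>auto simp: is_full_lattice_def\<close>)
    show "\<exists>P G. quasi_polynomial_on (\<pi> ` L) P \<and>
      meromorphic_restricts (vertex_cone_sum L p f) (annihilator (lin f)) G \<and>
      exp_sum_represents (\<pi> ` L) (\<pi> ` tangent_cone p f) P (\<lambda>\<eta>. G (\<eta> o\<^sub>L \<pi>)) \<and>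
      (\<forall>\<xi> \<in> real_dual \<inter> annihilator (lin f).
         (\<forall>h. h face_of p \<and> f \<subset> h \<longrightarrow> \<not> blinfun_apply \<xi> constant_on h) \<longrightarrow>
         holomorphic_dual_at (vertex_cone_sum L p f) \<xi>) \<and>
      (\<forall>y \<in> \<pi> ` tangent_cone p f \<inter> \<pi> ` L. \<forall>y0 \<in> \<pi> ` f. dist y y0 < \<epsilon> \<longrightarrow>
         P y = real (card (L \<inter> (p \<inter> {x. \<pi> x = y}))))"
    proof (intro exI[of _ lf.P] exI[of _ lf.G] conjI lf.quasi_polynomial_P lf.restricts lf.transverse_cone_represented ballI impI)
      fix \<xi> assume "\<xi> \<in> real_dual \<inter> annihilator (lin f)"
        "\<forall>h. h face_of p \<and> f \<subset> h \<longrightarrow> \<not> blinfun_apply \<xi> constant_on h"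
      then show "holomorphic_dual_at (vertex_cone_sum L p f) \<xi>" using lf.holomorphic_at_regular by blast
    next
      fix y y0 assume y: "y \<in> \<pi> ` tangent_cone p f \<inter> \<pi> ` L" and y0: "y0 \<in> \<pi> ` f" and d: "dist y y0 < \<epsilon>"
      obtain z where z: "z \<in> f" "y0 = \<pi> z" using y0 by blast
      show "lf.P y = real (card (L \<inter> (p \<inter> {x. \<pi> x = y})))"
      proof (rule lf.P_counts_slice)
        fix x s assume x: "\<pi> x = y" and s: "s \<in> vertices f"
        have "\<forall>j\<in>spf.T. a j \<bullet> x \<le> b j" using y x qf.tangent_cone_fibre[of x] by blast
        then show "spf.vertex_shift s x \<in> p" using z d x s by (intro \<epsilon>(2)[of x z]) auto
      qed
    qed
  qed
qed

end
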